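(* Let $k$ be a field and let $\mathcal C$ be a Hom-finite Krull–Schmidt 0-Auslander extriangulated $k$-category with a basic projective silting object $T$. Then $\mathfrak F_{\mathbf g}(\mathcal C)=\{\mathbf C(X): X\text{ presilting in }\mathcal C\}$ is a rational and simplicial polyhedral fan (in $K_0(\mathrm{add}\,T)_{\mathbb R}$).
   Context: **Extriangulated categories.** An extriangulated $k$-category $(\mathcal C,\mathbb E)$ is in the sense of Nakaoka–Palu: an additive $k$-category with a $k$-linear bifunctor $\mathbb E:\mathcal C^{\mathrm{op}}\times\mathcal C\to\mathrm{Mod}(k)$ and an exact realisation satisfying (ET1)–(ET4)$^{\mathrm{op}}$. Realised sequences $A\to B\to C$ are conflations; the first map is an inflation (with cone $C$), the second a deflation (with cocone $A$); a conflation with its class in $\mathbb E(C,A)$ is an $\mathbb E$-triangle. $X$ is projective if $\mathbb E(X,-)=0$, injective if $\mathbb E(-,X)=0$, projective-injective if both. $\mathcal C$ is 0-Auslander if it has enough projectives (every $X$ receives a deflation from a projective), is hereditary (every $X$ has an $\mathbb E$-triangle $P_1\to P_0\to X$ with $P_0,P_1$ projective), and every projective admits an inflation into a projective-injective object. A thick subcategory is a full subcategory closed under isomorphisms, direct summands, extensions, cones and cocones; $\mathrm{thick}(X)$ is the smallest one containing $X$. $U$ is presilting if $\mathbb E(U,U)=0$, and silting if moreover $\mathrm{thick}(U)=\mathcal C$. An object is basic if its indecomposable summands are pairwise non-isomorphic. **$\mathbf g$-vectors.** For $X\in\mathcal C$ choose an $\mathbb E$-triangle $T_1^X\to T_0^X\to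 X$ with $T_i^X\in\mathrm{add}(T)$ and put $\mathrm{ind}_T(X)=[T_0^X]-[T_1^X]\in K_0(\mathrm{add}\,T)$, the split Grothendieck group (free on the classes of the indecomposable summands of $T$); this is independent of the choice. Put $\mathbf g^X=\mathrm{ind}_T(X)\otimes1\in K_0(\mathrm{add}\,T)_{\mathbb R}:=K_0(\mathrm{add}\,T)\otimes_{\mathbb Z}\mathbb R$. For $X$ presilting with indecomposable direct summands $X_1,\dots,X_\ell$, $\mathbf C(X)$ is the non-negative span of $\{\mathbf g^{X_i}\}_{i=1}^\ell$. **Fans.** A polyhedral fan in $N_{\mathbb R}$ ($N$ a lattice of finite rank) is a (possibly infinite) family of strongly convex polyhedral cones (non-negative spans of finite sets containing no positive-dimensional subspace) closed under taking faces and such that the intersection of any two cones is a face of both. It is simplicial if every cone is the non-negative span of a linearly independent set, and rational if every cone is the non-negative span of finitely many vectors in $N$ (here $N=K_0(\mathrm{add}\,T)$). *)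

theory Defs
  imports "HOL-Analysis.Analysis" "HOL-Analysis.Finite_Function_Topology" "HOL-Algebra.Free_Abelian_Groups"
begin

section \<open>Linear and additive categories\<close>

text \<open>
  A category is given on a type \<open>'o\<close> of objects. Its morphism spaces \<open>mor C X Y\<close> are subspaces of one
  ambient vector space \<open>'m\<close> over the field \<open>'k\<close>, with scalar multiplication \<open>hscale C\<close>. This is no
  restriction: arbitrary spaces \<open>Hom(X,Y)\<close> embed into their direct sum over all pairs \<open>(X,Y)\<close>, where
  distinct summands share only the zero morphism, whose composites are all zero. Consequently sums of
  morphisms are written with the type-class operations, and composition needs no object arguments.
  The operations \<open>cmp\<close> (\<open>g \<cdot> f\<close> is \<open>f\<close> followed by \<open>g\<close>), \<open>push\<close> and \<open>pull\<close> below are constrained only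
  on composable arguments. The same encoding is used for the spaces \<open>ext C Z A\<close>, standing for
  \<open>\<E>(Z,A)\<close>, inside \<open>'e\<close>.
\<close>

record ('k, 'o, 'm) lincat =
  mor :: "'o \<Rightarrow> 'o \<Rightarrow> 'm set"
  cmp :: "'m \<Rightarrow> 'm \<Rightarrow> 'm"  (infixl \<open>\<cdot>\<index>\<close> 75)
  idn :: "'o \<Rightarrow> 'm"
  hscale :: "'k \<Rightarrow> 'm \<Rightarrow> 'm"

locale linear_category =
  fixes C :: "('k::field, 'o, 'm::ab_group_add, 'z) lincat_scheme" (structure)
  assumes mor_vector_space: "vector_space (hscale C)"
    and mor_subspace: "module.subspace (hscale C) (mor C X Y)"
    and idn_mor: "idn C X \<in> mor C X X"
    and cmp_mor: "\<lbrakk>g \<in> mor C Y Z; f \<in> mor C X Y\<rbrakk> \<Longrightarrow> g \<cdot> f \<in> mor C X Z"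
    and idn_left: "f \<in> mor C X Y \<Longrightarrow> idn C Y \<cdot> f = f"
    and idn_right: "f \<in> mor C X Y \<Longrightarrow> f \<cdot> idn C X = f"
    and cmp_assoc: "\<lbrakk>h \<in> mor C Z W; g \<in> mor C Y Z; f \<in> mor C X Y\<rbrakk> \<Longrightarrow> (h \<cdot> g) \<cdot> f = h \<cdot> (g \<cdot> f)"
    and cmp_add_left: "\<lbrakk>g \<in> mor C Y Z; g' \<in> mor C Y Z; f \<in> mor C X Y\<rbrakk>
          \<Longrightarrow> (g + g') \<cdot> f = g \<cdot> f + g' \<cdot> f"
    and cmp_add_right: "\<lbrakk>g \<in> mor C Y Z; f \<in> mor C X Y; f' \<in> mor C X Y\<rbrakk>
          \<Longrightarrow> g \<cdot> (f + f') = g \<cdot> f + g \<cdot> f'"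
    and cmp_scale_left: "\<lbrakk>g \<in> mor C Y Z; f \<in> mor C X Y\<rbrakk>
          \<Longrightarrow> hscale C r g \<cdot> f = hscale C r (g \<cdot> f)"
    and cmp_scale_right: "\<lbrakk>g \<in> mor C Y Z; f \<in> mor C X Y\<rbrakk>
          \<Longrightarrow> g \<cdot> hscale C r f = hscale C r (g \<cdot> f)"

definition is_iso :: "('k, 'o, 'm, 'z) lincat_scheme \<Rightarrow> 'm \<Rightarrow> 'o \<Rightarrow> 'o \<Rightarrow> bool" where
  "is_iso C f X Y \<longleftrightarrow> f \<in> mor C X Y \<and>
     (\<exists>g \<in> mor C Y X. g \<cdot>\<^bsub>C\<^esub> f = idn C X \<and> f \<cdot>\<^bsub>C\<^esub> g = idn C Y)"

definition isomorphic :: "('k, 'o, 'm, 'z) lincat_scheme \<Rightarrow> 'o \<Rightarrow> 'o \<Rightarrow> bool" where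
  "isomorphic C X Y \<longleftrightarrow> (\<exists>f. is_iso C f X Y)"

definition iso_class :: "('k, 'o, 'm, 'z) lincat_scheme \<Rightarrow> 'o \<Rightarrow> 'o set" where
  "iso_class C X = {Y. isomorphic C X Y}"

definition zero_object :: "('k, 'o, 'm::zero, 'z) lincat_scheme \<Rightarrow> 'o \<Rightarrow> bool" where
  "zero_object C X \<longleftrightarrow> (\<forall>Y. mor C X Y = {0} \<and> mor C Y X = {0})"

definition biproduct ::
    "('k, 'o, 'm::ab_group_add, 'z) lincat_scheme \<Rightarrow> 'o \<Rightarrow> 'o list \<Rightarrow> (nat \<Rightarrow> 'm) \<Rightarrow> (nat \<Rightarrow> 'm) \<Rightarrow> bool" where
  "biproduct C X Xs i p \<longleftrightarrow>
     (\<forall>j < length Xs. i j \<in> mor C (Xs ! j) X \<and> p j \<in> mor C X (Xs ! j)) \<and>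
     (\<forall>j < length Xs. \<forall>l < length Xs.
        p j \<cdot>\<^bsub>C\<^esub> i l = (if j = l then idn C (Xs ! j) else 0)) \<and>
     (\<Sum>j < length Xs. i j \<cdot>\<^bsub>C\<^esub> p j) = idn C X"

definition direct_sum :: "('k, 'o, 'm::ab_group_add, 'z) lincat_scheme \<Rightarrow> 'o \<Rightarrow> 'o list \<Rightarrow> bool" where
  "direct_sum C X Xs \<longleftrightarrow> (\<exists>i p. biproduct C X Xs i p)"

definition summand :: "('k, 'o, 'm::ab_group_add, 'z) lincat_scheme \<Rightarrow> 'o \<Rightarrow> 'o \<Rightarrow> bool" where
  "summand C Y X \<longleftrightarrow> (\<exists>Z. direct_sum C X [Y, Z])"

definition indecomposable :: "('k, 'o, 'm::ab_group_add, 'z) lincat_scheme \<Rightarrow> 'o \<Rightarrow> bool" where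
  "indecomposable C X \<longleftrightarrow> \<not> zero_object C X \<and>
     (\<forall>Y Z. direct_sum C X [Y, Z] \<longrightarrow> zero_object C Y \<or> zero_object C Z)"

definition basic :: "('k, 'o, 'm::ab_group_add, 'z) lincat_scheme \<Rightarrow> 'o \<Rightarrow> bool" where
  "basic C X \<longleftrightarrow> (\<forall>Xs. direct_sum C X Xs \<and> (\<forall>Y \<in> set Xs. indecomposable C Y) \<longrightarrow>
     (\<forall>j < length Xs. \<forall>l < length Xs. j \<noteq> l \<longrightarrow> \<not> isomorphic C (Xs ! j) (Xs ! l)))"

definition add_of :: "('k, 'o, 'm::ab_group_add, 'z) lincat_scheme \<Rightarrow> 'o \<Rightarrow> 'o set" where
  "add_of C T = {X. \<exists>n Y. direct_sum C Y (replicate n T) \<and> summand C X Y}"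

locale additive_category = linear_category C
  for C :: "('k::field, 'o, 'm::ab_group_add, 'z) lincat_scheme" (structure) +
  assumes ex_zero_object: "\<exists>Z. zero_object C Z"
    and ex_binary_sum: "\<exists>S. direct_sum C S [X, Y]"

definition hom_finite :: "('k::field, 'o, 'm::ab_group_add, 'z) lincat_scheme \<Rightarrow> bool" where
  "hom_finite C \<longleftrightarrow> (\<forall>X Y. \<exists>B. finite B \<and> module.span (hscale C) B = mor C X Y)"

definition local_end :: "('k, 'o, 'm::ab_group_add, 'z) lincat_scheme \<Rightarrow> 'o \<Rightarrow> bool" where
  "local_end C X \<longleftrightarrow> idn C X \<noteq> 0 \<and>
     (\<forall>f \<in> mor C X X. \<forall>g \<in> mor C X X.
        \<not> is_iso C f X X \<and> \<not> is_iso C g X X \<longrightarrow> \<not> is_iso C (f + g) X X)"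

definition krull_schmidt :: "('k, 'o, 'm::ab_group_add, 'z) lincat_scheme \<Rightarrow> bool" where
  "krull_schmidt C \<longleftrightarrow> (\<forall>X. \<exists>Xs. direct_sum C X Xs \<and> (\<forall>Y \<in> set Xs. local_end C Y))"


section \<open>Extriangulated categories\<close>

text \<open>
  \<open>push C a \<delta>\<close> is \<open>a\<^sub>*\<delta>\<close> and \<open>pull C c \<delta>\<close> is \<open>c\<^sup>*\<delta>\<close>. \<open>realn C Z A \<delta>\<close> is the set of sequences
  \<open>A \<rightarrow> B \<rightarrow> Z\<close>, encoded as triples \<open>(B, x, y)\<close>, that realise \<open>\<delta> \<in> \<E>(Z,A)\<close>.
\<close>

record ('k, 'o, 'm, 'e) extricat = "('k, 'o, 'm) lincat" +
  ext :: "'o \<Rightarrow> 'o \<Rightarrow> 'e set"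
  push :: "'m \<Rightarrow> 'e \<Rightarrow> 'e"
  pull :: "'m \<Rightarrow> 'e \<Rightarrow> 'e"
  escale :: "'k \<Rightarrow> 'e \<Rightarrow> 'e"
  realn :: "'o \<Rightarrow> 'o \<Rightarrow> 'e \<Rightarrow> ('o \<times> 'm \<times> 'm) set"

definition seqs :: "('k, 'o, 'm, 'z) lincat_scheme \<Rightarrow> 'o \<Rightarrow> 'o \<Rightarrow> ('o \<times> 'm \<times> 'm) set" where
  "seqs C A Z = {(B, x, y). x \<in> mor C A B \<and> y \<in> mor C B Z}"

definition seq_equiv ::
    "('k, 'o, 'm, 'z) lincat_scheme \<Rightarrow> 'o \<Rightarrow> 'o \<Rightarrow> (('o \<times> 'm \<times> 'm) \<times> ('o \<times> 'm \<times> 'm)) set" where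
  "seq_equiv C A Z = {((B, x, y), (B', x', y')).
     (B, x, y) \<in> seqs C A Z \<and> (B', x', y') \<in> seqs C A Z \<and>
     (\<exists>b. is_iso C b B B' \<and> b \<cdot>\<^bsub>C\<^esub> x = x' \<and> y' \<cdot>\<^bsub>C\<^esub> b = y)}"

definition etri ::
    "('k, 'o, 'm, 'e, 'z) extricat_scheme \<Rightarrow> 'o \<Rightarrow> 'o \<Rightarrow> 'o \<Rightarrow> 'm \<Rightarrow> 'm \<Rightarrow> 'e \<Rightarrow> bool" where
  "etri C A B Z x y \<delta> \<longleftrightarrow> \<delta> \<in> ext C Z A \<and> (B, x, y) \<in> realn C Z A \<delta>"

definition conflation ::
    "('k, 'o, 'm, 'e, 'z) extricat_scheme \<Rightarrow> 'o \<Rightarrow> 'o \<Rightarrow> 'o \<Rightarrow> 'm \<Rightarrow> 'm \<Rightarrow> bool" where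
  "conflation C A B Z x y \<longleftrightarrow> (\<exists>\<delta>. etri C A B Z x y \<delta>)"

locale extriangulated_category = additive_category C
  for C :: "('k::field, 'o, 'm::ab_group_add, 'e::ab_group_add, 'z) extricat_scheme" (structure) +
  assumes ext_vector_space: "vector_space (escale C)"
    and ext_subspace: "module.subspace (escale C) (ext C Z A)"
    \<comment> \<open>(ET1): a bilinear bifunctor, contravariant in the first argument\<close>
    and push_ext: "\<lbrakk>a \<in> mor C A A'; \<delta> \<in> ext C Z A\<rbrakk> \<Longrightarrow> push C a \<delta> \<in> ext C Z A'"
    and pull_ext: "\<lbrakk>c \<in> mor C Z' Z; \<delta> \<in> ext C Z A\<rbrakk> \<Longrightarrow> pull C c \<delta> \<in> ext C Z' A"
    and push_idn: "\<delta> \<in> ext C Z A \<Longrightarrow> push C (idn C A) \<delta> = \<delta>"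
    and pull_idn: "\<delta> \<in> ext C Z A \<Longrightarrow> pull C (idn C Z) \<delta> = \<delta>"
    and push_cmp: "\<lbrakk>a' \<in> mor C A' A''; a \<in> mor C A A'; \<delta> \<in> ext C Z A\<rbrakk>
          \<Longrightarrow> push C (a' \<cdot> a) \<delta> = push C a' (push C a \<delta>)"
    and pull_cmp: "\<lbrakk>c \<in> mor C Z' Z; c' \<in> mor C Z'' Z'; \<delta> \<in> ext C Z A\<rbrakk>
          \<Longrightarrow> pull C (c \<cdot> c') \<delta> = pull C c' (pull C c \<delta>)"
    and push_pull: "\<lbrakk>a \<in> mor C A A'; c \<in> mor C Z' Z; \<delta> \<in> ext C Z A\<rbrakk>
          \<Longrightarrow> push C a (pull C c \<delta>) = pull C c (push C a \<delta>)"
    and push_add_right: "\<lbrakk>a \<in> mor C A A'; \<delta> \<in> ext C Z A; \<delta>' \<in> ext C Z A\<rbrakk>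
          \<Longrightarrow> push C a (\<delta> + \<delta>') = push C a \<delta> + push C a \<delta>'"
    and push_add_left: "\<lbrakk>a \<in> mor C A A'; a' \<in> mor C A A'; \<delta> \<in> ext C Z A\<rbrakk>
          \<Longrightarrow> push C (a + a') \<delta> = push C a \<delta> + push C a' \<delta>"
    and push_scale_right: "\<lbrakk>a \<in> mor C A A'; \<delta> \<in> ext C Z A\<rbrakk>
          \<Longrightarrow> push C a (escale C r \<delta>) = escale C r (push C a \<delta>)"
    and push_scale_left: "\<lbrakk>a \<in> mor C A A'; \<delta> \<in> ext C Z A\<rbrakk>
          \<Longrightarrow> push C (hscale C r a) \<delta> = escale C r (push C a \<delta>)"
    and pull_add_right: "\<lbrakk>c \<in> mor C Z' Z; \<delta> \<in> ext C Z A; \<delta>' \<in> ext C Z A\<rbrakk>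
          \<Longrightarrow> pull C c (\<delta> + \<delta>') = pull C c \<delta> + pull C c \<delta>'"
    and pull_add_left: "\<lbrakk>c \<in> mor C Z' Z; c' \<in> mor C Z' Z; \<delta> \<in> ext C Z A\<rbrakk>
          \<Longrightarrow> pull C (c + c') \<delta> = pull C c \<delta> + pull C c' \<delta>"
    and pull_scale_right: "\<lbrakk>c \<in> mor C Z' Z; \<delta> \<in> ext C Z A\<rbrakk>
          \<Longrightarrow> pull C c (escale C r \<delta>) = escale C r (pull C c \<delta>)"
    and pull_scale_left: "\<lbrakk>c \<in> mor C Z' Z; \<delta> \<in> ext C Z A\<rbrakk>
          \<Longrightarrow> pull C (hscale C r c) \<delta> = escale C r (pull C c \<delta>)"
    \<comment> \<open>(ET2): \<open>realn\<close> is an additive realisation\<close>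
    and realn_class: "\<delta> \<in> ext C Z A \<Longrightarrow> realn C Z A \<delta> \<in> seqs C A Z // seq_equiv C A Z"
    and realn_morphism: "\<lbrakk>etri C A B Z x y \<delta>; etri C A' B' Z' x' y' \<delta>';
          a \<in> mor C A A'; c \<in> mor C Z Z'; push C a \<delta> = pull C c \<delta>'\<rbrakk>
          \<Longrightarrow> \<exists>b \<in> mor C B B'. b \<cdot> x = x' \<cdot> a \<and> y' \<cdot> b = c \<cdot> y"
    and realn_zero: "biproduct C B [A, Z] i p \<Longrightarrow> (B, i 0, p 1) \<in> realn C Z A 0"
    and realn_sum: "\<lbrakk>etri C A B Z x y \<delta>; etri C A' B' Z' x' y' \<delta>';
          biproduct C A\<^sub>s [A, A'] iA pA; biproduct C B\<^sub>s [B, B'] iB pB; biproduct C Z\<^sub>s [Z, Z'] iZ pZ\<rbrakk>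
          \<Longrightarrow> (B\<^sub>s, iB 0 \<cdot> x \<cdot> pA 0 + iB 1 \<cdot> x' \<cdot> pA 1, iZ 0 \<cdot> y \<cdot> pB 0 + iZ 1 \<cdot> y' \<cdot> pB 1)
             \<in> realn C Z\<^sub>s A\<^sub>s
                 (push C (iA 0) (pull C (pZ 0) \<delta>) + push C (iA 1) (pull C (pZ 1) \<delta>'))"
    and ET3: "\<lbrakk>etri C A B Z x y \<delta>; etri C A' B' Z' x' y' \<delta>';
          a \<in> mor C A A'; b \<in> mor C B B'; b \<cdot> x = x' \<cdot> a\<rbrakk>
          \<Longrightarrow> \<exists>c \<in> mor C Z Z'. c \<cdot> y = y' \<cdot> b \<and> push C a \<delta> = pull C c \<delta>'"
    and ET3_op: "\<lbrakk>etri C A B Z x y \<delta>; etri C A' B' Z' x' y' \<delta>';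
          b \<in> mor C B B'; c \<in> mor C Z Z'; c \<cdot> y = y' \<cdot> b\<rbrakk>
          \<Longrightarrow> \<exists>a \<in> mor C A A'. b \<cdot> x = x' \<cdot> a \<and> push C a \<delta> = pull C c \<delta>'"
    and ET4: "\<lbrakk>etri C A B D f f' \<delta>; etri C B Z F g g' \<delta>'\<rbrakk>
          \<Longrightarrow> \<exists>E h' d e \<delta>''. etri C A Z E (g \<cdot> f) h' \<delta>'' \<and> d \<in> mor C D E \<and> e \<in> mor C E F \<and>
                h' \<cdot> g = d \<cdot> f' \<and> e \<cdot> h' = g' \<and>
                etri C D E F d e (push C f' \<delta>') \<and>
                pull C d \<delta>'' = \<delta> \<and> push C f \<delta>'' = pull C e \<delta>'"
    and ET4_op: "\<lbrakk>etri C D A B f' f \<delta>; etri C F B Z g' g \<delta>'\<rbrakk>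
          \<Longrightarrow> \<exists>E h' d e \<delta>''. etri C E A Z h' (g \<cdot> f) \<delta>'' \<and> d \<in> mor C D E \<and> e \<in> mor C E F \<and>
                h' \<cdot> d = f' \<and> f \<cdot> h' = g' \<cdot> e \<and>
                etri C D E F d e (pull C g' \<delta>) \<and>
                push C e \<delta>'' = \<delta>' \<and> push C d \<delta> = pull C g \<delta>''"

definition projective :: "('k, 'o, 'm, 'e::zero, 'z) extricat_scheme \<Rightarrow> 'o \<Rightarrow> bool" where
  "projective C X \<longleftrightarrow> (\<forall>A. ext C X A = {0})"

definition injective :: "('k, 'o, 'm, 'e::zero, 'z) extricat_scheme \<Rightarrow> 'o \<Rightarrow> bool" where
  "injective C X \<longleftrightarrow> (\<forall>Z. ext C Z X = {0})"

definition enough_projectives :: "('k, 'o, 'm, 'e::zero, 'z) extricat_scheme \<Rightarrow> bool" where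
  "enough_projectives C \<longleftrightarrow> (\<forall>X. \<exists>A P x y. projective C P \<and> conflation C A P X x y)"

definition hereditary :: "('k, 'o, 'm, 'e::zero, 'z) extricat_scheme \<Rightarrow> bool" where
  "hereditary C \<longleftrightarrow>
     (\<forall>X. \<exists>P\<^sub>1 P\<^sub>0 x y. projective C P\<^sub>1 \<and> projective C P\<^sub>0 \<and> conflation C P\<^sub>1 P\<^sub>0 X x y)"

definition zero_auslander :: "('k, 'o, 'm, 'e::zero, 'z) extricat_scheme \<Rightarrow> bool" where
  "zero_auslander C \<longleftrightarrow> enough_projectives C \<and> hereditary C \<and>
     (\<forall>P. projective C P \<longrightarrow>
        (\<exists>I Z x y. projective C I \<and> injective C I \<and> conflation C P I Z x y))"

text \<open>Full subcategories are identified with their sets of objects.\<close>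

definition thick :: "('k, 'o, 'm::ab_group_add, 'e, 'z) extricat_scheme \<Rightarrow> 'o set \<Rightarrow> bool" where
  "thick C S \<longleftrightarrow>
     (\<forall>X Y. X \<in> S \<and> isomorphic C X Y \<longrightarrow> Y \<in> S) \<and>
     (\<forall>X Y. X \<in> S \<and> summand C Y X \<longrightarrow> Y \<in> S) \<and>
     (\<forall>A B Z x y. conflation C A B Z x y \<longrightarrow>
        (A \<in> S \<and> Z \<in> S \<longrightarrow> B \<in> S) \<and>
        (A \<in> S \<and> B \<in> S \<longrightarrow> Z \<in> S) \<and>
        (B \<in> S \<and> Z \<in> S \<longrightarrow> A \<in> S))"

definition presilting :: "('k, 'o, 'm, 'e::zero, 'z) extricat_scheme \<Rightarrow> 'o \<Rightarrow> bool" where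
  "presilting C U \<longleftrightarrow> ext C U U = {0}"

definition silting :: "('k, 'o, 'm::ab_group_add, 'e::zero, 'z) extricat_scheme \<Rightarrow> 'o \<Rightarrow> bool" where
  "silting C U \<longleftrightarrow> presilting C U \<and> thick C hull {U} = UNIV"


section \<open>The split Grothendieck group of \<open>add(T)\<close> and g-vectors\<close>

text \<open>
  In a Krull-Schmidt category, the split Grothendieck group of \<open>add(T)\<close> is free on the isomorphism
  classes of indecomposable summands of \<open>T\<close>; the class of an object records the multiplicities of
  the indecomposables in a decomposition. Elements of \<open>K\<^sub>0(add T)\<^sub>\<real>\<close> are accordingly
  finitely supported real functions on isomorphism classes.
\<close>

definition K0 :: "('k, 'o, 'm::ab_group_add, 'z) lincat_scheme \<Rightarrow> 'o \<Rightarrow> ('o set \<Rightarrow>\<^sub>0 int) monoid" where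
  "K0 C T = free_Abelian_group (iso_class C ` {Y. indecomposable C Y \<and> summand C Y T})"

definition K0_class :: "('k, 'o, 'm::ab_group_add, 'z) lincat_scheme \<Rightarrow> 'o \<Rightarrow> ('o set \<Rightarrow>\<^sub>0 int)" where
  "K0_class C X = (SOME v. \<exists>Xs. direct_sum C X Xs \<and> (\<forall>Y \<in> set Xs. indecomposable C Y) \<and>
     v = (\<Sum>Y\<leftarrow>Xs. frag_of (iso_class C Y)))"

definition ind :: "('k, 'o, 'm::ab_group_add, 'e, 'z) extricat_scheme \<Rightarrow> 'o \<Rightarrow> 'o \<Rightarrow> ('o set \<Rightarrow>\<^sub>0 int)" where
  "ind C T X = (SOME v. \<exists>T\<^sub>1 T\<^sub>0 x y \<delta>. T\<^sub>1 \<in> add_of C T \<and> T\<^sub>0 \<in> add_of C T \<and>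
     etri C T\<^sub>1 T\<^sub>0 X x y \<delta> \<and> v = K0_class C T\<^sub>0 - K0_class C T\<^sub>1)"

definition tensor_real :: "('a \<Rightarrow>\<^sub>0 int) \<Rightarrow> ('a \<Rightarrow>\<^sub>0 real)" where
  "tensor_real v = Poly_Mapping.map real_of_int v"

definition K0_lattice ::
    "('k, 'o, 'm::ab_group_add, 'z) lincat_scheme \<Rightarrow> 'o \<Rightarrow> ('o set \<Rightarrow>\<^sub>0 real) set" where
  "K0_lattice C T = tensor_real ` carrier (K0 C T)"

definition g_vector ::
    "('k, 'o, 'm::ab_group_add, 'e, 'z) extricat_scheme \<Rightarrow> 'o \<Rightarrow> 'o \<Rightarrow> ('o set \<Rightarrow>\<^sub>0 real)" where
  "g_vector C T X = tensor_real (ind C T X)"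

text \<open>\<open>convex_cone hull S\<close> is the non-negative span of \<open>S\<close>; it is \<open>{0}\<close> for empty \<open>S\<close>.\<close>

definition g_cone ::
    "('k, 'o, 'm::ab_group_add, 'e, 'z) extricat_scheme \<Rightarrow> 'o \<Rightarrow> 'o \<Rightarrow> ('o set \<Rightarrow>\<^sub>0 real) set" where
  "g_cone C T X = convex_cone hull (g_vector C T ` {Y. indecomposable C Y \<and> summand C Y X})"

definition g_fan ::
    "('k, 'o, 'm::ab_group_add, 'e::zero, 'z) extricat_scheme \<Rightarrow> 'o \<Rightarrow> ('o set \<Rightarrow>\<^sub>0 real) set set" where
  "g_fan C T = {g_cone C T X | X. presilting C X}"


section \<open>Polyhedral fans\<close>

text \<open>
  A lattice of finite rank \<open>N\<close> is represented by its image in \<open>N\<^sub>\<real>\<close>, that is, as the set of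
  integral combinations of a finite linearly independent set; then \<open>N\<^sub>\<real> = span N\<close>.
\<close>

definition lattice_finite_rank :: "'v::real_vector set \<Rightarrow> bool" where
  "lattice_finite_rank N \<longleftrightarrow> (\<exists>B. finite B \<and> independent B \<and>
     N = {v. \<exists>c :: 'v \<Rightarrow> int. v = (\<Sum>b\<in>B. real_of_int (c b) *\<^sub>R b)})"

definition strongly_convex_polyhedral_cone :: "'v::real_vector set \<Rightarrow> 'v set \<Rightarrow> bool" where
  "strongly_convex_polyhedral_cone N \<sigma> \<longleftrightarrow>
     (\<exists>S. finite S \<and> S \<subseteq> span N \<and> \<sigma> = convex_cone hull S) \<and>
     (\<forall>V. subspace V \<and> V \<subseteq> \<sigma> \<longrightarrow> V = {0})"

text \<open>The relation \<open>face_of\<close> also admits the empty set, which is not a face in the sense of cones.\<close>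

definition cone_face :: "'v::real_vector set \<Rightarrow> 'v set \<Rightarrow> bool" where
  "cone_face \<tau> \<sigma> \<longleftrightarrow> \<tau> face_of \<sigma> \<and> \<tau> \<noteq> {}"

definition polyhedral_fan :: "'v::real_vector set \<Rightarrow> 'v set set \<Rightarrow> bool" where
  "polyhedral_fan N \<F> \<longleftrightarrow> lattice_finite_rank N \<and>
     (\<forall>\<sigma> \<in> \<F>. strongly_convex_polyhedral_cone N \<sigma>) \<and>
     (\<forall>\<sigma> \<in> \<F>. \<forall>\<tau>. cone_face \<tau> \<sigma> \<longrightarrow> \<tau> \<in> \<F>) \<and>
     (\<forall>\<sigma> \<in> \<F>. \<forall>\<tau> \<in> \<F>. cone_face (\<sigma> \<inter> \<tau>) \<sigma> \<and> cone_face (\<sigma> \<inter> \<tau>) \<tau>)"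

definition simplicial_fan :: "'v::real_vector set set \<Rightarrow> bool" where
  "simplicial_fan \<F> \<longleftrightarrow> (\<forall>\<sigma> \<in> \<F>. \<exists>B. independent B \<and> \<sigma> = convex_cone hull B)"

definition rational_fan :: "'v::real_vector set \<Rightarrow> 'v set set \<Rightarrow> bool" where
  "rational_fan N \<F> \<longleftrightarrow> (\<forall>\<sigma> \<in> \<F>. \<exists>S. finite S \<and> S \<subseteq> N \<and> \<sigma> = convex_cone hull S)"

end

theory Submission
  imports Defs
begin

text \<open>
  Record an object by its Krull-Schmidt multiset. Since \<open>T\<close> is projective silting and \<open>C\<close> is
  hereditary, every object has a two-term resolution by \<open>add(T)\<close>, unique up to Schanuel's lemma, so
  indices are additive. The fan property reduces to one fact: presilting objects \<open>U\<close> and \<open>V\<close> with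
  the same index are isomorphic. Indeed, a real coincidence of non-negative combinations of g-vectors
  can be rounded (simultaneous Dirichlet approximation) to a coincidence of non-negative integral
  ones, that is, of indices of presilting objects.

  To prove this fact, choose resolutions \<open>P1 \<rightarrow> P0 \<rightarrow> U\<close> by \<open>f\<close> and \<open>P1 \<rightarrow> P0 \<rightarrow> V\<close> by \<open>g\<close> with the same terms.
  As \<open>\<E>(U,U) = 0\<close>, the deformation \<open>f - t g\<close> is equivalent to \<open>f\<close> over \<open>k[[t]]\<close>; together with
  \<open>\<E>(V,V) = 0\<close> a dimension count gives \<open>\<E>(U,V) = 0\<close>, over any field. Then \<open>W = U \<oplus> V\<close> is presilting,
  and pushing both resolutions out along a universal extension \<open>P1 \<rightarrow> A0 \<rightarrow> A1\<close> with \<open>\<E>(W,A0) = 0\<close> gives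
  \<open>P0 \<rightarrow> A0 \<oplus> U \<rightarrow> A1\<close> and \<open>P0 \<rightarrow> A0 \<oplus> V \<rightarrow> A1\<close>; the dual of Schanuel's lemma and cancellation give \<open>U \<cong> V\<close>.
\<close>

section \<open>Direct sums in linear categories\<close>

text \<open>Why power series: over an algebraically closed field \<open>f\<close> and
  \<open>g\<close> would be compared as points of dense orbits in one space of maps from
  \<open>P1\<close> to \<open>P0\<close>. A finite field has no generic point, so the indeterminate
  takes over that role. That \<open>U\<close> has no self-extensions says that every first-order
  deformation of \<open>f\<close> is trivial, so \<open>f - t g\<close> is straightened one
  coefficient at a time and no scalar has to be chosen.

  Why rounding: the fan axioms concern real points that lie in the cones of two different presilting
  objects, whereas equality of indices only speaks about multiplicities. The approximation must
  therefore preserve signs and zero coefficients; then the integral relation still lives on the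
  summands of the same two objects. Applied to pairs of objects, uniqueness of coefficients yields
  the intersection property, the faces, linear independence and strong convexity alike.\<close>

context linear_category
begin

sublocale H: vector_space "hscale C" by (rule mor_vector_space)

lemma zero_mor [simp]: "0 \<in> mor C X Y"
  using H.subspace_0[OF mor_subspace] .

lemma add_mor [intro]: "f \<in> mor C X Y \<Longrightarrow> g \<in> mor C X Y \<Longrightarrow> f + g \<in> mor C X Y"
  using H.subspace_add[OF mor_subspace] .

lemma uminus_mor [intro]: "f \<in> mor C X Y \<Longrightarrow> - f \<in> mor C X Y"
  using H.subspace_neg[OF mor_subspace] .

lemma diff_mor [intro]: "f \<in> mor C X Y \<Longrightarrow> g \<in> mor C X Y \<Longrightarrow> f - g \<in> mor C X Y"
  using H.subspace_diff[OF mor_subspace] .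

lemma sum_mor [intro]: "(\<And>j. j \<in> A \<Longrightarrow> f j \<in> mor C X Y) \<Longrightarrow> (\<Sum>j\<in>A. f j) \<in> mor C X Y"
  by (rule H.subspace_sum[OF mor_subspace])

declare idn_mor [simp, intro]

lemma cmp_zero_left: "f \<in> mor C X Y \<Longrightarrow> 0 \<cdot> f = 0"
  using cmp_add_left[OF zero_mor zero_mor, of f X Y] by simp

lemma cmp_zero_right: "g \<in> mor C Y Z \<Longrightarrow> g \<cdot> 0 = 0"
  using cmp_add_right[OF _ zero_mor zero_mor, of g Y Z] by simp

lemma cmp_uminus_left: "g \<in> mor C Y Z \<Longrightarrow> f \<in> mor C X Y \<Longrightarrow> (- g) \<cdot> f = - (g \<cdot> f)"
  using cmp_add_left[of "- g" Y Z g f X] by (simp add: uminus_mor cmp_zero_left eq_neg_iff_add_eq_0)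

lemma cmp_uminus_right: "g \<in> mor C Y Z \<Longrightarrow> f \<in> mor C X Y \<Longrightarrow> g \<cdot> (- f) = - (g \<cdot> f)"
  using cmp_add_right[of g Y Z "- f" X f] by (simp add: uminus_mor cmp_zero_right eq_neg_iff_add_eq_0)

lemma cmp_diff_left:
  "\<lbrakk>g \<in> mor C Y Z; g' \<in> mor C Y Z; f \<in> mor C X Y\<rbrakk> \<Longrightarrow> (g - g') \<cdot> f = g \<cdot> f - g' \<cdot> f"
  using cmp_add_left[of g Y Z "- g'" f X] by (simp add: uminus_mor cmp_uminus_left)

lemma cmp_diff_right:
  "\<lbrakk>g \<in> mor C Y Z; f \<in> mor C X Y; f' \<in> mor C X Y\<rbrakk> \<Longrightarrow> g \<cdot> (f - f') = g \<cdot> f - g \<cdot> f'"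
  using cmp_add_right[of g Y Z f X "- f'"] by (simp add: uminus_mor cmp_uminus_right)

lemma cmp_sum_left:
  "\<lbrakk>\<And>j. j \<in> A \<Longrightarrow> g j \<in> mor C Y Z; f \<in> mor C X Y\<rbrakk> \<Longrightarrow> (\<Sum>j\<in>A. g j) \<cdot> f = (\<Sum>j\<in>A. g j \<cdot> f)"
proof (induction A rule: infinite_finite_induct)
  case (insert a A)
  then show ?case by (simp add: cmp_add_left[of _ Y Z] sum_mor)
qed (auto simp: cmp_zero_left)

lemma cmp_sum_right:
  "\<lbrakk>g \<in> mor C Y Z; \<And>j. j \<in> A \<Longrightarrow> f j \<in> mor C X Y\<rbrakk> \<Longrightarrow> g \<cdot> (\<Sum>j\<in>A. f j) = (\<Sum>j\<in>A. g \<cdot> f j)"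
proof (induction A rule: infinite_finite_induct)
  case (insert a A)
  then show ?case by (simp add: cmp_add_right[of _ Y Z _ X] sum_mor)
qed (auto simp: cmp_zero_right)

lemma cmp_assoc4:
  assumes "a \<in> mor C Y Z" "b \<in> mor C X Y" "c \<in> mor C W X" "d \<in> mor C V W"
  shows "(a \<cdot> b) \<cdot> (c \<cdot> d) = a \<cdot> ((b \<cdot> c) \<cdot> d)"
  using cmp_assoc[OF assms(1,2) cmp_mor[OF assms(3,4)]] cmp_assoc[OF assms(2-4)] by simp

lemma zero_object_iff: "zero_object C X \<longleftrightarrow> idn C X = 0"
proof
  assume "zero_object C X"
  then show "idn C X = 0" unfolding zero_object_def using idn_mor[of X] by blast
next
  assume z: "idn C X = 0"
  have "f = 0" if "f \<in> mor C X Y" for f Y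
    using idn_right[OF that] cmp_zero_right[OF that] z by simp
  moreover have "f = 0" if "f \<in> mor C Y X" for f Y
    using idn_left[OF that] cmp_zero_left[OF that] z by simp
  ultimately show "zero_object C X" unfolding zero_object_def by auto
qed

lemma is_isoI:
  "\<lbrakk>f \<in> mor C X Y; g \<in> mor C Y X; g \<cdot> f = idn C X; f \<cdot> g = idn C Y\<rbrakk> \<Longrightarrow> is_iso C f X Y"
  unfolding is_iso_def by blast

lemma is_isoE:
  assumes "is_iso C f X Y"
  obtains g where "f \<in> mor C X Y" "g \<in> mor C Y X" "g \<cdot> f = idn C X" "f \<cdot> g = idn C Y"
  using assms unfolding is_iso_def by blast

lemma isomorphic_refl [simp, intro]: "isomorphic C X X"
  unfolding isomorphic_def by (metis idn_left idn_mor is_isoI)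

lemma isomorphic_sym: "isomorphic C X Y \<Longrightarrow> isomorphic C Y X"
  unfolding isomorphic_def is_iso_def by blast

lemma is_iso_comp:
  assumes "is_iso C f X Y" "is_iso C g Y Z"
  shows "is_iso C (g \<cdot> f) X Z"
proof -
  obtain f' where f: "f \<in> mor C X Y" "f' \<in> mor C Y X" "f' \<cdot> f = idn C X" "f \<cdot> f' = idn C Y"
    using assms(1) by (rule is_isoE)
  obtain g' where g: "g \<in> mor C Y Z" "g' \<in> mor C Z Y" "g' \<cdot> g = idn C Y" "g \<cdot> g' = idn C Z"
    using assms(2) by (rule is_isoE)
  have 1: "(f' \<cdot> g') \<cdot> (g \<cdot> f) = idn C X"
    using cmp_assoc4[OF f(2) g(2,1) f(1)] f g idn_left[OF f(1)] by simp
  have 2: "(g \<cdot> f) \<cdot> (f' \<cdot> g') = idn C Z"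
    using cmp_assoc4[OF g(1) f(1,2) g(2)] f g idn_left[OF g(2)] by simp
  show ?thesis by (rule is_isoI[OF cmp_mor[OF g(1) f(1)] cmp_mor[OF f(2) g(2)] 1 2])
qed

lemma isomorphic_trans: "isomorphic C X Y \<Longrightarrow> isomorphic C Y Z \<Longrightarrow> isomorphic C X Z"
  unfolding isomorphic_def by (metis is_iso_comp)

lemma iso_class_eq_iff: "iso_class C X = iso_class C Y \<longleftrightarrow> isomorphic C X Y"
  unfolding iso_class_def by (auto dest: isomorphic_sym isomorphic_trans)

lemma biproductI:
  assumes "\<And>j. j < length Xs \<Longrightarrow> i j \<in> mor C (Xs ! j) X"
    and "\<And>j. j < length Xs \<Longrightarrow> p j \<in> mor C X (Xs ! j)"
    and "\<And>j. j < length Xs \<Longrightarrow> p j \<cdot> i j = idn C (Xs ! j)"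
    and "\<And>j l. j < length Xs \<Longrightarrow> l < length Xs \<Longrightarrow> j \<noteq> l \<Longrightarrow> p j \<cdot> i l = 0"
    and "(\<Sum>j < length Xs. i j \<cdot> p j) = idn C X"
  shows "biproduct C X Xs i p"
  using assms unfolding biproduct_def by auto

lemma biproductD:
  assumes "biproduct C X Xs i p"
  shows "j < length Xs \<Longrightarrow> i j \<in> mor C (Xs ! j) X"
    and "j < length Xs \<Longrightarrow> p j \<in> mor C X (Xs ! j)"
    and "j < length Xs \<Longrightarrow> p j \<cdot> i j = idn C (Xs ! j)"
    and "j < length Xs \<Longrightarrow> l < length Xs \<Longrightarrow> j \<noteq> l \<Longrightarrow> p j \<cdot> i l = 0"
    and "(\<Sum>j < length Xs. i j \<cdot> p j) = idn C X"
  using assms unfolding biproduct_def by auto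

lemma biproduct2I:
  assumes "i0 \<in> mor C A X" "i1 \<in> mor C B X" "p0 \<in> mor C X A" "p1 \<in> mor C X B"
    and "p0 \<cdot> i0 = idn C A" "p1 \<cdot> i1 = idn C B" "p0 \<cdot> i1 = 0" "p1 \<cdot> i0 = 0"
    and "i0 \<cdot> p0 + i1 \<cdot> p1 = idn C X"
  shows "biproduct C X [A, B] (case_nat i0 (\<lambda>_. i1)) (case_nat p0 (\<lambda>_. p1))"
  using assms unfolding biproduct_def
  by (auto simp: lessThan_Suc less_Suc_eq numeral_2_eq_2 add.commute nth_Cons' split: nat.splits)

lemma biproduct2D:
  assumes "biproduct C X [A, B] i p"
  shows "i 0 \<in> mor C A X" "i 1 \<in> mor C B X" "p 0 \<in> mor C X A" "p 1 \<in> mor C X B"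
    and "p 0 \<cdot> i 0 = idn C A" "p 1 \<cdot> i 1 = idn C B" "p 0 \<cdot> i 1 = 0" "p 1 \<cdot> i 0 = 0"
    and "i 0 \<cdot> p 0 + i 1 \<cdot> p 1 = idn C X"
  using biproductD(1,2,3)[OF assms, of 0] biproductD(1,2,3)[OF assms, of 1]
    biproductD(4)[OF assms, of 0 1] biproductD(4)[OF assms, of 1 0] biproductD(5)[OF assms]
  by (auto simp: lessThan_Suc add.commute)

lemma direct_sum2I:
  assumes "i0 \<in> mor C A X" "i1 \<in> mor C B X" "p0 \<in> mor C X A" "p1 \<in> mor C X B"
    and "p0 \<cdot> i0 = idn C A" "p1 \<cdot> i1 = idn C B" "p0 \<cdot> i1 = 0" "p1 \<cdot> i0 = 0"
    and "i0 \<cdot> p0 + i1 \<cdot> p1 = idn C X"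
  shows "direct_sum C X [A, B]"
  unfolding direct_sum_def using biproduct2I[OF assms] by blast

lemma direct_sum2E:
  assumes "direct_sum C X [A, B]"
  obtains i0 i1 p0 p1 where "i0 \<in> mor C A X" "i1 \<in> mor C B X" "p0 \<in> mor C X A" "p1 \<in> mor C X B"
    "p0 \<cdot> i0 = idn C A" "p1 \<cdot> i1 = idn C B" "p0 \<cdot> i1 = 0" "p1 \<cdot> i0 = 0"
    "i0 \<cdot> p0 + i1 \<cdot> p1 = idn C X"
  using assms biproduct2D unfolding direct_sum_def by metis

lemma direct_sum_Nil: "direct_sum C X [] \<longleftrightarrow> zero_object C X"
  by (auto simp: direct_sum_def biproduct_def zero_object_iff)

lemma direct_sum_single: "direct_sum C X [X]"
  unfolding direct_sum_def
  by (rule exI[of _ "\<lambda>_. idn C X"], rule exI[of _ "\<lambda>_. idn C X"]) (auto simp: biproduct_def idn_left[OF idn_mor])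

lemma direct_sum_zero_right:
  assumes "isomorphic C X Y" "zero_object C Z"
  shows "direct_sum C Y [X, Z]"
proof -
  obtain f g where f: "f \<in> mor C X Y" "g \<in> mor C Y X" "g \<cdot> f = idn C X" "f \<cdot> g = idn C Y"
    using assms(1) unfolding isomorphic_def by (auto elim: is_isoE)
  show ?thesis
    by (rule direct_sum2I[of f _ _ 0 _ g 0])
      (use f assms(2) in \<open>auto simp: zero_object_iff cmp_zero_right cmp_zero_left cmp_zero_left[OF zero_mor]\<close>)
qed

lemma direct_sum2_commute:
  assumes "direct_sum C X [A, B]" shows "direct_sum C X [B, A]"
proof -
  obtain i0 i1 p0 p1 where "i0 \<in> mor C A X" "i1 \<in> mor C B X" "p0 \<in> mor C X A" "p1 \<in> mor C X B"
    "p0 \<cdot> i0 = idn C A" "p1 \<cdot> i1 = idn C B" "p0 \<cdot> i1 = 0" "p1 \<cdot> i0 = 0"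
    "i0 \<cdot> p0 + i1 \<cdot> p1 = idn C X" using direct_sum2E[OF assms] by blast
  then show ?thesis by (intro direct_sum2I[of i1 B X i0 A p1 p0]) (simp_all add: add.commute)
qed

text \<open>Matrix multiplication through a biproduct: orthogonality of \<open>p\<close> and
  \<open>b\<close> kills the cross terms and leaves the diagonal.\<close>

lemma sum_cmp_sum:
  fixes n :: nat
  assumes a: "\<And>l. l < n \<Longrightarrow> a l \<in> mor C (Z l) Y" and p: "\<And>l. l < n \<Longrightarrow> p l \<in> mor C X (Z l)"
    and b: "\<And>l. l < n \<Longrightarrow> b l \<in> mor C (Z l) X" and q: "\<And>l. l < n \<Longrightarrow> q l \<in> mor C W (Z l)"
    and pb: "\<And>l m. l < n \<Longrightarrow> m < n \<Longrightarrow> p l \<cdot> b m = (if l = m then idn C (Z l) else 0)"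
  shows "(\<Sum>l<n. a l \<cdot> p l) \<cdot> (\<Sum>m<n. b m \<cdot> q m) = (\<Sum>l<n. a l \<cdot> q l)"
proof -
  have ap: "a l \<cdot> p l \<in> mor C X Y" and bq: "b l \<cdot> q l \<in> mor C W X" if "l < n" for l
    using a b p q that by (blast intro: cmp_mor)+
  have *: "(a l \<cdot> p l) \<cdot> (b m \<cdot> q m) = (if l = m then a l \<cdot> q l else 0)" if "l < n" "m < n" for l m
    using cmp_assoc4[OF a[OF that(1)] p[OF that(1)] b[OF that(2)] q[OF that(2)]] pb[OF that]
      idn_left[OF q[OF that(2)]] cmp_zero_left[OF q[OF that(2)]] cmp_zero_right[OF a[OF that(1)]]
    by (simp split: if_splits)
  have "(\<Sum>l<n. a l \<cdot> p l) \<cdot> (\<Sum>m<n. b m \<cdot> q m) = (\<Sum>l<n. (a l \<cdot> p l) \<cdot> (\<Sum>m<n. b m \<cdot> q m))"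
    by (rule cmp_sum_left[of _ _ X Y _ W]) (use ap bq in auto)
  also have "\<dots> = (\<Sum>l<n. \<Sum>m<n. (a l \<cdot> p l) \<cdot> (b m \<cdot> q m))"
    by (intro sum.cong refl cmp_sum_right[of _ X Y _ _ W]) (use ap bq in auto)
  also have "\<dots> = (\<Sum>l<n. \<Sum>m<n. if l = m then a l \<cdot> q l else 0)"
    by (intro sum.cong refl) (use * in auto)
  also have "\<dots> = (\<Sum>l<n. a l \<cdot> q l)"
    by (intro sum.cong refl) (simp only: finite_lessThan sum.delta' lessThan_iff if_True)
  finally show ?thesis .
qed

lemma biproduct_orth:
  "biproduct C X Xs i p \<Longrightarrow> l < length Xs \<Longrightarrow> m < length Xs \<Longrightarrow>
    p l \<cdot> i m = (if l = m then idn C (Xs ! l) else 0)"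
  unfolding biproduct_def by auto

lemma direct_sum_unique:
  assumes "direct_sum C X Xs" "direct_sum C Y Xs"
  shows "isomorphic C X Y"
proof -
  obtain i p j q where i: "biproduct C X Xs i p" and j: "biproduct C Y Xs j q"
    using assms unfolding direct_sum_def by blast
  note I = biproductD[OF i] and J = biproductD[OF j]
  let ?F = "\<Sum>l<length Xs. j l \<cdot> p l" and ?G = "\<Sum>l<length Xs. i l \<cdot> q l"
  have "?F \<cdot> ?G = (\<Sum>l<length Xs. j l \<cdot> q l)"
    by (rule sum_cmp_sum[where Z = "\<lambda>l. Xs ! l"]) (use I J biproduct_orth[OF i] in auto)
  moreover have "?G \<cdot> ?F = (\<Sum>l<length Xs. i l \<cdot> p l)"
    by (rule sum_cmp_sum[where Z = "\<lambda>l. Xs ! l"]) (use I J biproduct_orth[OF j] in auto)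
  moreover have "?F \<in> mor C X Y" "?G \<in> mor C Y X"
    by (rule sum_mor, use I J in \<open>blast intro: cmp_mor\<close>)+
  ultimately show ?thesis
    unfolding isomorphic_def is_iso_def using I(5) J(5) by auto
qed

lemma direct_sum_iso:
  assumes "direct_sum C X Xs" "isomorphic C X Y"
  shows "direct_sum C Y Xs"
proof -
  obtain i p where b: "biproduct C X Xs i p" using assms(1) unfolding direct_sum_def by blast
  obtain f g where f: "f \<in> mor C X Y" "g \<in> mor C Y X" "g \<cdot> f = idn C X" "f \<cdot> g = idn C Y"
    using assms(2) unfolding isomorphic_def by (auto elim: is_isoE)
  note D = biproductD[OF b]
  have 1: "(p j \<cdot> g) \<cdot> (f \<cdot> i l) = p j \<cdot> i l" if "j < length Xs" "l < length Xs" for j l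
    using cmp_assoc4[OF D(2)[OF that(1)] f(2,1) D(1)[OF that(2)]] f idn_left[OF D(1)[OF that(2)]] by simp
  have t: "i j \<cdot> p j \<in> mor C X X" "(i j \<cdot> p j) \<cdot> g \<in> mor C Y X" if "j < length Xs" for j
    using D that f by (blast intro: cmp_mor)+
  have "(\<Sum>j<length Xs. (f \<cdot> i j) \<cdot> (p j \<cdot> g)) = (\<Sum>j<length Xs. f \<cdot> ((i j \<cdot> p j) \<cdot> g))"
    by (intro sum.cong refl) (use cmp_assoc4[OF f(1) D(1) D(2) f(2)] in auto)
  also have "\<dots> = f \<cdot> (\<Sum>j<length Xs. (i j \<cdot> p j) \<cdot> g)"
    by (rule cmp_sum_right[OF f(1), symmetric]) (use t in auto)
  also have "\<dots> = f \<cdot> ((\<Sum>j<length Xs. i j \<cdot> p j) \<cdot> g)"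
    by (subst cmp_sum_left[OF _ f(2)]) (use t in auto)
  finally have "(\<Sum>j<length Xs. (f \<cdot> i j) \<cdot> (p j \<cdot> g)) = idn C Y"
    using D(5) f idn_left[OF f(2)] by simp
  then have "biproduct C Y Xs (\<lambda>j. f \<cdot> i j) (\<lambda>j. p j \<cdot> g)"
    by (intro biproductI) (use D f 1 in \<open>auto intro: cmp_mor\<close>)
  then show ?thesis unfolding direct_sum_def by blast
qed

lemma direct_sum_singleton_iff: "direct_sum C X [Y] \<longleftrightarrow> isomorphic C X Y"
  using direct_sum_iso direct_sum_single direct_sum_unique isomorphic_sym by metis

lemma direct_sum_Cons:
  assumes "direct_sum C X [Y, S]" "direct_sum C S Ys"
  shows "direct_sum C X (Y # Ys)"
proof -
  obtain i p where b: "biproduct C X [Y, S] i p" using assms(1) unfolding direct_sum_def by blast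
  obtain k r where c: "biproduct C S Ys k r" using assms(2) unfolding direct_sum_def by blast
  note B = biproduct2D[OF b] and K = biproductD[OF c]
  define j where "j = case_nat (i 0) (\<lambda>m. i 1 \<cdot> k m)"
  define q where "q = case_nat (p 0) (\<lambda>m. r m \<cdot> p 1)"
  have t: "j l \<in> mor C ((Y # Ys) ! l) X" "q l \<in> mor C X ((Y # Ys) ! l)" if "l < length (Y # Ys)" for l
    using that B K unfolding j_def q_def by (auto split: nat.splits intro: cmp_mor)
  have rk: "(r l \<cdot> p 1) \<cdot> (i 1 \<cdot> k m) = r l \<cdot> k m" if "l < length Ys" "m < length Ys" for l m
    using cmp_assoc4[OF K(2)[OF that(1)] B(4,2) K(1)[OF that(2)]] B(6) idn_left[OF K(1)[OF that(2)]] by simp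
  have pk: "p 0 \<cdot> (i 1 \<cdot> k m) = 0" if "m < length Ys" for m
    using cmp_assoc[OF B(3,2) K(1)[OF that]] B(7) cmp_zero_left[OF K(1)[OF that]] by simp
  have rp: "(r l \<cdot> p 1) \<cdot> i 0 = 0" if "l < length Ys" for l
    using cmp_assoc[OF K(2)[OF that] B(4,1)] B(8) cmp_zero_right[OF K(2)[OF that]] by simp
  have o: "q l \<cdot> j m = (if l = m then idn C ((Y # Ys) ! l) else 0)"
    if "l < length (Y # Ys)" "m < length (Y # Ys)" for l m
    using that B rk pk rp biproduct_orth[OF c] unfolding j_def q_def by (auto split: nat.splits)
  have t': "k m \<cdot> r m \<in> mor C S S" "(k m \<cdot> r m) \<cdot> p 1 \<in> mor C X S" if "m < length Ys" for m
    using K that B by (blast intro: cmp_mor)+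
  have "(\<Sum>m<length Ys. (i 1 \<cdot> k m) \<cdot> (r m \<cdot> p 1)) = (\<Sum>m<length Ys. i 1 \<cdot> ((k m \<cdot> r m) \<cdot> p 1))"
    by (intro sum.cong refl) (use cmp_assoc4[OF B(2) K(1,2) B(4)] in auto)
  also have "\<dots> = i 1 \<cdot> (\<Sum>m<length Ys. (k m \<cdot> r m) \<cdot> p 1)"
    by (rule cmp_sum_right[OF B(2), symmetric]) (use t' in auto)
  also have "\<dots> = i 1 \<cdot> ((\<Sum>m<length Ys. k m \<cdot> r m) \<cdot> p 1)"
    by (subst cmp_sum_left[OF _ B(4)]) (use t' in auto)
  finally have s: "(\<Sum>m<length Ys. (i 1 \<cdot> k m) \<cdot> (r m \<cdot> p 1)) = i 1 \<cdot> p 1"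
    using K(5) idn_left[OF B(4)] by simp
  have "(\<Sum>l<length (Y # Ys). j l \<cdot> q l) = i 0 \<cdot> p 0 + (\<Sum>m<length Ys. (i 1 \<cdot> k m) \<cdot> (r m \<cdot> p 1))"
    unfolding j_def q_def by (simp add: sum.lessThan_Suc_shift del: sum.lessThan_Suc)
  then have "(\<Sum>l<length (Y # Ys). j l \<cdot> q l) = idn C X" using s B(9) by simp
  then have "biproduct C X (Y # Ys) j q"
    unfolding biproduct_def using t o by blast
  then show ?thesis unfolding direct_sum_def by blast
qed

text \<open>The structure maps of the head are kept on purpose: the exchange argument finds an
  invertible component and must meet that same component in the regrouped biproduct.\<close>

lemma biproduct_Cons_split:
  assumes b: "biproduct C X (Y # Ys) i p" and S: "direct_sum C S Ys"
  obtains i' p' where "biproduct C X [Y, S] i' p'" "i' 0 = i 0" "p' 0 = p 0"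
proof -
  obtain k r where c: "biproduct C S Ys k r" using S unfolding direct_sum_def by blast
  note B = biproductD[OF b] and K = biproductD[OF c]
  let ?n = "length Ys"
  let ?j = "\<Sum>m<?n. i (Suc m) \<cdot> r m" and ?q = "\<Sum>m<?n. k m \<cdot> p (Suc m)"
  have B0: "i 0 \<in> mor C Y X" "p 0 \<in> mor C X Y" "p 0 \<cdot> i 0 = idn C Y" using B(1,2,3)[of 0] by auto
  have BS: "i (Suc m) \<in> mor C (Ys ! m) X" "p (Suc m) \<in> mor C X (Ys ! m)"
    "p 0 \<cdot> i (Suc m) = 0" "p (Suc m) \<cdot> i 0 = 0" if "m < ?n" for m
    using B(1,2)[of "Suc m"] B(4)[of 0 "Suc m"] B(4)[of "Suc m" 0] that by auto
  have o: "p (Suc l) \<cdot> i (Suc m) = (if l = m then idn C (Ys ! l) else 0)" if "l < ?n" "m < ?n" for l m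
    using biproduct_orth[OF b, of "Suc l" "Suc m"] that by auto
  have t: "?j \<in> mor C S X" "?q \<in> mor C X S"
    by (rule sum_mor, use BS K in \<open>blast intro: cmp_mor\<close>)+
  have 1: "?q \<cdot> ?j = idn C S"
    using sum_cmp_sum[of ?n k "\<lambda>l. Ys ! l" S "\<lambda>m. p (Suc m)" X "\<lambda>m. i (Suc m)" r S] BS K o by auto
  have 2: "?j \<cdot> ?q = (\<Sum>m<?n. i (Suc m) \<cdot> p (Suc m))"
    using sum_cmp_sum[of ?n "\<lambda>m. i (Suc m)" "\<lambda>l. Ys ! l" X r S k "\<lambda>m. p (Suc m)" X] BS K
      biproduct_orth[OF c] by auto
  have "i 0 \<cdot> p 0 + ?j \<cdot> ?q = (\<Sum>m<length (Y # Ys). i m \<cdot> p m)"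
    unfolding 2 by (simp add: sum.lessThan_Suc_shift del: sum.lessThan_Suc)
  then have 3: "i 0 \<cdot> p 0 + ?j \<cdot> ?q = idn C X" using B(5) by simp
  have "p 0 \<cdot> ?j = (\<Sum>m<?n. p 0 \<cdot> (i (Suc m) \<cdot> r m))"
    by (rule cmp_sum_right[OF B0(2)]) (use BS K in \<open>blast intro: cmp_mor\<close>)
  also have "p 0 \<cdot> (i (Suc m) \<cdot> r m) = 0" if "m < ?n" for m
    using cmp_assoc[OF B0(2) BS(1)[OF that] K(2)[OF that]] BS(3)[OF that] cmp_zero_left[OF K(2)[OF that]] by simp
  then have "(\<Sum>m<?n. p 0 \<cdot> (i (Suc m) \<cdot> r m)) = 0" by (intro sum.neutral) auto
  finally have 4: "p 0 \<cdot> ?j = 0" .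
  have "?q \<cdot> i 0 = (\<Sum>m<?n. (k m \<cdot> p (Suc m)) \<cdot> i 0)"
    by (rule cmp_sum_left[OF _ B0(1)]) (use BS K in \<open>blast intro: cmp_mor\<close>)
  also have "(k m \<cdot> p (Suc m)) \<cdot> i 0 = 0" if "m < ?n" for m
    using cmp_assoc[OF K(1)[OF that] BS(2)[OF that] B0(1)] BS(4)[OF that] cmp_zero_right[OF K(1)[OF that]] by simp
  then have "(\<Sum>m<?n. (k m \<cdot> p (Suc m)) \<cdot> i 0) = 0" by (intro sum.neutral) auto
  finally have 5: "?q \<cdot> i 0 = 0" .
  have "biproduct C X [Y, S] (case_nat (i 0) (\<lambda>_. ?j)) (case_nat (p 0) (\<lambda>_. ?q))"
    by (rule biproduct2I) (use B0 t 1 3 4 5 in auto)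
  then show ?thesis using that by auto
qed

lemma direct_sum_Cons_split:
  "direct_sum C X (Y # Ys) \<Longrightarrow> direct_sum C S Ys \<Longrightarrow> direct_sum C X [Y, S]"
  using biproduct_Cons_split unfolding direct_sum_def[of C X] by metis

lemma biproduct_permute:
  assumes b: "biproduct C X Xs i p" and \<pi>: "\<pi> permutes {..<length Xs}"
  shows "biproduct C X (permute_list \<pi> Xs) (i \<circ> \<pi>) (p \<circ> \<pi>)"
proof -
  have *: "\<pi> l < length Xs" "permute_list \<pi> Xs ! l = Xs ! \<pi> l" if "l < length Xs" for l
    using that permutes_in_image[OF \<pi>, of l] permute_list_nth[OF \<pi>] by auto
  have "inj \<pi>" using \<pi> by (rule permutes_inj)
  then have "(p \<circ> \<pi>) l \<cdot> (i \<circ> \<pi>) m = (if l = m then idn C (permute_list \<pi> Xs ! l) else 0)"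
    if "l < length Xs" "m < length Xs" for l m
    using biproduct_orth[OF b, of "\<pi> l" "\<pi> m"] that * by (auto simp: inj_eq)
  moreover have "(\<Sum>l<length Xs. (i \<circ> \<pi>) l \<cdot> (p \<circ> \<pi>) l) = idn C X"
    using sum.permute[OF \<pi>, of "\<lambda>l. i l \<cdot> p l"] biproductD(5)[OF b] by (simp add: o_def)
  ultimately show ?thesis using biproductD(1,2)[OF b] *
    unfolding biproduct_def by auto
qed

lemma direct_sum_mset:
  assumes "direct_sum C X Xs" "mset Xs = mset Ys"
  shows "direct_sum C X Ys"
proof -
  obtain \<pi> where \<pi>: "\<pi> permutes {..<length Xs}" "permute_list \<pi> Xs = Ys"
    using mset_eq_permutation[OF assms(2)[symmetric]] by blast
  then show ?thesis using assms(1) biproduct_permute[OF _ \<pi>(1)] unfolding direct_sum_def by blast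
qed

lemma biproduct_move_head:
  assumes b: "biproduct C X Xs i p" and l: "l < length Xs"
  obtains Ys i' p' where "mset Xs = mset (Xs ! l # Ys)" "biproduct C X (Xs ! l # Ys) i' p'"
    "i' 0 = i l" "p' 0 = p l"
proof -
  let ?\<pi> = "Transposition.transpose 0 l"
  have \<pi>: "?\<pi> permutes {..<length Xs}" by (rule permutes_swap_id) (use l in auto)
  have "length (permute_list ?\<pi> Xs) = length Xs" by simp
  then obtain Y Ys where Y: "permute_list ?\<pi> Xs = Y # Ys" using l by (cases "permute_list ?\<pi> Xs") auto
  have "Y = Xs ! l" using permute_list_nth[OF \<pi>, of 0] Y l by (cases Xs) auto
  moreover have "mset (permute_list ?\<pi> Xs) = mset Xs" using \<pi> by (rule mset_permute_list)
  moreover note biproduct_permute[OF b \<pi>]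
  ultimately show ?thesis using that[of Ys "i \<circ> ?\<pi>" "p \<circ> ?\<pi>"] Y by auto
qed

section \<open>Local endomorphism rings and cancellation\<close>

lemma not_iso_zero: "idn C X \<noteq> 0 \<Longrightarrow> \<not> is_iso C 0 X X"
  using cmp_zero_right unfolding is_iso_def by fastforce

lemma local_end_sum:
  assumes "local_end C X" "finite A" "\<And>j. j \<in> A \<Longrightarrow> f j \<in> mor C X X" "is_iso C (\<Sum>j\<in>A. f j) X X"
  shows "\<exists>j\<in>A. is_iso C (f j) X X"
  using assms(2-)
proof (induction A rule: finite_induct)
  case empty
  then show ?case using not_iso_zero[of X] assms(1) unfolding local_end_def by simp
next
  case (insert a A)
  have "(\<Sum>j\<in>A. f j) \<in> mor C X X" using insert by auto
  then have "is_iso C (f a) X X \<or> is_iso C (\<Sum>j\<in>A. f j) X X"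
    using assms(1) insert unfolding local_end_def by auto
  then show ?case using insert by auto
qed

lemma iso_idempotent:
  assumes "is_iso C e X X" "e \<cdot> e = e" shows "e = idn C X"
proof -
  obtain g where g: "e \<in> mor C X X" "g \<in> mor C X X" "g \<cdot> e = idn C X" using assms(1) by (auto elim: is_isoE)
  then show ?thesis using cmp_assoc[OF g(2,1,1)] assms(2) idn_left[OF g(1)] by simp
qed

text \<open>The identity is the sum of \<open>e\<close> and \<open>idn C X - e\<close>, so locality
  makes one of them invertible, and an invertible idempotent is the identity.\<close>

lemma local_end_idempotent:
  assumes "local_end C X" "e \<in> mor C X X" "e \<cdot> e = e" shows "e = 0 \<or> e = idn C X"
proof -
  let ?e = "idn C X - e"
  have t: "?e \<in> mor C X X" using assms by (auto intro: diff_mor)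
  have ee: "?e \<cdot> ?e = ?e"
    using assms(2,3) cmp_diff_left[OF idn_mor assms(2) t] cmp_diff_right[OF assms(2) idn_mor assms(2)]
      idn_left[OF t] idn_right[OF assms(2)] by simp
  have "is_iso C (e + ?e) X X"
    using is_isoI[OF idn_mor idn_mor idn_left[OF idn_mor] idn_left[OF idn_mor]] by simp
  moreover have "\<not> is_iso C e X X \<Longrightarrow> \<not> is_iso C ?e X X \<Longrightarrow> \<not> is_iso C (e + ?e) X X"
    using assms(1,2) t unfolding local_end_def by metis
  ultimately have "is_iso C e X X \<or> is_iso C ?e X X" by argo
  then show ?thesis
  proof
    assume "is_iso C ?e X X"
    then have "?e = idn C X" using ee by (rule iso_idempotent)
    then show ?thesis by simp
  qed (use iso_idempotent assms(3) in simp)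
qed

lemma local_end_retract:
  assumes X: "local_end C X" and Y: "local_end C Y" and a: "a \<in> mor C Y X" and b: "b \<in> mor C X Y"
    and ab: "is_iso C (a \<cdot> b) X X"
  shows "is_iso C a Y X"
proof -
  obtain h where h: "h \<in> mor C X X" "h \<cdot> (a \<cdot> b) = idn C X" "(a \<cdot> b) \<cdot> h = idn C X"
    using ab by (auto elim: is_isoE)
  have ha: "h \<cdot> a \<in> mor C Y X" and bh: "b \<cdot> h \<in> mor C X Y" and abm: "a \<cdot> b \<in> mor C X X"
    using a b h by (auto intro: cmp_mor)
  \<comment> \<open>Since \<open>b \<cdot> h\<close> is a right inverse of \<open>a\<close>,
    \<open>?e\<close> is an idempotent of \<open>Y\<close>, hence 0 or the identity; the value 0
    would force \<open>a = 0\<close>.\<close>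
  let ?e = "b \<cdot> (h \<cdot> a)"
  have e: "?e \<in> mor C Y Y" using ha b by (auto intro: cmp_mor)
  have 1: "a \<cdot> ?e = a"
    using cmp_assoc[OF a b ha] cmp_assoc[OF abm h(1) a] h idn_left[OF a] by simp
  have "?e \<cdot> ?e = ?e"
    using cmp_assoc[OF b ha e] cmp_assoc[OF h(1) a e] 1 by simp
  then consider "?e = 0" | "?e = idn C Y" using local_end_idempotent[OF Y e] by blast
  then show ?thesis
  proof cases
    case 1
    then have "a = 0" using \<open>a \<cdot> ?e = a\<close> cmp_zero_right[OF a] by simp
    then have "a \<cdot> b = 0" using cmp_zero_left[OF b] by simp
    then show ?thesis using not_iso_zero X ab unfolding local_end_def by metis
  next
    case 2
    show ?thesis
      by (rule is_isoI[OF a bh]) (use 2 cmp_assoc[OF b h(1) a] cmp_assoc[OF a b h(1)] h in auto)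
  qed
qed

text \<open>The lower right block of the inverse of an invertible \<open>2 \<times> 2\<close> matrix is inverse to the Schur
  complement of the upper left block.\<close>

lemma biproduct_cancel:
  assumes b: "biproduct C X [A, B] i p" and c: "biproduct C X [A', B'] j q"
    and iso: "is_iso C (p 0 \<cdot> j 0) A' A"
  shows "isomorphic C B' B"
proof -
  note I = biproduct2D[OF b] and J = biproduct2D[OF c]
  define u where "u = p 0 \<cdot> j 0"
  obtain v where u: "u \<in> mor C A' A" and v: "v \<in> mor C A A'" and vu: "v \<cdot> u = idn C A'" and uv: "u \<cdot> v = idn C A"
    using iso unfolding u_def by (auto elim: is_isoE)
  have ij: "p 0 \<cdot> j 1 \<in> mor C B' A" "p 1 \<cdot> j 0 \<in> mor C A' B" "p 1 \<cdot> j 1 \<in> mor C B' B"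
    "q 0 \<cdot> i 1 \<in> mor C B A'" "q 1 \<cdot> i 0 \<in> mor C A B'" "q 1 \<cdot> i 1 \<in> mor C B B'"
    using I J by (blast intro: cmp_mor)+
  have I9: "i 1 \<cdot> p 1 = idn C X - i 0 \<cdot> p 0" and J9: "j 1 \<cdot> q 1 = idn C X - j 0 \<cdot> q 0"
    using I(9) J(9) by (auto simp: eq_diff_eq add.commute)
  have e: "i 0 \<cdot> p 0 \<in> mor C X X" "j 0 \<cdot> q 0 \<in> mor C X X" using I J by (blast intro: cmp_mor)+
  define m where "m = v \<cdot> (p 0 \<cdot> j 1)"
  have m: "m \<in> mor C B' A'" unfolding m_def using v ij by (blast intro: cmp_mor)
  define s where "s = p 1 \<cdot> j 1 - (p 1 \<cdot> j 0) \<cdot> m"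
  have s: "s \<in> mor C B' B" unfolding s_def using ij m by (blast intro: cmp_mor diff_mor)
  let ?w = "q 1 \<cdot> i 1"
  have um: "u \<cdot> m = p 0 \<cdot> j 1"
    unfolding m_def using cmp_assoc[OF u v ij(1)] uv idn_left[OF ij(1)] by simp
  \<comment> \<open>\<open>R\<close> and \<open>R'\<close> compute products of matrix blocks by
    inserting the decomposition of the identity of \<open>X\<close> coming from one of the two
    biproducts.\<close>
  have R: "(q 1 \<cdot> i 1) \<cdot> (p 1 \<cdot> g) = q 1 \<cdot> g - (q 1 \<cdot> i 0) \<cdot> (p 0 \<cdot> g)" if "g \<in> mor C Z X" for g Z
    using cmp_assoc4[OF J(4) I(2,4) that] I9 cmp_diff_left[OF idn_mor e(1) that] idn_left[OF that]
      cmp_diff_right[OF J(4) that, of "(i 0 \<cdot> p 0) \<cdot> g"] cmp_mor[OF e(1) that]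
      cmp_assoc4[OF J(4) I(1,3) that] by simp
  have R': "(p g \<cdot> j 1) \<cdot> (q 1 \<cdot> i 1) = p g \<cdot> i 1 - (p g \<cdot> j 0) \<cdot> (q 0 \<cdot> i 1)" if "p g \<in> mor C X Z" for g Z
    using cmp_assoc4[OF that J(2,4) I(2)] J9 cmp_diff_left[OF idn_mor e(2) I(2)] idn_left[OF I(2)]
      cmp_diff_right[OF that I(2), of "(j 0 \<cdot> q 0) \<cdot> i 1"] cmp_mor[OF e(2) I(2)]
      cmp_assoc4[OF that J(1,3) I(2)] by simp
  have pj1m: "(p 1 \<cdot> j 0) \<cdot> m \<in> mor C B' B" using ij m by (blast intro: cmp_mor)
  have "?w \<cdot> s = ?w \<cdot> (p 1 \<cdot> j 1) - (?w \<cdot> (p 1 \<cdot> j 0)) \<cdot> m"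
    unfolding s_def using cmp_diff_right[OF ij(6,3) pj1m] cmp_assoc[OF ij(6,2) m] by simp
  also have "?w \<cdot> (p 1 \<cdot> j 0) = - ((q 1 \<cdot> i 0) \<cdot> u)"
    using R[OF J(1)] J(8) u_def by simp
  also have "(- ((q 1 \<cdot> i 0) \<cdot> u)) \<cdot> m = - ((q 1 \<cdot> i 0) \<cdot> (p 0 \<cdot> j 1))"
    using cmp_uminus_left[OF cmp_mor[OF ij(5) u] m] cmp_assoc[OF ij(5) u m] um by simp
  also have "?w \<cdot> (p 1 \<cdot> j 1) = idn C B' - (q 1 \<cdot> i 0) \<cdot> (p 0 \<cdot> j 1)"
    using R[OF J(2)] J(6) by simp
  finally have ws: "?w \<cdot> s = idn C B'" by simp
  have "m \<cdot> ?w = v \<cdot> ((p 0 \<cdot> j 1) \<cdot> ?w)" unfolding m_def using cmp_assoc[OF v ij(1,6)] .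
  also have "(p 0 \<cdot> j 1) \<cdot> ?w = - (u \<cdot> (q 0 \<cdot> i 1))" using R'[OF I(3)] I(7) u_def by simp
  also have "v \<cdot> (- (u \<cdot> (q 0 \<cdot> i 1))) = - (q 0 \<cdot> i 1)"
    using cmp_uminus_right[OF v cmp_mor[OF u ij(4)]] cmp_assoc[OF v u ij(4)] vu idn_left[OF ij(4)] by simp
  finally have mw: "m \<cdot> ?w = - (q 0 \<cdot> i 1)" .
  have "s \<cdot> ?w = (p 1 \<cdot> j 1) \<cdot> ?w - (p 1 \<cdot> j 0) \<cdot> (m \<cdot> ?w)"
    unfolding s_def using cmp_diff_left[OF ij(3) pj1m ij(6)] cmp_assoc[OF ij(2) m ij(6)] by simp
  also have "\<dots> = idn C B"
    unfolding mw using R'[OF I(4)] I(6) cmp_uminus_right[OF ij(2,4)] by simp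
  finally have "s \<cdot> ?w = idn C B" .
  then show ?thesis unfolding isomorphic_def using is_isoI[OF s ij(6) ws] by blast
qed

end

section \<open>Krull-Schmidt decompositions\<close>

context additive_category
begin

lemma ex_direct_sum: "\<exists>X. direct_sum C X Xs"
proof (induction Xs)
  case Nil
  then show ?case using ex_zero_object by (simp add: direct_sum_Nil)
next
  case (Cons Y Ys)
  then show ?case using ex_binary_sum direct_sum_Cons by metis
qed

lemma direct_sum_append:
  assumes "direct_sum C X [A, B]" "direct_sum C A As" "direct_sum C B Bs"
  shows "direct_sum C X (As @ Bs)"
  using assms
proof (induction As arbitrary: X A)
  case Nil
  then have "isomorphic C B X"
    using direct_sum_unique[OF direct_sum_zero_right[OF isomorphic_refl, of A B] direct_sum2_commute[of X A B]]
    by (simp add: direct_sum_Nil)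
  then show ?case using Nil direct_sum_iso by auto
next
  case (Cons a As)
  obtain A' where A': "direct_sum C A' As" using ex_direct_sum by blast
  obtain Z where Z: "direct_sum C Z [A', B]" using ex_direct_sum by blast
  have "direct_sum C X [B, A]" using Cons.prems(1) by (rule direct_sum2_commute)
  moreover have "direct_sum C A [a, A']" using Cons.prems(2) A' by (rule direct_sum_Cons_split)
  ultimately have "direct_sum C X [B, a, A']" by (rule direct_sum_Cons)
  then have "direct_sum C X [a, A', B]" by (rule direct_sum_mset) simp
  then have "direct_sum C X [a, Z]" using Z by (rule direct_sum_Cons_split)
  moreover have "direct_sum C Z (As @ Bs)" using Z A' Cons.prems(3) by (rule Cons.IH)
  ultimately show ?case using direct_sum_Cons by simp
qed

text \<open>The identity of \<open>A\<close> is the sum of its composites through the entries of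
  \<open>Ys\<close>, so locality makes one composite invertible. As that entry is local too, its
  component to \<open>A\<close> is an isomorphism, and cancelling it identifies the
  complements.\<close>

lemma local_end_exchange:
  assumes X: "direct_sum C X [A, S]" "local_end C A"
    and Ys: "direct_sum C X Ys" "\<And>Y. Y \<in> set Ys \<Longrightarrow> local_end C Y"
  obtains Y Zs where "mset Ys = mset (Y # Zs)" "isomorphic C A Y" "direct_sum C S Zs"
proof -
  obtain i p where b: "biproduct C X [A, S] i p" using X(1) unfolding direct_sum_def by blast
  obtain j q where c: "biproduct C X Ys j q" using Ys(1) unfolding direct_sum_def by blast
  note I = biproduct2D[OF b] and J = biproductD[OF c]
  have t: "p 0 \<cdot> j l \<in> mor C (Ys ! l) A" "q l \<cdot> i 0 \<in> mor C A (Ys ! l)"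
      "j l \<cdot> q l \<in> mor C X X" "(j l \<cdot> q l) \<cdot> i 0 \<in> mor C A X" if "l < length Ys" for l
    using I J that by (blast intro: cmp_mor)+
  have "(\<Sum>l<length Ys. (p 0 \<cdot> j l) \<cdot> (q l \<cdot> i 0)) = (\<Sum>l<length Ys. p 0 \<cdot> ((j l \<cdot> q l) \<cdot> i 0))"
    by (intro sum.cong refl) (use cmp_assoc4[OF I(3) J(1,2) I(1)] in auto)
  also have "\<dots> = p 0 \<cdot> (\<Sum>l<length Ys. (j l \<cdot> q l) \<cdot> i 0)"
    by (rule cmp_sum_right[OF I(3), symmetric]) (use t in auto)
  also have "(\<Sum>l<length Ys. (j l \<cdot> q l) \<cdot> i 0) = (\<Sum>l<length Ys. j l \<cdot> q l) \<cdot> i 0"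
    by (rule cmp_sum_left[OF _ I(1), symmetric]) (use t in auto)
  finally have "(\<Sum>l<length Ys. (p 0 \<cdot> j l) \<cdot> (q l \<cdot> i 0)) = idn C A"
    using J(5) I(5) idn_left[OF I(1)] by simp
  then have "is_iso C (\<Sum>l<length Ys. (p 0 \<cdot> j l) \<cdot> (q l \<cdot> i 0)) A A"
    using is_isoI[OF idn_mor idn_mor idn_left[OF idn_mor] idn_left[OF idn_mor], of A] by simp
  then have "\<exists>l\<in>{..<length Ys}. is_iso C ((p 0 \<cdot> j l) \<cdot> (q l \<cdot> i 0)) A A"
    by (rule local_end_sum[OF X(2) finite_lessThan, rotated]) (use t in \<open>blast intro: cmp_mor\<close>)
  then obtain l where l: "l < length Ys" "is_iso C ((p 0 \<cdot> j l) \<cdot> (q l \<cdot> i 0)) A A" by blast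
  have iso: "is_iso C (p 0 \<cdot> j l) (Ys ! l) A"
    using local_end_retract[OF X(2) Ys(2) t(1)[OF l(1)] t(2)[OF l(1)] l(2)] l(1) by simp
  obtain Zs j' q' where Z: "mset Ys = mset (Ys ! l # Zs)" "biproduct C X (Ys ! l # Zs) j' q'" "j' 0 = j l"
    using biproduct_move_head[OF c l(1)] by metis
  obtain S' where S': "direct_sum C S' Zs" using ex_direct_sum by blast
  obtain j'' q'' where d: "biproduct C X [Ys ! l, S'] j'' q''" "j'' 0 = j l"
    using biproduct_Cons_split[OF Z(2) S'] Z(3) by metis
  have "isomorphic C S' S" by (rule biproduct_cancel[OF b d(1)]) (use iso d(2) in simp)
  then have "direct_sum C S Zs" using S' direct_sum_iso by blast
  moreover have "isomorphic C A (Ys ! l)"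
    using iso isomorphic_sym unfolding isomorphic_def[of _ "Ys ! l"] by (metis isomorphic_def)
  ultimately show ?thesis using that Z(1) by blast
qed

lemma local_end_decomposition_unique:
  assumes "direct_sum C X Xs" "\<And>Y. Y \<in> set Xs \<Longrightarrow> local_end C Y"
    and "direct_sum C X Ys" "\<And>Y. Y \<in> set Ys \<Longrightarrow> local_end C Y"
  shows "mset (map (iso_class C) Xs) = mset (map (iso_class C) Ys)"
  using assms
proof (induction Xs arbitrary: X Ys)
  case Nil
  then have X: "idn C X = 0" by (simp add: direct_sum_Nil zero_object_iff)
  have "Ys = []"
  proof (rule ccontr)
    assume ne: "Ys \<noteq> []"
    obtain j q where "biproduct C X Ys j q" using Nil.prems(3) unfolding direct_sum_def by blast
    note J = biproductD(1-3)[OF this, of 0]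
    have "idn C (Ys ! 0) = q 0 \<cdot> (idn C X \<cdot> j 0)" using ne J(1,3) idn_left[OF J(1)] by simp
    then have "idn C (Ys ! 0) = 0" using X J(1,2) ne cmp_zero_left cmp_zero_right by fastforce
    then show False using Nil.prems(4)[of "Ys ! 0"] ne unfolding local_end_def by simp
  qed
  then show ?case by simp
next
  case (Cons A Xs)
  obtain S where S: "direct_sum C S Xs" using ex_direct_sum by blast
  have "direct_sum C X [A, S]" using Cons.prems(1) S by (rule direct_sum_Cons_split)
  then obtain Y Zs where Z: "mset Ys = mset (Y # Zs)" "isomorphic C A Y" "direct_sum C S Zs"
    using local_end_exchange[OF _ _ Cons.prems(3,4)] Cons.prems(2) by (metis list.set_intros(1))
  have "set Ys = set (Y # Zs)" using Z(1) by (rule mset_eq_setD)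
  then have "mset (map (iso_class C) Xs) = mset (map (iso_class C) Zs)"
    using Cons.IH[OF S _ Z(3)] Cons.prems(2,4) by simp
  moreover have "mset (map (iso_class C) Ys) = mset (map (iso_class C) (Y # Zs))"
    using Z(1) by (metis mset_map)
  ultimately show ?case using Z(2) iso_class_eq_iff by simp
qed

text \<open>The description is unique by \<open>local_end_decomposition_unique\<close>. Turning
  objects into multisets lets later arguments cancel and compare direct sums by plain
  arithmetic.\<close>

definition ks :: "'o \<Rightarrow> 'o set multiset" where
  "ks X = (THE M. \<exists>Xs. direct_sum C X Xs \<and> (\<forall>Y\<in>set Xs. local_end C Y) \<and> M = mset (map (iso_class C) Xs))"

lemma ks_eq:
  assumes "direct_sum C X Xs" "\<And>Y. Y \<in> set Xs \<Longrightarrow> local_end C Y"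
  shows "ks X = mset (map (iso_class C) Xs)"
  unfolding ks_def
  by (rule the_equality) (use assms local_end_decomposition_unique[OF _ _ assms] in blast)+

end

locale krull_schmidt_category = additive_category C
  for C :: "('k::field, 'o, 'm::ab_group_add, 'z) lincat_scheme" (structure) +
  assumes krull_schmidt: "krull_schmidt C"
begin

lemma ex_local_decomposition:
  obtains Xs where "direct_sum C X Xs" "\<And>Y. Y \<in> set Xs \<Longrightarrow> local_end C Y"
    "ks X = mset (map (iso_class C) Xs)"
  using krull_schmidt ks_eq unfolding krull_schmidt_def by metis

section \<open>Dictionary between direct sums and multisets of isomorphism classes\<close>

lemma ks_direct_sum2:
  assumes "direct_sum C X [A, B]" shows "ks X = ks A + ks B"
proof -
  obtain As where A: "direct_sum C A As" "\<And>Y. Y \<in> set As \<Longrightarrow> local_end C Y"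
    "ks A = mset (map (iso_class C) As)" using ex_local_decomposition by blast
  obtain Bs where B: "direct_sum C B Bs" "\<And>Y. Y \<in> set Bs \<Longrightarrow> local_end C Y"
    "ks B = mset (map (iso_class C) Bs)" using ex_local_decomposition by blast
  show ?thesis using ks_eq[OF direct_sum_append[OF assms A(1) B(1)]] A B by auto
qed

lemma ks_local: "local_end C X \<Longrightarrow> ks X = {#iso_class C X#}"
  using ks_eq[OF direct_sum_single, of X] by simp

lemma ks_zero: "zero_object C X \<Longrightarrow> ks X = {#}"
  using ks_eq[of X "[]"] by (simp add: direct_sum_Nil)

lemma mem_ks_split:
  assumes "c \<in># ks X"
  obtains Y S where "local_end C Y" "iso_class C Y = c" "direct_sum C X [Y, S]"
proof -
  obtain Xs where X: "direct_sum C X Xs" "\<And>Y. Y \<in> set Xs \<Longrightarrow> local_end C Y"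
    "ks X = mset (map (iso_class C) Xs)" using ex_local_decomposition by blast
  have "c \<in> iso_class C ` set Xs" using assms X(3) by simp
  then obtain Y where Y: "Y \<in> set Xs" "iso_class C Y = c" by blast
  obtain Ys Zs where s: "Xs = Ys @ Y # Zs" using split_list[OF Y(1)] by blast
  obtain S where S: "direct_sum C S (Ys @ Zs)" using ex_direct_sum by blast
  have "direct_sum C X (Y # Ys @ Zs)" using X(1) by (rule direct_sum_mset) (simp add: s)
  then have "direct_sum C X [Y, S]" using S by (rule direct_sum_Cons_split)
  then show ?thesis using that X(2) Y by blast
qed

lemma isomorphic_iff_ks: "isomorphic C X Y \<longleftrightarrow> ks X = ks Y"
proof
  assume "isomorphic C X Y"
  moreover obtain Xs where X: "direct_sum C X Xs" "\<And>Y. Y \<in> set Xs \<Longrightarrow> local_end C Y"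
    "ks X = mset (map (iso_class C) Xs)" using ex_local_decomposition by blast
  ultimately show "ks X = ks Y" using direct_sum_iso ks_eq by metis
next
  assume "ks X = ks Y"
  then show "isomorphic C X Y"
  proof (induction "ks X" arbitrary: X Y)
    case empty
    obtain Xs where "direct_sum C X Xs" "ks X = mset (map (iso_class C) Xs)" using ex_local_decomposition by blast
    moreover obtain Ys where "direct_sum C Y Ys" "ks Y = mset (map (iso_class C) Ys)" using ex_local_decomposition by blast
    ultimately show ?case using empty direct_sum_unique by simp
  next
    case (add c M)
    obtain A S where A: "iso_class C A = c" "direct_sum C X [A, S]" "local_end C A"
      using mem_ks_split[of c X] add.hyps(2) by (metis union_single_eq_member)
    obtain B R where B: "iso_class C B = c" "direct_sum C Y [B, R]" "local_end C B"
      using mem_ks_split[of c Y] add by (metis union_single_eq_member)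
    have "ks X = {#c#} + ks S" using ks_direct_sum2[OF A(2)] ks_local[OF A(3)] A(1) by simp
    moreover have "ks Y = {#c#} + ks R" using ks_direct_sum2[OF B(2)] ks_local[OF B(3)] B(1) by simp
    ultimately have "M = ks S" "ks S = ks R" using add by auto
    then have SR: "isomorphic C S R" using add.hyps(1) by blast
    have AB: "isomorphic C A B" using A(1) B(1) iso_class_eq_iff by metis
    have "direct_sum C B [A]" "direct_sum C R [S]" using AB SR isomorphic_sym direct_sum_singleton_iff by blast+
    then have "direct_sum C Y [A, S]" using direct_sum_append[OF B(2), of "[A]" "[S]"] by simp
    then show ?case using A(2) direct_sum_unique by blast
  qed
qed

lemma direct_sum2_iff_ks: "direct_sum C X [A, B] \<longleftrightarrow> ks X = ks A + ks B"
proof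
  assume "ks X = ks A + ks B"
  moreover obtain Z where Z: "direct_sum C Z [A, B]" using ex_direct_sum by blast
  ultimately have "isomorphic C Z X" using ks_direct_sum2 isomorphic_iff_ks by simp
  then show "direct_sum C X [A, B]" using Z direct_sum_iso by blast
qed (rule ks_direct_sum2)

lemma zero_object_iff_ks: "zero_object C X \<longleftrightarrow> ks X = {#}"
proof
  assume "ks X = {#}"
  moreover obtain Z where Z: "zero_object C Z" using ex_zero_object by blast
  ultimately have "isomorphic C Z X" using ks_zero isomorphic_iff_ks by simp
  then show "zero_object C X" using Z direct_sum_iso[of Z "[]"] by (simp add: direct_sum_Nil)
qed (rule ks_zero)

lemma ks_direct_sum: "direct_sum C X Xs \<Longrightarrow> ks X = (\<Sum>Y\<leftarrow>Xs. ks Y)"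
proof (induction Xs arbitrary: X)
  case Nil
  then show ?case by (simp add: direct_sum_Nil ks_zero)
next
  case (Cons Y Ys)
  obtain S where S: "direct_sum C S Ys" using ex_direct_sum by blast
  show ?case using Cons.IH[OF S] ks_direct_sum2[OF direct_sum_Cons_split[OF Cons.prems S]] by simp
qed

lemma ex_ks: "\<exists>X. ks X = ks A + ks B"
  using ex_direct_sum ks_direct_sum2 by blast

text \<open>Each class can be split off some object and then added as often as desired, so
  multiplicities are unrestricted. This turns integral coefficient functions into objects.\<close>

lemma ex_ks_sub:
  assumes "\<And>c. c \<in># M \<Longrightarrow> \<exists>Y. c \<in># ks Y"
  shows "\<exists>X. ks X = M"
  using assms
proof (induction M)
  case empty
  then show ?case using ex_zero_object ks_zero by blast
next
  case (add c M)
  obtain A where A: "ks A = M" using add by force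
  obtain Y where "c \<in># ks Y" using add.prems[of c] by auto
  then obtain B where B: "ks B = {#c#}" using mem_ks_split ks_local by metis
  obtain X where "ks X = ks B + ks A" using ex_ks by blast
  then show ?case unfolding A B by (metis add_mset_add_single add.commute)
qed

lemma summand_iff_ks: "summand C Y X \<longleftrightarrow> ks Y \<subseteq># ks X"
proof
  assume "ks Y \<subseteq># ks X"
  then obtain N where N: "ks X = ks Y + N" by (metis subset_mset.le_iff_add)
  have "\<exists>Z. ks Z = N" by (rule ex_ks_sub) (metis N union_iff)
  then obtain Z where "ks Z = N" by blast
  then have "direct_sum C X [Y, Z]" using N direct_sum2_iff_ks by simp
  then show "summand C Y X" unfolding summand_def by blast
next
  assume "summand C Y X"
  then obtain Z where "direct_sum C X [Y, Z]" unfolding summand_def by blast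
  then show "ks Y \<subseteq># ks X" using ks_direct_sum2 by simp
qed

lemma indecomposable_iff_ks: "indecomposable C X \<longleftrightarrow> ks X = {#iso_class C X#}"
proof
  assume X: "indecomposable C X"
  then obtain c where "c \<in># ks X" unfolding indecomposable_def zero_object_iff_ks by fastforce
  then obtain Y S where Y: "local_end C Y" "direct_sum C X [Y, S]" by (rule mem_ks_split)
  then have "\<not> zero_object C Y" unfolding zero_object_iff local_end_def by simp
  then have "ks S = {#}" using X Y unfolding indecomposable_def zero_object_iff_ks by metis
  then have "ks X = ks Y" using ks_direct_sum2[OF Y(2)] by simp
  then show "ks X = {#iso_class C X#}" using ks_local[OF Y(1)] isomorphic_iff_ks iso_class_eq_iff by metis
next
  assume X: "ks X = {#iso_class C X#}"
  then show "indecomposable C X"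
    unfolding indecomposable_def zero_object_iff_ks direct_sum2_iff_ks by (auto simp: single_is_union)
qed

lemma mem_ks_iff: "c \<in># ks X \<longleftrightarrow> (\<exists>Y. indecomposable C Y \<and> summand C Y X \<and> iso_class C Y = c)"
proof
  assume "c \<in># ks X"
  then obtain Y S where "local_end C Y" "iso_class C Y = c" "direct_sum C X [Y, S]" by (rule mem_ks_split)
  then show "\<exists>Y. indecomposable C Y \<and> summand C Y X \<and> iso_class C Y = c"
    unfolding indecomposable_iff_ks summand_def using ks_local by blast
qed (auto simp: indecomposable_iff_ks summand_iff_ks)

lemma add_of_iff_ks: "X \<in> add_of C T \<longleftrightarrow> set_mset (ks X) \<subseteq> set_mset (ks T)"
proof -
  have T: "ks Y = repeat_mset n (ks T)" if "direct_sum C Y (replicate n T)" for n Y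
  proof -
    have "sum_list (replicate n (ks T)) = repeat_mset n (ks T)" by (induction n) auto
    then show ?thesis using ks_direct_sum[OF that] by simp
  qed
  show ?thesis
  proof
    assume "X \<in> add_of C T"
    then obtain n Y where "ks Y = repeat_mset n (ks T)" "ks X \<subseteq># ks Y"
      unfolding add_of_def summand_iff_ks using T by blast
    then show "set_mset (ks X) \<subseteq> set_mset (ks T)"
      by (metis count_eq_zero_iff count_repeat_mset mset_subset_eqD mult_0_right subsetI)
  next
    assume s: "set_mset (ks X) \<subseteq> set_mset (ks T)"
    \<comment> \<open>No multiplicity in \<open>ks X\<close> exceeds its size, so \<open>?n\<close>
      copies of \<open>T\<close> leave room for all of \<open>X\<close>.\<close>
    let ?n = "size (ks X)"
    obtain Y where Y: "direct_sum C Y (replicate ?n T)" using ex_direct_sum by blast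
    have "count (ks X) c \<le> count (repeat_mset ?n (ks T)) c" for c
    proof (cases "c \<in># ks X")
      case True
      then have "count (ks T) c \<ge> 1" using s by (meson count_greater_eq_one_iff subsetD)
      moreover have "count (ks X) c \<le> ?n" by (rule count_le_size)
      ultimately show ?thesis by (simp add: mult_le_mono order_trans[OF _ mult_le_mono2[of 1]])
    qed (simp add: not_in_iff)
    then have "ks X \<subseteq># ks Y" using T[OF Y] by (simp add: subseteq_mset_def)
    then show "X \<in> add_of C T" unfolding add_of_def summand_iff_ks using Y by blast
  qed
qed

end

section \<open>Conflations\<close>

context extriangulated_category
begin

sublocale E: vector_space "escale C" by (rule ext_vector_space)

lemma zero_ext [simp]: "0 \<in> ext C Z A"
  using E.subspace_0[OF ext_subspace] .

lemma add_ext: "\<delta> \<in> ext C Z A \<Longrightarrow> \<delta>' \<in> ext C Z A \<Longrightarrow> \<delta> + \<delta>' \<in> ext C Z A"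
  using E.subspace_add[OF ext_subspace] .

lemma diff_ext: "\<delta> \<in> ext C Z A \<Longrightarrow> \<delta>' \<in> ext C Z A \<Longrightarrow> \<delta> - \<delta>' \<in> ext C Z A"
  using E.subspace_diff[OF ext_subspace] .

lemma ext_eq_zeroI: "(\<And>\<delta>. \<delta> \<in> ext C Z A \<Longrightarrow> \<delta> = 0) \<Longrightarrow> ext C Z A = {0}"
  using zero_ext by blast

lemma push_zero: "a \<in> mor C A A' \<Longrightarrow> push C a 0 = 0"
  using push_add_right[OF _ zero_ext zero_ext, of a A A'] by simp

lemma pull_zero: "c \<in> mor C Z' Z \<Longrightarrow> pull C c 0 = 0"
  using pull_add_right[OF _ zero_ext zero_ext, of c Z' Z] by simp

lemma zero_push: "\<delta> \<in> ext C Z A \<Longrightarrow> push C 0 \<delta> = 0"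
  using push_add_left[OF zero_mor zero_mor, of \<delta> Z A] by simp

lemma zero_pull: "\<delta> \<in> ext C Z A \<Longrightarrow> pull C 0 \<delta> = 0"
  using pull_add_left[OF zero_mor zero_mor, of \<delta> Z A] by simp

lemma push_diff_left:
  "\<lbrakk>a \<in> mor C A A'; a' \<in> mor C A A'; \<delta> \<in> ext C Z A\<rbrakk> \<Longrightarrow> push C (a - a') \<delta> = push C a \<delta> - push C a' \<delta>"
  using push_add_left[OF diff_mor, of a A A' a' a' \<delta> Z] by (simp add: eq_diff_eq)

lemma pull_diff_left:
  "\<lbrakk>c \<in> mor C Z' Z; c' \<in> mor C Z' Z; \<delta> \<in> ext C Z A\<rbrakk> \<Longrightarrow> pull C (c - c') \<delta> = pull C c \<delta> - pull C c' \<delta>"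
  using pull_add_left[OF diff_mor, of c Z' Z c' c' \<delta> A] by (simp add: eq_diff_eq)

lemma push_diff_right:
  "\<lbrakk>a \<in> mor C A A'; \<delta> \<in> ext C Z A; \<delta>' \<in> ext C Z A\<rbrakk> \<Longrightarrow> push C a (\<delta> - \<delta>') = push C a \<delta> - push C a \<delta>'"
  using push_add_right[OF _ diff_ext, of a A A' \<delta> Z \<delta>' \<delta>'] by (simp add: eq_diff_eq)

lemma pull_diff_right:
  "\<lbrakk>c \<in> mor C Z' Z; \<delta> \<in> ext C Z A; \<delta>' \<in> ext C Z A\<rbrakk> \<Longrightarrow> pull C c (\<delta> - \<delta>') = pull C c \<delta> - pull C c \<delta>'"
  using pull_add_right[OF _ diff_ext, of c Z' Z \<delta> A \<delta>' \<delta>'] by (simp add: eq_diff_eq)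

section \<open>Exactness properties of triangles\<close>

lemma realn_seqs: "\<delta> \<in> ext C Z A \<Longrightarrow> realn C Z A \<delta> \<subseteq> seqs C A Z"
  using realn_class[of \<delta> Z A] by (auto simp: quotient_def seq_equiv_def)

lemma etriD:
  assumes "etri C A B Z x y \<delta>"
  shows "\<delta> \<in> ext C Z A" "x \<in> mor C A B" "y \<in> mor C B Z"
  using assms realn_seqs[of \<delta> Z A] unfolding etri_def seqs_def by auto

lemma etri_equiv:
  assumes "etri C A B Z x y \<delta>" "etri C A B' Z x' y' \<delta>"
  shows "isomorphic C B B'"
proof -
  obtain s where s: "realn C Z A \<delta> = seq_equiv C A Z `` {s}"
    using realn_class[OF etriD(1)[OF assms(1)]] by (auto simp: quotient_def)
  obtain B0 x0 y0 where s0: "s = (B0, x0, y0)" by (cases s) auto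
  have "((B0, x0, y0), (B, x, y)) \<in> seq_equiv C A Z" "((B0, x0, y0), (B', x', y')) \<in> seq_equiv C A Z"
    using assms unfolding etri_def s s0 by auto
  then have "isomorphic C B0 B" "isomorphic C B0 B'"
    unfolding seq_equiv_def isomorphic_def by auto
  then show ?thesis using isomorphic_sym isomorphic_trans by blast
qed

lemma ex_etri:
  assumes "\<delta> \<in> ext C Z A"
  obtains B x y where "etri C A B Z x y \<delta>"
proof -
  obtain s where s: "realn C Z A \<delta> = seq_equiv C A Z `` {s}" "s \<in> seqs C A Z"
    using realn_class[OF assms] by (auto simp: quotient_def)
  obtain B x y where s0: "s = (B, x, y)" by (cases s) auto
  then have "x \<in> mor C A B" "y \<in> mor C B Z" using s(2) unfolding seqs_def by auto
  then have "(s, s) \<in> seq_equiv C A Z"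
    using s(2) is_isoI[OF idn_mor idn_mor idn_left[OF idn_mor] idn_left[OF idn_mor], of B]
      idn_left idn_right unfolding s0 seq_equiv_def by blast
  then show ?thesis using that s(1) assms unfolding s0 etri_def by blast
qed

lemma etri_split:
  assumes "i0 \<in> mor C A X" "i1 \<in> mor C B X" "p0 \<in> mor C X A" "p1 \<in> mor C X B"
    and "p0 \<cdot> i0 = idn C A" "p1 \<cdot> i1 = idn C B" "p0 \<cdot> i1 = 0" "p1 \<cdot> i0 = 0"
    and "i0 \<cdot> p0 + i1 \<cdot> p1 = idn C X"
  shows "etri C A X B i0 p1 0"
  using realn_zero[OF biproduct2I[OF assms]] unfolding etri_def by simp

lemma etri_idn_zero: "zero_object C N \<Longrightarrow> etri C A A N (idn C A) 0 0"
  by (rule etri_split[of _ _ _ 0 N "idn C A"])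
    (simp_all add: idn_left[OF idn_mor] zero_object_iff cmp_zero_left[OF zero_mor] cmp_zero_right[OF idn_mor] cmp_zero_left[OF idn_mor])

lemma etri_zero_idn: "zero_object C N \<Longrightarrow> etri C N A A 0 (idn C A) 0"
  by (rule etri_split[of 0 N _ "idn C A" A 0])
    (simp_all add: idn_left[OF idn_mor] zero_object_iff cmp_zero_left[OF zero_mor] cmp_zero_right[OF idn_mor] cmp_zero_left[OF idn_mor])

text \<open>Comparison with the trivial triangle on \<open>A\<close> factors
  \<open>y \<cdot> x\<close> through a zero object. Similar comparisons with trivial triangles give
  the weak kernel and weak cokernel properties below.\<close>

lemma cmp_etri:
  assumes e: "etri C A B Z x y \<delta>" shows "y \<cdot> x = 0"
proof -
  note D = etriD[OF e]
  obtain N where N: "zero_object C N" using ex_zero_object by blast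
  obtain c where "c \<in> mor C N Z" "c \<cdot> 0 = y \<cdot> x"
    using ET3[OF etri_idn_zero[OF N, of A] e idn_mor D(2)] by auto
  then show ?thesis using cmp_zero_right by simp
qed

lemma weak_kernel:
  assumes e: "etri C A B Z x y \<delta>" and b: "b \<in> mor C X B" "y \<cdot> b = 0"
  obtains a where "a \<in> mor C X A" "b = x \<cdot> a"
proof -
  obtain N where N: "zero_object C N" using ex_zero_object by blast
  have "0 \<cdot> 0 = y \<cdot> b" using b cmp_zero_left[OF zero_mor] by simp
  then obtain a where "a \<in> mor C X A" "b \<cdot> idn C X = x \<cdot> a"
    using ET3_op[OF etri_idn_zero[OF N, of X] e b(1) zero_mor] by auto
  then show ?thesis using that idn_right[OF b(1)] by simp
qed

lemma weak_cokernel: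
  assumes e: "etri C A B Z x y \<delta>" and b: "b \<in> mor C B X" "b \<cdot> x = 0"
  obtains c where "c \<in> mor C Z X" "b = c \<cdot> y"
proof -
  obtain N where N: "zero_object C N" using ex_zero_object by blast
  have "b \<cdot> x = 0 \<cdot> 0" using b cmp_zero_left[OF zero_mor] by simp
  then obtain c where "c \<in> mor C Z X" "c \<cdot> y = idn C X \<cdot> b"
    using ET3[OF e etri_zero_idn[OF N, of X] zero_mor b(1)] by auto
  then show ?thesis using that idn_left[OF b(1)] by simp
qed

lemma push_inflation:
  assumes e: "etri C A B Z x y \<delta>" shows "push C x \<delta> = 0"
proof -
  note D = etriD[OF e]
  obtain N where N: "zero_object C N" using ex_zero_object by blast
  obtain c where "c \<in> mor C Z N" "push C x \<delta> = pull C c 0"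
    using ET3[OF e etri_idn_zero[OF N, of B] D(2) idn_mor] idn_left[OF D(2)] by auto
  then show ?thesis using pull_zero by simp
qed

text \<open>As \<open>pull C c \<delta>\<close> vanishes, the split triangle on \<open>A\<close> and
  \<open>X\<close> maps to the given one over \<open>c\<close>; the lift is its middle map
  restricted to the summand \<open>X\<close>.\<close>

lemma lift_along_deflation:
  assumes e: "etri C A B Z x y \<delta>" and c: "c \<in> mor C X Z" "pull C c \<delta> = 0"
  obtains b where "b \<in> mor C X B" "y \<cdot> b = c"
proof -
  note D = etriD[OF e]
  obtain S where "direct_sum C S [A, X]" using ex_binary_sum by blast
  then obtain i0 i1 p0 p1 where S: "i0 \<in> mor C A S" "i1 \<in> mor C X S" "p0 \<in> mor C S A" "p1 \<in> mor C S X"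
    "p0 \<cdot> i0 = idn C A" "p1 \<cdot> i1 = idn C X" "p0 \<cdot> i1 = 0" "p1 \<cdot> i0 = 0"
    "i0 \<cdot> p0 + i1 \<cdot> p1 = idn C S" by (rule direct_sum2E)
  have "push C (idn C A) 0 = pull C c \<delta>" using c push_zero[OF idn_mor] by simp
  then obtain b where b: "b \<in> mor C S B" "y \<cdot> b = c \<cdot> p1"
    using realn_morphism[OF etri_split[OF S] e idn_mor c(1)] by auto
  have "y \<cdot> (b \<cdot> i1) = c"
    using cmp_assoc[OF D(3) b(1) S(2)] cmp_assoc[OF c(1) S(4,2)] b(2) S(6) idn_right[OF c(1)] by simp
  then show ?thesis using that cmp_mor[OF b(1) S(2)] by blast
qed

lemma extend_along_inflation:
  assumes e: "etri C A B Z x y \<delta>" and a: "a \<in> mor C A X" "push C a \<delta> = 0"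
  obtains b where "b \<in> mor C B X" "b \<cdot> x = a"
proof -
  note D = etriD[OF e]
  obtain S where "direct_sum C S [X, Z]" using ex_binary_sum by blast
  then obtain i0 i1 p0 p1 where S: "i0 \<in> mor C X S" "i1 \<in> mor C Z S" "p0 \<in> mor C S X" "p1 \<in> mor C S Z"
    "p0 \<cdot> i0 = idn C X" "p1 \<cdot> i1 = idn C Z" "p0 \<cdot> i1 = 0" "p1 \<cdot> i0 = 0"
    "i0 \<cdot> p0 + i1 \<cdot> p1 = idn C S" by (rule direct_sum2E)
  have "push C a \<delta> = pull C (idn C Z) 0" using a pull_zero[OF idn_mor] by simp
  then obtain b where b: "b \<in> mor C B S" "b \<cdot> x = i0 \<cdot> a"
    using realn_morphism[OF e etri_split[OF S] a(1) idn_mor] by auto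
  have "(p0 \<cdot> b) \<cdot> x = a"
    using cmp_assoc[OF S(3) b(1) D(2)] cmp_assoc[OF S(3,1) a(1)] b(2) S(5) idn_left[OF a(1)] by simp
  then show ?thesis using that cmp_mor[OF S(3) b(1)] by blast
qed

text \<open>Since \<open>y\<close> pulls \<open>\<epsilon>\<close> back to 0, it lifts to the middle
  term of \<open>\<epsilon>\<close>; completing the lift to a morphism of triangles produces
  \<open>a\<close>. This is one exactness statement of the long exact sequence.\<close>

lemma ext_from_pull_zero:
  assumes e: "etri C A B Z x y \<delta>" and \<epsilon>: "\<epsilon> \<in> ext C Z X" "pull C y \<epsilon> = 0"
  obtains a where "a \<in> mor C A X" "\<epsilon> = push C a \<delta>"
proof -
  note D = etriD[OF e]
  obtain M m n where M: "etri C X M Z m n \<epsilon>" using \<epsilon>(1) by (rule ex_etri)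
  obtain b where b: "b \<in> mor C B M" "n \<cdot> b = y" using lift_along_deflation[OF M D(3) \<epsilon>(2)] .
  then obtain a where "a \<in> mor C A X" "push C a \<delta> = pull C (idn C Z) \<epsilon>"
    using ET3_op[OF e M b(1) idn_mor] idn_left[OF D(3)] by auto
  then show ?thesis using that pull_idn[OF \<epsilon>(1)] by simp
qed

lemma ext_from_push_zero:
  assumes e: "etri C A B Z x y \<delta>" and \<epsilon>: "\<epsilon> \<in> ext C X A" "push C x \<epsilon> = 0"
  obtains c where "c \<in> mor C X Z" "\<epsilon> = pull C c \<delta>"
proof -
  note D = etriD[OF e]
  obtain M m n where M: "etri C A M X m n \<epsilon>" using \<epsilon>(1) by (rule ex_etri)
  obtain b where b: "b \<in> mor C M B" "b \<cdot> m = x" using extend_along_inflation[OF M D(2) \<epsilon>(2)] .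
  then obtain c where "c \<in> mor C X Z" "push C (idn C A) \<epsilon> = pull C c \<delta>"
    using ET3[OF M e idn_mor b(1)] idn_right[OF D(2)] by auto
  then show ?thesis using that push_idn[OF \<epsilon>(1)] by simp
qed

text \<open>Compose \<open>x\<close> with the inflation realising \<open>\<epsilon>\<close>. The
  cone \<open>E\<close> is an extension of \<open>X\<close> by \<open>Z\<close> with class
  \<open>push C y \<epsilon> = 0\<close>, so it has a section \<open>s\<close>; the preimage is the
  class of the composite, pulled back along \<open>s\<close>.\<close>

lemma ext_exact_middle:
  assumes e: "etri C A B Z x y \<delta>" and \<epsilon>: "\<epsilon> \<in> ext C X B" "push C y \<epsilon> = 0"
  obtains \<epsilon>' where "\<epsilon>' \<in> ext C X A" "\<epsilon> = push C x \<epsilon>'"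
proof -
  note D = etriD[OF e]
  obtain M g g' where M: "etri C B M X g g' \<epsilon>" using \<epsilon>(1) by (rule ex_etri)
  obtain E h' d f \<delta>'' where E: "etri C A M E (g \<cdot> x) h' \<delta>''" "f \<in> mor C E X"
      "etri C Z E X d f (push C y \<epsilon>)" "push C x \<delta>'' = pull C f \<epsilon>"
    using ET4[OF e M] by blast
  have "pull C (idn C X) (push C y \<epsilon>) = 0" using \<epsilon>(2) pull_zero[OF idn_mor] by simp
  then obtain s where s: "s \<in> mor C X E" "f \<cdot> s = idn C X"
    using lift_along_deflation[OF E(3) idn_mor] by blast
  note \<delta>'' = etriD(1)[OF E(1)]
  have "push C x (pull C s \<delta>'') = pull C s (pull C f \<epsilon>)" using push_pull[OF D(2) s(1) \<delta>''] E(4) by simp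
  also have "\<dots> = \<epsilon>" using pull_cmp[OF E(2) s(1) \<epsilon>(1)] s(2) pull_idn[OF \<epsilon>(1)] by simp
  finally show ?thesis using that pull_ext[OF s(1) \<delta>''] by metis
qed

text \<open>The section is adapted to the prescribed \<open>r\<close> by applying the projector
  \<open>idn C B - x \<cdot> r\<close> to an arbitrary section. The pullback below needs this
  freedom, because only a corrected retraction has the right effect on extension classes.\<close>

lemma etri_zero_retraction:
  assumes e: "etri C A B Z x y 0" and r: "r \<in> mor C B A" "r \<cdot> x = idn C A"
  obtains s where "s \<in> mor C Z B" "y \<cdot> s = idn C Z" "r \<cdot> s = 0" "x \<cdot> r + s \<cdot> y = idn C B"
proof -
  note D = etriD[OF e]
  obtain s0 where s0: "s0 \<in> mor C Z B" "y \<cdot> s0 = idn C Z"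
    using lift_along_deflation[OF e idn_mor pull_zero[OF idn_mor]] .
  have xr: "x \<cdot> r \<in> mor C B B" using D r by (blast intro: cmp_mor)
  then have t: "idn C B - x \<cdot> r \<in> mor C B B" by (blast intro: diff_mor)
  have "(idn C B - x \<cdot> r) \<cdot> x = 0"
    using cmp_diff_left[OF idn_mor xr D(2)] cmp_assoc[OF D(2) r(1) D(2)] r(2) idn_left[OF D(2)] idn_right[OF D(2)] by simp
  then obtain s where s: "s \<in> mor C Z B" "idn C B - x \<cdot> r = s \<cdot> y" using weak_cokernel[OF e t] by blast
  have ss: "s = (idn C B - x \<cdot> r) \<cdot> s0"
    using s(2) cmp_assoc[OF s(1) D(3) s0(1)] s0(2) idn_right[OF s(1)] by simp
  have "y \<cdot> (idn C B - x \<cdot> r) = y"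
    using cmp_diff_right[OF D(3) idn_mor xr] cmp_assoc[OF D(3,2) r(1)] cmp_etri[OF e] cmp_zero_left[OF r(1)] idn_right[OF D(3)] by simp
  then have "y \<cdot> s = idn C Z" unfolding ss using cmp_assoc[OF D(3) t s0(1)] s0(2) by simp
  moreover have "r \<cdot> (idn C B - x \<cdot> r) = 0"
    using cmp_diff_right[OF r(1) idn_mor xr] cmp_assoc[OF r(1) D(2) r(1)] r(2) idn_right[OF r(1)] idn_left[OF r(1)] by simp
  then have "r \<cdot> s = 0" unfolding ss using cmp_assoc[OF r(1) t s0(1)] cmp_zero_left[OF s0(1)] by simp
  moreover have "x \<cdot> r + s \<cdot> y = idn C B" using s(2) by (metis add.commute diff_add_cancel)
  ultimately show ?thesis using that s(1) by blast
qed

lemma etri_zero_section: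
  assumes e: "etri C A B Z x y 0" and s: "s \<in> mor C Z B" "y \<cdot> s = idn C Z"
  obtains r where "r \<in> mor C B A" "r \<cdot> x = idn C A" "r \<cdot> s = 0" "x \<cdot> r + s \<cdot> y = idn C B"
proof -
  note D = etriD[OF e]
  obtain r0 where r0: "r0 \<in> mor C B A" "r0 \<cdot> x = idn C A"
    using extend_along_inflation[OF e idn_mor push_zero[OF idn_mor]] .
  have sy: "s \<cdot> y \<in> mor C B B" using D s by (blast intro: cmp_mor)
  then have t: "idn C B - s \<cdot> y \<in> mor C B B" by (blast intro: diff_mor)
  have "y \<cdot> (idn C B - s \<cdot> y) = 0"
    using cmp_diff_right[OF D(3) idn_mor sy] cmp_assoc[OF D(3) s(1) D(3)] s(2) idn_left[OF D(3)] idn_right[OF D(3)] by simp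
  then obtain r where r: "r \<in> mor C B A" "idn C B - s \<cdot> y = x \<cdot> r" using weak_kernel[OF e t] by blast
  have rr: "r = r0 \<cdot> (idn C B - s \<cdot> y)"
    using r(2) cmp_assoc[OF r0(1) D(2) r(1)] r0(2) idn_left[OF r(1)] by simp
  have "(idn C B - s \<cdot> y) \<cdot> x = x"
    using cmp_diff_left[OF idn_mor sy D(2)] cmp_assoc[OF s(1) D(3,2)] cmp_etri[OF e] cmp_zero_right[OF s(1)] idn_left[OF D(2)] by simp
  then have "r \<cdot> x = idn C A" unfolding rr using cmp_assoc[OF r0(1) t D(2)] r0(2) by simp
  moreover have "(idn C B - s \<cdot> y) \<cdot> s = 0"
    using cmp_diff_left[OF idn_mor sy s(1)] cmp_assoc[OF s(1) D(3) s(1)] s(2) idn_right[OF s(1)] idn_left[OF s(1)] by simp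
  then have "r \<cdot> s = 0" unfolding rr using cmp_assoc[OF r0(1) t s(1)] cmp_zero_right[OF r0(1)] by simp
  moreover have "x \<cdot> r + s \<cdot> y = idn C B" using r(2) by (metis diff_add_cancel)
  ultimately show ?thesis using that r(1) by blast
qed

lemma etri_zero_direct_sum:
  assumes e: "etri C A B Z x y 0" shows "direct_sum C B [A, Z]"
proof -
  note D = etriD[OF e]
  obtain r where r: "r \<in> mor C B A" "r \<cdot> x = idn C A"
    using extend_along_inflation[OF e idn_mor push_zero[OF idn_mor]] .
  obtain s where "s \<in> mor C Z B" "y \<cdot> s = idn C Z" "r \<cdot> s = 0" "x \<cdot> r + s \<cdot> y = idn C B"
    using etri_zero_retraction[OF e r] .
  then show ?thesis using D r cmp_etri[OF e] by (intro direct_sum2I[of x A B s Z r y])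
qed

section \<open>Conflations without their classes: sums, pullbacks and pushouts\<close>

abbreviation confl :: "'o \<Rightarrow> 'o \<Rightarrow> 'o \<Rightarrow> bool" where
  "confl A B Z \<equiv> \<exists>x y. conflation C A B Z x y"

lemma conflI: "etri C A B Z x y \<delta> \<Longrightarrow> confl A B Z"
  unfolding conflation_def by blast

lemma conflE:
  assumes "confl A B Z" obtains x y \<delta> where "etri C A B Z x y \<delta>"
  using assms unfolding conflation_def by blast

lemma confl_split: "confl A B Z \<Longrightarrow> ext C Z A = {0} \<Longrightarrow> direct_sum C B [A, Z]"
  by (metis conflE etriD(1) etri_zero_direct_sum singletonD)

lemma confl_direct_sum: "direct_sum C B [A, Z] \<Longrightarrow> confl A B Z"
  by (erule direct_sum2E) (blast intro: conflI etri_split)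

lemma confl_sum:
  assumes "confl A B Z" "confl A' B' Z'"
    and "direct_sum C As [A, A']" "direct_sum C Bs [B, B']" "direct_sum C Zs [Z, Z']"
  shows "confl As Bs Zs"
proof -
  obtain x y \<delta> where e: "etri C A B Z x y \<delta>" using assms(1) by (rule conflE)
  obtain x' y' \<delta>' where e': "etri C A' B' Z' x' y' \<delta>'" using assms(2) by (rule conflE)
  obtain iA pA where A: "biproduct C As [A, A'] iA pA" using assms(3) unfolding direct_sum_def by blast
  obtain iB pB where B: "biproduct C Bs [B, B'] iB pB" using assms(4) unfolding direct_sum_def by blast
  obtain iZ pZ where Z: "biproduct C Zs [Z, Z'] iZ pZ" using assms(5) unfolding direct_sum_def by blast
  note A' = biproduct2D[OF A] and Z' = biproduct2D[OF Z]
  have "push C (iA 0) (pull C (pZ 0) \<delta>) + push C (iA 1) (pull C (pZ 1) \<delta>') \<in> ext C Zs As"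
    using A' Z' etriD(1)[OF e] etriD(1)[OF e'] by (intro add_ext push_ext[OF A'(1)] push_ext[OF A'(2)] pull_ext[OF Z'(3)] pull_ext[OF Z'(4)])
  then show ?thesis using realn_sum[OF e e' A B Z] conflI unfolding etri_def by blast
qed

text \<open>An object isomorphic to \<open>A\<close> is a direct sum of \<open>A\<close> and a zero
  object, so adding a zero conflation transports along all three isomorphisms at once.\<close>

lemma confl_iso:
  assumes "confl A B Z" "isomorphic C A A'" "isomorphic C B B'" "isomorphic C Z Z'"
  shows "confl A' B' Z'"
proof -
  obtain N where N: "zero_object C N" using ex_zero_object by blast
  show ?thesis
    by (rule confl_sum[OF assms(1) conflI[OF etri_idn_zero[OF N, of N]]])
      (use assms N direct_sum_zero_right in blast)+
qed

lemma confl_compose_deflations: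
  "confl D A B \<Longrightarrow> confl F B Z \<Longrightarrow> \<exists>E. confl E A Z \<and> confl D E F"
  by (metis conflE conflI ET4_op)

text \<open>\<open>M\<close> realises the pullback of \<open>\<delta>\<close> along
  \<open>y'\<close>. The cocone \<open>E\<close> of the composite from \<open>M\<close> to
  \<open>Z\<close> is an extension of \<open>A'\<close> by \<open>A\<close> whose class is pulled
  back along \<open>y' \<cdot> x' = 0\<close>, so it splits and \<open>A'\<close> embeds into
  \<open>M\<close>. The cone of this embedding realises \<open>push C r \<delta>''\<close>, hence is
  \<open>B\<close> once that class is \<open>\<delta>\<close>.\<close>

lemma confl_pullback:
  assumes "confl A B Z" "confl A' B' Z"
  shows "\<exists>M. confl A M B' \<and> confl A' M B"
proof -
  obtain x y \<delta> where e: "etri C A B Z x y \<delta>" using assms(1) by (rule conflE)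
  obtain x' y' \<delta>' where e': "etri C A' B' Z x' y' \<delta>'" using assms(2) by (rule conflE)
  note D = etriD[OF e] and D' = etriD[OF e']
  define \<epsilon> where "\<epsilon> = pull C y' \<delta>"
  have \<epsilon>: "\<epsilon> \<in> ext C B' A" unfolding \<epsilon>_def using D' D by (blast intro: pull_ext)
  obtain M m n where M: "etri C A M B' m n \<epsilon>" using \<epsilon> by (rule ex_etri)
  obtain E h d f \<delta>'' where E: "etri C E M Z h (y' \<cdot> n) \<delta>''" "d \<in> mor C A E" "f \<in> mor C E A'"
      "etri C A E A' d f (pull C x' \<epsilon>)" "push C f \<delta>'' = \<delta>'" "push C d \<epsilon> = pull C y' \<delta>''"
    using ET4_op[OF M e'] by blast
  note \<delta>'' = etriD(1)[OF E(1)]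
  have "pull C x' \<epsilon> = 0"
    unfolding \<epsilon>_def using pull_cmp[OF D'(3,2) D(1)] cmp_etri[OF e'] zero_pull[OF D(1)] by simp
  then have E0: "etri C A E A' d f 0" using E(4) by simp
  obtain r0 where r0: "r0 \<in> mor C E A" "r0 \<cdot> d = idn C A"
    using extend_along_inflation[OF E0 idn_mor push_zero[OF idn_mor]] .
  have r0\<delta>: "push C r0 \<delta>'' \<in> ext C Z A" using push_ext[OF r0(1) \<delta>''] .
  have "pull C y' (push C r0 \<delta>'') = \<epsilon>"
    using push_pull[OF r0(1) D'(3) \<delta>''] push_cmp[OF r0(1) E(2) \<epsilon>] E(6) r0(2) push_idn[OF \<epsilon>] by simp
  \<comment> \<open>The two classes agree only after pulling back to \<open>B'\<close>, so their
    difference comes from a map \<open>k\<close> on \<open>A'\<close>; subtracting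
    \<open>k \<cdot> f\<close> will remove it.\<close>
  then have "pull C y' (push C r0 \<delta>'' - \<delta>) = 0"
    using pull_diff_right[OF D'(3) r0\<delta> D(1)] \<epsilon>_def by simp
  then obtain k where k: "k \<in> mor C A' A" "push C r0 \<delta>'' - \<delta> = push C k \<delta>'"
    using ext_from_pull_zero[OF e' diff_ext[OF r0\<delta> D(1)]] by blast
  have kf: "k \<cdot> f \<in> mor C E A" using k E(3) by (blast intro: cmp_mor)
  \<comment> \<open>another retraction of \<open>d\<close>, corrected so that it pushes \<open>\<delta>''\<close> exactly to \<open>\<delta>\<close>\<close>
  define r where "r = r0 - k \<cdot> f"
  have r: "r \<in> mor C E A" unfolding r_def using r0 kf by (blast intro: diff_mor)
  have "push C r \<delta>'' = \<delta>"
    unfolding r_def using push_diff_left[OF r0(1) kf \<delta>''] push_cmp[OF k(1) E(3) \<delta>''] E(5) k(2)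
    by (metis diff_diff_eq2 add_diff_cancel_left')
  moreover have rd: "r \<cdot> d = idn C A"
    unfolding r_def using cmp_diff_left[OF r0(1) kf E(2)] cmp_assoc[OF k(1) E(3,2)] cmp_etri[OF E0] cmp_zero_right[OF k(1)] r0(2) by simp
  obtain s where s: "s \<in> mor C A' E" "f \<cdot> s = idn C A'" "r \<cdot> s = 0" "d \<cdot> r + s \<cdot> f = idn C E"
    using etri_zero_retraction[OF E0 r rd] .
  have "etri C A' E A s r 0"
    by (rule etri_split[of s A' E d A f r]) (use s r rd E cmp_etri[OF E0] in \<open>auto simp: add.commute\<close>)
  from ET4[OF this E(1)] obtain E3 h3 d3 f3 \<delta>3 where
    "etri C A' M E3 (h \<cdot> s) h3 \<delta>3" "etri C A E3 Z d3 f3 (push C r \<delta>'')" by blast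
  ultimately have "confl A' M E3" "isomorphic C E3 B" using conflI etri_equiv e by auto
  then have "confl A' M B" using confl_iso by blast
  then show ?thesis using conflI[OF M] by blast
qed

lemma confl_pushout:
  assumes "confl A B Z" "confl A B' Z'"
  shows "\<exists>M. confl B M Z' \<and> confl B' M Z"
proof -
  obtain x y \<delta> where e: "etri C A B Z x y \<delta>" using assms(1) by (rule conflE)
  obtain x' y' \<delta>' where e': "etri C A B' Z' x' y' \<delta>'" using assms(2) by (rule conflE)
  note D = etriD[OF e] and D' = etriD[OF e']
  define \<epsilon> where "\<epsilon> = push C x \<delta>'"
  have \<epsilon>: "\<epsilon> \<in> ext C Z' B" unfolding \<epsilon>_def using D' D by (blast intro: push_ext)
  obtain M m n where M: "etri C B M Z' m n \<epsilon>" using \<epsilon> by (rule ex_etri)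
  obtain E h d f \<delta>'' where E: "etri C A M E (m \<cdot> x) h \<delta>''" "d \<in> mor C Z E" "f \<in> mor C E Z'"
      "etri C Z E Z' d f (push C y \<epsilon>)" "pull C d \<delta>'' = \<delta>" "push C x \<delta>'' = pull C f \<epsilon>"
    using ET4[OF e M] by blast
  note \<delta>'' = etriD(1)[OF E(1)]
  have "push C y \<epsilon> = 0"
    unfolding \<epsilon>_def using push_cmp[OF D(3,2) D'(1)] cmp_etri[OF e] zero_push[OF D'(1)] by simp
  then have E0: "etri C Z E Z' d f 0" using E(4) by simp
  obtain s0 where s0: "s0 \<in> mor C Z' E" "f \<cdot> s0 = idn C Z'"
    using lift_along_deflation[OF E0 idn_mor pull_zero[OF idn_mor]] .
  have s0\<delta>: "pull C s0 \<delta>'' \<in> ext C Z' A" using pull_ext[OF s0(1) \<delta>''] .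
  have "push C x (pull C s0 \<delta>'') = \<epsilon>"
    using push_pull[OF D(2) s0(1) \<delta>''] pull_cmp[OF E(3) s0(1) \<epsilon>] E(6) s0(2) pull_idn[OF \<epsilon>] by simp
  then have "push C x (pull C s0 \<delta>'' - \<delta>') = 0"
    using push_diff_right[OF D(2) s0\<delta> D'(1)] \<epsilon>_def by simp
  then obtain k where k: "k \<in> mor C Z' Z" "pull C s0 \<delta>'' - \<delta>' = pull C k \<delta>"
    using ext_from_push_zero[OF e diff_ext[OF s0\<delta> D'(1)]] by blast
  \<comment> \<open>Dually to the pullback, \<open>d \<cdot> k\<close> corrects the section so that
    it pulls \<open>\<delta>''\<close> back to \<open>\<delta>'\<close> itself, which makes the
    final cocone a copy of \<open>B'\<close>.\<close>
  have dk: "d \<cdot> k \<in> mor C Z' E" using k E(2) by (blast intro: cmp_mor)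
  define s where "s = s0 - d \<cdot> k"
  have s: "s \<in> mor C Z' E" unfolding s_def using s0 dk by (blast intro: diff_mor)
  have "pull C s \<delta>'' = \<delta>'"
    unfolding s_def using pull_diff_left[OF s0(1) dk \<delta>''] pull_cmp[OF E(2) k(1) \<delta>''] E(5) k(2)
    by (metis diff_diff_eq2 add_diff_cancel_left')
  moreover have fs: "f \<cdot> s = idn C Z'"
    unfolding s_def using cmp_diff_right[OF E(3) s0(1) dk] cmp_assoc[OF E(3,2) k(1)] cmp_etri[OF E0] cmp_zero_left[OF k(1)] s0(2) by simp
  obtain r where r: "r \<in> mor C E Z" "r \<cdot> d = idn C Z" "r \<cdot> s = 0" "d \<cdot> r + s \<cdot> f = idn C E"
    using etri_zero_section[OF E0 s fs] .
  have "etri C Z' E Z s r 0"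
    by (rule etri_split[of s Z' E d Z f r]) (use s r fs E cmp_etri[OF E0] in \<open>auto simp: add.commute\<close>)
  from ET4_op[OF E(1) this] obtain E3 h3 d3 f3 \<delta>3 where
    "etri C E3 M Z h3 (r \<cdot> h) \<delta>3" "etri C A E3 Z' d3 f3 (pull C s \<delta>'')" by blast
  ultimately have "confl E3 M Z" "isomorphic C E3 B'" using conflI etri_equiv e' by auto
  then have "confl B' M Z" using confl_iso by blast
  then show ?thesis using conflI[OF M] by blast
qed

section \<open>Vanishing of extensions and direct sums\<close>

lemma ext_zero_summand_left:
  assumes "direct_sum C X [A, B]" "ext C X Y = {0}" shows "ext C A Y = {0}"
proof (rule ext_eq_zeroI)
  fix \<delta> assume \<delta>: "\<delta> \<in> ext C A Y"
  obtain i0 p0 where i: "i0 \<in> mor C A X" "p0 \<in> mor C X A" "p0 \<cdot> i0 = idn C A"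
    using assms(1) by (rule direct_sum2E)
  have "pull C p0 \<delta> = 0" using pull_ext[OF i(2) \<delta>] assms(2) by simp
  then show "\<delta> = 0" using pull_cmp[OF i(2,1) \<delta>] i(3) pull_idn[OF \<delta>] pull_zero[OF i(1)] by simp
qed

lemma ext_zero_summand_right:
  assumes "direct_sum C X [A, B]" "ext C Y X = {0}" shows "ext C Y A = {0}"
proof (rule ext_eq_zeroI)
  fix \<delta> assume \<delta>: "\<delta> \<in> ext C Y A"
  obtain i0 p0 where i: "i0 \<in> mor C A X" "p0 \<in> mor C X A" "p0 \<cdot> i0 = idn C A"
    using assms(1) by (rule direct_sum2E)
  have "push C i0 \<delta> = 0" using push_ext[OF i(1) \<delta>] assms(2) by simp
  then show "\<delta> = 0" using push_cmp[OF i(2,1) \<delta>] i(3) push_idn[OF \<delta>] push_zero[OF i(2)] by simp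
qed

lemma ext_zero_sum_left:
  assumes "direct_sum C X [A, B]" "ext C A Y = {0}" "ext C B Y = {0}" shows "ext C X Y = {0}"
proof (rule ext_eq_zeroI)
  fix \<delta> assume \<delta>: "\<delta> \<in> ext C X Y"
  obtain i0 i1 p0 p1 where S: "i0 \<in> mor C A X" "i1 \<in> mor C B X" "p0 \<in> mor C X A" "p1 \<in> mor C X B"
    "i0 \<cdot> p0 + i1 \<cdot> p1 = idn C X" using assms(1) by (rule direct_sum2E)
  have "\<delta> = pull C (i0 \<cdot> p0) \<delta> + pull C (i1 \<cdot> p1) \<delta>"
    using pull_add_left[OF cmp_mor[OF S(1,3)] cmp_mor[OF S(2,4)] \<delta>] S(5) pull_idn[OF \<delta>] by simp
  also have "pull C (i0 \<cdot> p0) \<delta> = 0"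
    using pull_cmp[OF S(1,3) \<delta>] pull_ext[OF S(1) \<delta>] assms(2) pull_zero[OF S(3)] by simp
  also have "pull C (i1 \<cdot> p1) \<delta> = 0"
    using pull_cmp[OF S(2,4) \<delta>] pull_ext[OF S(2) \<delta>] assms(3) pull_zero[OF S(4)] by simp
  finally show "\<delta> = 0" by simp
qed

lemma ext_zero_sum_right:
  assumes "direct_sum C X [A, B]" "ext C Y A = {0}" "ext C Y B = {0}" shows "ext C Y X = {0}"
proof (rule ext_eq_zeroI)
  fix \<delta> assume \<delta>: "\<delta> \<in> ext C Y X"
  obtain i0 i1 p0 p1 where S: "i0 \<in> mor C A X" "i1 \<in> mor C B X" "p0 \<in> mor C X A" "p1 \<in> mor C X B"
    "i0 \<cdot> p0 + i1 \<cdot> p1 = idn C X" using assms(1) by (rule direct_sum2E)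
  have "\<delta> = push C (i0 \<cdot> p0) \<delta> + push C (i1 \<cdot> p1) \<delta>"
    using push_add_left[OF cmp_mor[OF S(1,3)] cmp_mor[OF S(2,4)] \<delta>] S(5) push_idn[OF \<delta>] by simp
  also have "push C (i0 \<cdot> p0) \<delta> = 0"
    using push_cmp[OF S(1,3) \<delta>] push_ext[OF S(3) \<delta>] assms(2) push_zero[OF S(1)] by simp
  also have "push C (i1 \<cdot> p1) \<delta> = 0"
    using push_cmp[OF S(2,4) \<delta>] push_ext[OF S(4) \<delta>] assms(3) push_zero[OF S(2)] by simp
  finally show "\<delta> = 0" by simp
qed

end

section \<open>Resolutions and presilting objects\<close>

context vector_space
begin

text \<open>Both maps identify the quotient of \<open>M\<close> by the common preimage of \<open>K\<close> with a subspace
  of \<open>N / K\<close>; for \<open>\<psi>\<close> it is all of \<open>N / K\<close>, hence also for \<open>\<phi>\<close> by counting dimensions.\<close>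

lemma surjective_mod_subspace_transfer:
  assumes M: "subspace M" and K: "subspace K" "K \<subseteq> N" and N: "N = span B" "finite B"
    and \<phi>: "\<And>m. m \<in> M \<Longrightarrow> \<phi> m \<in> N" "\<And>m m'. m \<in> M \<Longrightarrow> m' \<in> M \<Longrightarrow> \<phi> (m + m') = \<phi> m + \<phi> m'"
      "\<And>c m. m \<in> M \<Longrightarrow> \<phi> (scale c m) = scale c (\<phi> m)"
    and \<psi>: "\<And>m m'. m \<in> M \<Longrightarrow> m' \<in> M \<Longrightarrow> \<psi> (m + m') = \<psi> m + \<psi> m'"
      "\<And>c m. m \<in> M \<Longrightarrow> \<psi> (scale c m) = scale c (\<psi> m)"
    and surj: "N \<subseteq> \<psi> ` M" and iff: "\<And>m. m \<in> M \<Longrightarrow> \<phi> m \<in> K \<longleftrightarrow> \<psi> m \<in> K"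
    and n: "n \<in> N"
  shows "\<exists>m\<in>M. \<exists>k\<in>K. n = \<phi> m + k"
proof -
  interpret P: vector_space_pair scale scale by unfold_locales
  have sN: "subspace N" using N by simp
  obtain BK where BK: "BK \<subseteq> K" "independent BK" "K \<subseteq> span BK" using maximal_independent_subset .
  obtain A where A: "BK \<subseteq> A" "A \<subseteq> N" "independent A" "N \<subseteq> span A"
    using maximal_independent_subset_extend[of BK N] BK K by blast
  have finA: "finite A" using independent_span_bound[OF N(2) A(3)] A(2) N(1) by blast
  have spA: "span A = N" using A(4) span_minimal[OF A(2) sN] by simp
  have spBK: "span BK = K" using BK(3) span_minimal[OF BK(1) K(1)] by simp
  let ?D = "A - BK"
  have "\<forall>d\<in>?D. \<exists>m. m \<in> M \<and> \<psi> m = d" using surj A(2) by fast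
  from bchoice[OF this] obtain \<mu> where "\<forall>d\<in>?D. \<mu> d \<in> M \<and> \<psi> (\<mu> d) = d" ..
  then have \<mu>: "\<And>d. d \<in> ?D \<Longrightarrow> \<mu> d \<in> M \<and> \<psi> (\<mu> d) = d" by blast
  obtain g where g: "Vector_Spaces.linear scale scale g" "\<And>d. d \<in> A \<Longrightarrow> g d = \<mu> d"
    using P.linear_independent_extend[OF A(3), of \<mu>] by blast
  \<comment> \<open>\<open>A - BK\<close> spans a complement of \<open>K\<close>. \<open>L\<close>
    is the identity on \<open>K\<close> and, on the complement, \<open>\<phi>\<close> after a
    section of \<open>\<psi>\<close>; its surjectivity is the claim, and in finite dimension
    injectivity is enough.\<close>
  obtain L where L: "Vector_Spaces.linear scale scale L" "\<And>d. d \<in> A \<Longrightarrow> L d = (if d \<in> BK then d else \<phi> (\<mu> d))"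
    using P.linear_independent_extend[OF A(3), of "\<lambda>d. if d \<in> BK then d else \<phi> (\<mu> d)"] by blast
  have \<phi>0: "\<phi> 0 = 0" using \<phi>(3)[of 0 0] M subspace_0 by simp
  have \<psi>0: "\<psi> 0 = 0" using \<psi>(2)[of 0 0] M subspace_0 by simp
  have D: "g y \<in> M \<and> \<psi> (g y) = y \<and> \<phi> (g y) = L y" if "y \<in> span ?D" for y
    using that
  proof (induction y rule: span_induct_alt)
    case base
    then show ?case using \<phi>0 \<psi>0 M subspace_0 P.linear_0[OF g(1)] P.linear_0[OF L(1)] by simp
  next
    case (step c x y)
    have x: "g x = \<mu> x" "L x = \<phi> (\<mu> x)" "\<mu> x \<in> M" "\<psi> (\<mu> x) = x" using g L \<mu> step by auto
    have s: "scale c (\<mu> x) \<in> M" using M x subspace_scale by blast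
    have gs: "g (scale c x + y) = scale c (\<mu> x) + g y"
      using P.linear_add[OF g(1)] P.linear_scale[OF g(1)] x by simp
    have Ls: "L (scale c x + y) = scale c (\<phi> (\<mu> x)) + L y"
      using P.linear_add[OF L(1)] P.linear_scale[OF L(1)] x by simp
    show ?case unfolding gs Ls
      using s x step \<phi>(2,3) \<psi>(1,2) subspace_add[OF M] by simp
  qed
  have LK: "L k = k" if "k \<in> K" for k
    using that unfolding spBK[symmetric]
  proof (induction k rule: span_induct_alt)
    case base
    then show ?case using P.linear_0[OF L(1)] by simp
  next
    case (step c x y)
    then show ?case using P.linear_add[OF L(1)] P.linear_scale[OF L(1)] L(2)[of x] A(1) by auto
  qed
  have dec: "\<exists>k y. k \<in> K \<and> y \<in> span ?D \<and> x = k + y" if "x \<in> N" for x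
  proof -
    have "x \<in> span (BK \<union> ?D)" using that spA A(1) by (simp add: Un_absorb1)
    then show ?thesis unfolding span_Un spBK by blast
  qed
  have int: "y = 0" if "y \<in> span ?D" "y \<in> K" for y
  proof -
    obtain Q where Q: "Vector_Spaces.linear scale scale Q" "\<And>d. d \<in> A \<Longrightarrow> Q d = (if d \<in> BK then d else 0)"
      using P.linear_independent_extend[OF A(3), of "\<lambda>d. if d \<in> BK then d else 0"] by blast
    have "Q y = 0" using P.linear_eq_0_on_span[OF Q(1) _ that(1)] Q(2) by auto
    moreover have "Q x = x" if "x \<in> BK" for x using that Q(2) A(1) by auto
    then have "Q y = y"
      using P.linear_eq_on_span[OF Q(1) linear_ident, of BK y] that(2) spBK by blast
    ultimately show ?thesis by simp
  qed
  \<comment> \<open>If \<open>k + \<phi> (g y) = 0\<close>, then \<open>\<phi> (g y)\<close> lies in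
    \<open>K\<close>; by \<open>iff\<close> so does \<open>\<psi> (g y) = y\<close>, but
    \<open>y\<close> lies in a complement of \<open>K\<close>.\<close>
  have inj: "inj_on L (span A)"
    unfolding P.linear_inj_on_iff_eq_0[OF L(1) subspace_span]
  proof (intro ballI impI)
    fix x assume x: "x \<in> span A" "L x = 0"
    then obtain k y where ky: "k \<in> K" "y \<in> span ?D" "x = k + y" using dec spA by blast
    then have "k + \<phi> (g y) = 0" using x LK D P.linear_add[OF L(1)] by simp
    then have "\<phi> (g y) = - k" by (simp add: eq_neg_iff_add_eq_0 add.commute)
    then have "\<psi> (g y) \<in> K" using iff D ky subspace_neg[OF K(1)] by metis
    then have "y = 0" using int D ky by simp
    then show "x = 0" using ky x LK by simp
  qed
  have ind: "independent (L ` A)" using P.linear_independent_injective_image[OF L(1) A(3) inj] .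
  have LA: "L ` A \<subseteq> span A"
    unfolding spA using L(2) A(2) \<mu> \<phi>(1) by auto
  have "N \<subseteq> span (L ` A)"
  proof (rule ccontr)
    assume "\<not> N \<subseteq> span (L ` A)"
    then obtain z where z: "z \<in> N" "z \<notin> span (L ` A)" by blast
    have "independent (insert z (L ` A))" using ind z by (simp add: independent_insert)
    then have "card (insert z (L ` A)) \<le> card A"
      using independent_span_bound[OF finA, of "insert z (L ` A)"] LA z spA by auto
    moreover have "card (L ` A) = card A" using inj by (meson card_image inj_on_subset span_superset)
    moreover have "z \<notin> L ` A" using z span_superset by blast
    ultimately show False using finA by simp
  qed
  then obtain x where "x \<in> N" "n = L x"
    using n P.linear_span_image[OF L(1), of A] spA by blast
  moreover obtain k y where "k \<in> K" "y \<in> span ?D" "x = k + y" using dec \<open>x \<in> N\<close> by blast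
  ultimately have "n = \<phi> (g y) + k" "g y \<in> M" "k \<in> K" using LK D P.linear_add[OF L(1)] by (auto simp: add.commute)
  then show ?thesis by blast
qed

end

locale krull_schmidt_extriangulated = extriangulated_category C + krull_schmidt_category C
  for C :: "('k::field, 'o, 'm::ab_group_add, 'e::ab_group_add, 'z) extricat_scheme" (structure)
begin

lemma confl_ks: "confl A B Z \<Longrightarrow> ext C Z A = {0} \<Longrightarrow> ks B = ks A + ks Z"
  using confl_split ks_direct_sum2 by blast

text \<open>The pullback over \<open>Z\<close> sits in two conflations, both split by the vanishing
  hypotheses, so its multiset is read off twice.\<close>

lemma schanuel:
  assumes "confl A B Z" "confl A' B' Z" "ext C B' A = {0}" "ext C B A' = {0}"
  shows "ks A + ks B' = ks A' + ks B"
  using confl_pullback[OF assms(1,2)] confl_ks assms(3,4) by metis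

lemma schanuel_dual:
  assumes "confl A B Z" "confl A B' Z'" "ext C Z' B = {0}" "ext C Z B' = {0}"
  shows "ks B + ks Z' = ks B' + ks Z"
  using confl_pushout[OF assms(1,2)] confl_ks assms(3,4) by metis

lemma ext_zero_ks_left: "ks A \<subseteq># ks X \<Longrightarrow> ext C X Y = {0} \<Longrightarrow> ext C A Y = {0}"
  by (metis ext_zero_summand_left summand_def summand_iff_ks)

lemma ext_zero_ks_right: "ks A \<subseteq># ks X \<Longrightarrow> ext C Y X = {0} \<Longrightarrow> ext C Y A = {0}"
  by (metis ext_zero_summand_right summand_def summand_iff_ks)

lemma ext_zero_ks_sum_left:
  "ks X = ks A + ks B \<Longrightarrow> ext C A Y = {0} \<Longrightarrow> ext C B Y = {0} \<Longrightarrow> ext C X Y = {0}"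
  by (meson direct_sum2_iff_ks ext_zero_sum_left)

lemma ext_zero_ks_sum_right:
  "ks X = ks A + ks B \<Longrightarrow> ext C Y A = {0} \<Longrightarrow> ext C Y B = {0} \<Longrightarrow> ext C Y X = {0}"
  by (meson direct_sum2_iff_ks ext_zero_sum_right)

lemma projective_ks_sub: "ks A \<subseteq># ks X \<Longrightarrow> projective C X \<Longrightarrow> projective C A"
  unfolding projective_def using ext_zero_ks_left by blast

lemma projective_ks_sum: "ks X = ks A + ks B \<Longrightarrow> projective C A \<Longrightarrow> projective C B \<Longrightarrow> projective C X"
  unfolding projective_def using ext_zero_ks_sum_left[of X A B] by simp

lemma zero_object_ext:
  assumes "zero_object C N" shows "ext C N Y = {0}" "ext C Y N = {0}"
proof -
  have N: "idn C N = 0" using assms zero_object_iff by simp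
  show "ext C N Y = {0}"
    by (rule ext_eq_zeroI) (metis N pull_idn zero_pull)
  show "ext C Y N = {0}"
    by (rule ext_eq_zeroI) (metis N push_idn zero_push)
qed

lemma ext_zero_add_of_left:
  assumes "set_mset (ks A) \<subseteq> set_mset (ks X)" "ext C X Y = {0}"
  shows "ext C A Y = {0}"
  using assms(1)
proof (induction "ks A" arbitrary: A)
  case empty
  then show ?case using zero_object_ext zero_object_iff_ks by simp
next
  case (add c M)
  obtain B R where B: "ks B = {#c#}" "direct_sum C A [B, R]"
    using mem_ks_split[of c A] ks_local add.hyps(2) by (metis union_single_eq_member)
  have A: "ks A = ks B + ks R" using ks_direct_sum2[OF B(2)] .
  have "ks B \<subseteq># ks X" using add.prems unfolding A B(1) by simp
  then have "ext C B Y = {0}" using assms(2) by (rule ext_zero_ks_left)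
  moreover have "ext C R Y = {0}" using add.hyps add.prems A B(1) by simp
  ultimately show ?case by (rule ext_zero_ks_sum_left[OF A])
qed

lemma ext_zero_add_of_right:
  assumes "set_mset (ks A) \<subseteq> set_mset (ks X)" "ext C Y X = {0}"
  shows "ext C Y A = {0}"
  using assms(1)
proof (induction "ks A" arbitrary: A)
  case empty
  then show ?case using zero_object_ext zero_object_iff_ks by simp
next
  case (add c M)
  obtain B R where B: "ks B = {#c#}" "direct_sum C A [B, R]"
    using mem_ks_split[of c A] ks_local add.hyps(2) by (metis union_single_eq_member)
  have A: "ks A = ks B + ks R" using ks_direct_sum2[OF B(2)] .
  have "ks B \<subseteq># ks X" using add.prems unfolding A B(1) by simp
  then have "ext C Y B = {0}" using assms(2) by (rule ext_zero_ks_right)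
  moreover have "ext C Y R = {0}" using add.hyps add.prems A B(1) by simp
  ultimately show ?case by (rule ext_zero_ks_sum_right[OF A])
qed

lemma presilting_add_of:
  assumes "presilting C X" "set_mset (ks A) \<subseteq> set_mset (ks X)" shows "presilting C A"
  using assms ext_zero_add_of_left[OF assms(2)] ext_zero_add_of_right[OF assms(2)]
  unfolding presilting_def by blast

lemma projective_of_ks_subset:
  assumes "projective C T" "set_mset (ks X) \<subseteq> set_mset (ks T)"
  shows "projective C X"
  using assms(1) ext_zero_add_of_left[OF assms(2)] unfolding projective_def by blast

lemma confl_idn_zero: "zero_object C N \<Longrightarrow> confl A A N" and confl_zero_idn: "zero_object C N \<Longrightarrow> confl N A A"
  using etri_idn_zero etri_zero_idn conflI by blast+

lemma confl_add_left:
  assumes "confl A B Z" "ks A' = ks A + ks X" "ks B' = ks B + ks X"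
  shows "confl A' B' Z"
proof -
  obtain N where N: "zero_object C N" using ex_zero_object by blast
  show ?thesis
    by (rule confl_sum[OF assms(1) confl_idn_zero[OF N, of X]])
      (use assms(2,3) ks_zero[OF N] direct_sum2_iff_ks in auto)
qed

lemma confl_add_right:
  assumes "confl A B Z" "ks B' = ks B + ks X" "ks Z' = ks Z + ks X"
  shows "confl A B' Z'"
proof -
  obtain N where N: "zero_object C N" using ex_zero_object by blast
  show ?thesis
    by (rule confl_sum[OF assms(1) confl_zero_idn[OF N, of X]])
      (use assms(2,3) ks_zero[OF N] direct_sum2_iff_ks in auto)
qed

section \<open>Objects with a two-term resolution by add(\<open>T\<close>) form a thick
  subcategory\<close>

definition resolved :: "'o \<Rightarrow> 'o set" where
  "resolved T = {X. \<exists>T1 T0. T1 \<in> add_of C T \<and> T0 \<in> add_of C T \<and> confl T1 T0 X}"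

lemma resolvedE:
  assumes "X \<in> resolved T"
  obtains T1 T0 where "set_mset (ks T1) \<subseteq> set_mset (ks T)" "set_mset (ks T0) \<subseteq> set_mset (ks T)" "confl T1 T0 X"
  using assms unfolding resolved_def add_of_iff_ks by blast

lemma resolvedI:
  "set_mset (ks T1) \<subseteq> set_mset (ks T) \<Longrightarrow> set_mset (ks T0) \<subseteq> set_mset (ks T) \<Longrightarrow> confl T1 T0 X \<Longrightarrow> X \<in> resolved T"
  unfolding resolved_def add_of_iff_ks by blast

context
  fixes T
  assumes T: "projective C T" and hered: "hereditary C"
begin

lemma add_T_ext: "set_mset (ks X) \<subseteq> set_mset (ks T) \<Longrightarrow> ext C X Y = {0}"
  using projective_of_ks_subset[OF T] unfolding projective_def by blast

text \<open>Horseshoe argument: the pullback of \<open>B\<close> to \<open>T0\<close> splits as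
  \<open>A\<close> plus \<open>T0\<close>, so it is covered by \<open>S0\<close> plus
  \<open>T0\<close>. The cocone of the composite deflation onto \<open>B\<close> is an extension of
  \<open>T1\<close> by \<open>S1\<close>, which splits as well.\<close>

lemma resolved_extension:
  assumes "confl A B Z" "A \<in> resolved T" "Z \<in> resolved T"
  shows "B \<in> resolved T"
proof -
  obtain T1 T0 where Z: "set_mset (ks T1) \<subseteq> set_mset (ks T)" "set_mset (ks T0) \<subseteq> set_mset (ks T)" "confl T1 T0 Z"
    using assms(3) by (rule resolvedE)
  obtain S1 S0 where A: "set_mset (ks S1) \<subseteq> set_mset (ks T)" "set_mset (ks S0) \<subseteq> set_mset (ks T)" "confl S1 S0 A"
    using assms(2) by (rule resolvedE)
  obtain M where M: "confl A M T0" "confl T1 M B" using confl_pullback[OF assms(1) Z(3)] by blast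
  have ksM: "ks M = ks A + ks T0" using confl_ks[OF M(1) add_T_ext[OF Z(2)]] .
  obtain S0' where S0': "ks S0' = ks S0 + ks T0" using ex_ks by blast
  have "confl S1 S0' M" using confl_add_right[OF A(3) S0' ksM] .
  then obtain E where E: "confl E S0' B" "confl S1 E T1" using confl_compose_deflations M(2) by blast
  have "ks E = ks S1 + ks T1" using confl_ks[OF E(2) add_T_ext[OF Z(1)]] .
  then show ?thesis using resolvedI[OF _ _ E(1)] S0' A Z by simp
qed

lemma add_T_resolved: "set_mset (ks X) \<subseteq> set_mset (ks T) \<Longrightarrow> X \<in> resolved T"
proof -
  assume X: "set_mset (ks X) \<subseteq> set_mset (ks T)"
  obtain N where N: "zero_object C N" using ex_zero_object by blast
  show "X \<in> resolved T"
    by (rule resolvedI[OF _ X confl_zero_idn[OF N]]) (simp add: ks_zero[OF N])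
qed

text \<open>\<open>hereditary C\<close> only provides one resolution of \<open>X\<close> by
  projectives; Schanuel's lemma carries projectivity over to the cocone of any other deflation from
  a projective.\<close>

lemma projective_syzygy:
  assumes "confl K P X" "projective C P" shows "projective C K"
proof -
  obtain P1 P0 where P: "projective C P1" "projective C P0" "confl P1 P0 X"
    using hered unfolding hereditary_def by blast
  have ks: "ks K + ks P0 = ks P1 + ks P"
    by (rule schanuel[OF assms(1) P(3)]) (use assms(2) P in \<open>auto simp: projective_def\<close>)
  obtain Q where Q: "ks Q = ks P1 + ks P" using ex_ks by blast
  then have "projective C Q" using projective_ks_sum[OF _ P(1) assms(2)] by simp
  moreover have "ks K \<subseteq># ks Q" unfolding Q ks[symmetric] by simp
  ultimately show ?thesis using projective_ks_sub by blast
qed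

lemma projective_resolved:
  assumes "projective C X" "X \<in> resolved T" shows "set_mset (ks X) \<subseteq> set_mset (ks T)"
proof -
  obtain T1 T0 where Z: "set_mset (ks T1) \<subseteq> set_mset (ks T)" "set_mset (ks T0) \<subseteq> set_mset (ks T)" "confl T1 T0 X"
    using assms(2) by (rule resolvedE)
  have "ks T0 = ks T1 + ks X" using confl_ks[OF Z(3)] assms(1) unfolding projective_def by blast
  then show ?thesis using Z(2) by simp
qed

text \<open>The cocone \<open>E\<close> of the deflation from \<open>T0\<close> onto
  \<open>Z\<close> is resolved, being an extension of \<open>A\<close> by \<open>T1\<close>, and
  projective, being a syzygy. A resolved projective lies in add(\<open>T\<close>), since its
  resolution splits.\<close>

lemma resolved_cone:
  assumes "confl A B Z" "A \<in> resolved T" "B \<in> resolved T"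
  shows "Z \<in> resolved T"
proof -
  obtain T1 T0 where B: "set_mset (ks T1) \<subseteq> set_mset (ks T)" "set_mset (ks T0) \<subseteq> set_mset (ks T)" "confl T1 T0 B"
    using assms(3) by (rule resolvedE)
  obtain E where E: "confl E T0 Z" "confl T1 E A" using confl_compose_deflations B(3) assms(1) by blast
  have "E \<in> resolved T" using resolved_extension[OF E(2) add_T_resolved[OF B(1)] assms(2)] .
  moreover have "projective C E" using projective_syzygy[OF E(1) projective_of_ks_subset[OF T B(2)]] .
  ultimately show ?thesis using resolvedI[OF projective_resolved B(2) E(1)] by blast
qed

text \<open>Composing deflations in two ways presents \<open>Y\<close> both by \<open>K\<close> and
  \<open>T0\<close> and by \<open>T1\<close> and \<open>K'\<close>, where \<open>K'\<close> is the
  cocone for the complement \<open>Z\<close>. Schanuel's lemma then exhibits \<open>K\<close> as a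
  summand of \<open>T1\<close> plus \<open>T0\<close>.\<close>

lemma resolved_summand:
  assumes "summand C Y X" "X \<in> resolved T"
  shows "Y \<in> resolved T"
proof -
  obtain Z where "direct_sum C X [Y, Z]" using assms(1) unfolding summand_def by blast
  then have YZ: "confl Z X Y" "confl Y X Z" using confl_direct_sum direct_sum2_commute by blast+
  obtain T1 T0 where X: "set_mset (ks T1) \<subseteq> set_mset (ks T)" "set_mset (ks T0) \<subseteq> set_mset (ks T)" "confl T1 T0 X"
    using assms(2) by (rule resolvedE)
  obtain K where K: "confl K T0 Y" "confl T1 K Z" using confl_compose_deflations X(3) YZ(1) by blast
  obtain K' where K': "confl K' T0 Z" "confl T1 K' Y" using confl_compose_deflations X(3) YZ(2) by blast
  have "projective C K'" using projective_syzygy[OF K'(1) projective_of_ks_subset[OF T X(2)]] .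
  then have "ks K + ks K' = ks T1 + ks T0"
    by (intro schanuel[OF K(1) K'(2)] add_T_ext[OF X(2)]) (simp add: projective_def)
  then have "set_mset (ks K) \<subseteq> set_mset (ks T)" using X by (metis Un_subset_iff set_mset_union)
  then show ?thesis using resolvedI[OF _ X(2) K(1)] by blast
qed

text \<open>The pullback to \<open>T0\<close> is at the same time \<open>A\<close> plus
  \<open>T0\<close> and an extension of \<open>B\<close> by \<open>T1\<close>.\<close>

lemma resolved_cocone:
  assumes "confl A B Z" "B \<in> resolved T" "Z \<in> resolved T"
  shows "A \<in> resolved T"
proof -
  obtain T1 T0 where Z: "set_mset (ks T1) \<subseteq> set_mset (ks T)" "set_mset (ks T0) \<subseteq> set_mset (ks T)" "confl T1 T0 Z"
    using assms(3) by (rule resolvedE)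
  obtain M where M: "confl A M T0" "confl T1 M B" using confl_pullback[OF assms(1) Z(3)] by blast
  have "ks M = ks A + ks T0" using confl_ks[OF M(1) add_T_ext[OF Z(2)]] .
  then have "summand C A M" unfolding summand_iff_ks by simp
  moreover have "M \<in> resolved T" using resolved_extension[OF M(2) add_T_resolved[OF Z(1)] assms(2)] .
  ultimately show ?thesis by (rule resolved_summand)
qed

lemma thick_resolved: "thick C (resolved T)"
proof -
  have "Y \<in> resolved T" if "X \<in> resolved T" "isomorphic C X Y" for X Y
    using that resolved_summand[of Y X] by (simp add: isomorphic_iff_ks summand_iff_ks)
  moreover have "confl A B Z" if "conflation C A B Z x y" for A B Z x y using that by blast
  ultimately show ?thesis
    unfolding thick_def
    by (intro conjI allI impI; elim conjE) (blast intro: resolved_summand resolved_extension resolved_cone resolved_cocone)+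
qed

text \<open>Silting only says that the thick closure of \<open>T\<close> is everything; a thick
  class containing \<open>T\<close> therefore contains every object.\<close>

lemma resolved_UNIV: "silting C T \<Longrightarrow> resolved T = UNIV"
  using hull_minimal[of "{T}" "resolved T" "thick C"] thick_resolved add_T_resolved[of T]
  unfolding silting_def by auto

end

text \<open>As \<open>P0\<close> is projective, \<open>ext C U V\<close> is
  \<open>mor C P1 V\<close> modulo the maps factoring through \<open>f\<close>, so all maps from
  \<open>P1\<close> to \<open>V\<close> have to factor. Vanishing of \<open>ext C V V\<close> gives
  this for \<open>g\<close>, and the series \<open>a\<close> carries it over to \<open>f\<close>
  modulo a space of maps already known to factor.\<close>

lemma ext_zero_of_same_terms:
  assumes U: "etri C P1 P0 U f y \<delta>" and V: "etri C P1 P0 V g y' \<delta>'"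
    and P0: "projective C P0" and fin: "hom_finite C"
    and UU: "ext C U U = {0}" and VV: "ext C V V = {0}"
  shows "ext C U V = {0}"
proof -
  note DU = etriD[OF U] and DV = etriD[OF V]
  have surj: "\<exists>m \<in> mor C P0 V. m \<cdot> g = n" if n: "n \<in> mor C P1 V" for n
  proof -
    have "push C n \<delta>' = 0" using push_ext[OF n DV(1)] VV by simp
    then show ?thesis using extend_along_inflation[OF V n] by blast
  qed
  \<comment> \<open>Infinitesimal triviality of deformations of \<open>f\<close>:
    \<open>y \<cdot> h\<close> extends along \<open>f\<close> since \<open>ext C U U\<close>
    vanishes, the extension lifts through \<open>y\<close> to \<open>b\<close>, and what remains of
    \<open>h\<close> factors through \<open>f\<close> on the other side.\<close>
  have dec: "\<exists>a b. a \<in> mor C P1 P1 \<and> b \<in> mor C P0 P0 \<and> h = b \<cdot> f + f \<cdot> a" if h: "h \<in> mor C P1 P0" for h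
  proof -
    have yh: "y \<cdot> h \<in> mor C P1 U" using DU h by (blast intro: cmp_mor)
    have "push C (y \<cdot> h) \<delta> = 0" using push_ext[OF yh DU(1)] UU by simp
    then obtain m where m: "m \<in> mor C P0 U" "m \<cdot> f = y \<cdot> h" using extend_along_inflation[OF U yh] by blast
    have "pull C m \<delta> = 0" using pull_ext[OF m(1) DU(1)] P0 unfolding projective_def by blast
    then obtain b where b: "b \<in> mor C P0 P0" "y \<cdot> b = m" using lift_along_deflation[OF U m(1)] by blast
    have bf: "b \<cdot> f \<in> mor C P1 P0" using b DU by (blast intro: cmp_mor)
    have "y \<cdot> (h - b \<cdot> f) = 0"
      using cmp_diff_right[OF DU(3) h bf] cmp_assoc[OF DU(3) b(1) DU(2)] b(2) m(2) by simp
    then obtain a where "a \<in> mor C P1 P1" "h - b \<cdot> f = f \<cdot> a"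
      using weak_kernel[OF U diff_mor[OF h bf]] by blast
    then show ?thesis using b(1) by (metis add.commute diff_add_cancel)
  qed
  \<comment> \<open>coefficients of a power series \<open>a(t)\<close> with \<open>a(0) = id\<close> and \<open>(f - t g) a(t) = b(t) f\<close> for some \<open>b(t)\<close>\<close>
  obtain a where a: "\<And>i. a i \<in> mor C P1 P1" "a 0 = idn C P1"
      "\<And>i. \<exists>b \<in> mor C P0 P0. g \<cdot> a i = b \<cdot> f + f \<cdot> a (Suc i)"
  proof -
    have "\<exists>a. \<forall>i. (a i \<in> mor C P1 P1 \<and> (i = 0 \<longrightarrow> a i = idn C P1)) \<and>
        (\<exists>b \<in> mor C P0 P0. g \<cdot> a i = b \<cdot> f + f \<cdot> a (Suc i))"
      by (rule dependent_nat_choice) (use dec cmp_mor[OF DV(2)] in blast)+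
    then show ?thesis using that by blast
  qed
  define I where "I = (\<lambda>m. m \<cdot> f) ` mor C P0 V"
  have I: "H.subspace I"
    unfolding H.subspace_def I_def image_def
    using cmp_zero_left[OF DU(2)] cmp_add_left[OF _ _ DU(2)] cmp_scale_left[OF _ DU(2)]
      H.subspace_scale[OF mor_subspace] add_mor[of _ P0 V] zero_mor
    by (auto; metis)
  \<comment> \<open>\<open>K\<close> consists of those \<open>n\<close> for which the whole series
    \<open>n a(t)\<close> has coefficients in \<open>I\<close>; since \<open>a 0\<close> is the
    identity, \<open>K\<close> lies in \<open>I\<close>.\<close>
  define K where "K = {n \<in> mor C P1 V. \<forall>i. n \<cdot> a i \<in> I}"
  have KI: "K \<subseteq> I"
  proof
    fix n assume "n \<in> K"
    then have "n \<in> mor C P1 V" "n \<cdot> a 0 \<in> I" unfolding K_def by auto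
    then show "n \<in> I" using a(2) idn_right by simp
  qed
  have K: "H.subspace K"
    unfolding H.subspace_def K_def
    using cmp_zero_left[OF a(1)] cmp_add_left[OF _ _ a(1)] cmp_scale_left[OF _ a(1)]
      H.subspace_scale[OF mor_subspace] H.subspace_scale[OF I] H.subspace_add[OF I] H.subspace_0[OF I]
    by (auto intro: add_mor)
  \<comment> \<open>Multiplying \<open>(f - t g) a(t) = b(t) f\<close> by \<open>m\<close> shows
    that \<open>m f a(t)\<close> and \<open>t m g a(t)\<close> agree modulo \<open>I\<close>. The
    factor \<open>t\<close> is the index shift in \<open>step\<close>, and the constant coefficient
    \<open>m \<cdot> f\<close> lies in \<open>I\<close> anyway.\<close>
  have iff: "m \<cdot> f \<in> K \<longleftrightarrow> m \<cdot> g \<in> K" if m: "m \<in> mor C P0 V" for m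
  proof -
    have mf: "m \<cdot> f \<in> mor C P1 V" and mg: "m \<cdot> g \<in> mor C P1 V" using m DU DV by (blast intro: cmp_mor)+
    have step: "(m \<cdot> g) \<cdot> a i \<in> I \<longleftrightarrow> (m \<cdot> f) \<cdot> a (Suc i) \<in> I" for i
    proof -
      obtain b where b: "b \<in> mor C P0 P0" "g \<cdot> a i = b \<cdot> f + f \<cdot> a (Suc i)" using a(3) by blast
      have bf: "b \<cdot> f \<in> mor C P1 P0" "f \<cdot> a (Suc i) \<in> mor C P1 P0" using b DU a(1) by (blast intro: cmp_mor)+
      have "(m \<cdot> g) \<cdot> a i = m \<cdot> (b \<cdot> f + f \<cdot> a (Suc i))" using cmp_assoc[OF m DV(2) a(1)] b(2) by simp
      also have "\<dots> = (m \<cdot> b) \<cdot> f + (m \<cdot> f) \<cdot> a (Suc i)"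
        using cmp_add_right[OF m bf] cmp_assoc[OF m b(1) DU(2)] cmp_assoc[OF m DU(2) a(1)] by simp
      finally have eq: "(m \<cdot> g) \<cdot> a i = (m \<cdot> b) \<cdot> f + (m \<cdot> f) \<cdot> a (Suc i)" .
      have "(m \<cdot> b) \<cdot> f \<in> I" unfolding I_def using cmp_mor[OF m b(1)] by blast
      then show ?thesis using eq H.subspace_add[OF I] H.subspace_diff[OF I] by (metis add_diff_cancel_left')
    qed
    have "(m \<cdot> f) \<cdot> a 0 \<in> I" using a(2) idn_right[OF mf] m unfolding I_def by auto
    then have "(\<forall>i. (m \<cdot> f) \<cdot> a i \<in> I) \<longleftrightarrow> (\<forall>i. (m \<cdot> f) \<cdot> a (Suc i) \<in> I)" by (metis not0_implies_Suc)
    then show ?thesis unfolding K_def using step mf mg by simp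
  qed
  have NI: "n \<in> I" if n: "n \<in> mor C P1 V" for n
  proof -
    obtain B where B: "mor C P1 V = H.span B" "finite B" using fin unfolding hom_finite_def by metis
    have KN: "K \<subseteq> mor C P1 V" unfolding K_def by blast
    have sg: "mor C P1 V \<subseteq> (\<lambda>m. m \<cdot> g) ` mor C P0 V"
    proof
      fix n assume "n \<in> mor C P1 V"
      then obtain m where "m \<in> mor C P0 V" "m \<cdot> g = n" using surj by blast
      then show "n \<in> (\<lambda>m. m \<cdot> g) ` mor C P0 V" by blast
    qed
    have "\<exists>m\<in>mor C P0 V. \<exists>k\<in>K. n = m \<cdot> f + k"
    proof (rule H.surjective_mod_subspace_transfer[where M = "mor C P0 V" and N = "mor C P1 V" and K = K and B = B
          and \<psi> = "\<lambda>m. m \<cdot> g"])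
      show "H.subspace (mor C P0 V)" by (rule mor_subspace)
      show "H.subspace K" by (rule K)
      show "K \<subseteq> mor C P1 V" by (rule KN)
      show "mor C P1 V = H.span B" "finite B" by (fact B)+
      show "m \<cdot> f \<in> mor C P1 V" if "m \<in> mor C P0 V" for m using that DU(2) by (rule cmp_mor)
      show "(m + m') \<cdot> f = m \<cdot> f + m' \<cdot> f" if "m \<in> mor C P0 V" "m' \<in> mor C P0 V" for m m'
        using that DU(2) by (rule cmp_add_left)
      show "(m + m') \<cdot> g = m \<cdot> g + m' \<cdot> g" if "m \<in> mor C P0 V" "m' \<in> mor C P0 V" for m m'
        using that DV(2) by (rule cmp_add_left)
      show "hscale C c m \<cdot> f = hscale C c (m \<cdot> f)" if "m \<in> mor C P0 V" for c m
        using that DU(2) by (rule cmp_scale_left)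
      show "hscale C c m \<cdot> g = hscale C c (m \<cdot> g)" if "m \<in> mor C P0 V" for c m
        using that DV(2) by (rule cmp_scale_left)
      show "mor C P1 V \<subseteq> (\<lambda>m. m \<cdot> g) ` mor C P0 V" by (rule sg)
      show "m \<cdot> f \<in> K \<longleftrightarrow> m \<cdot> g \<in> K" if "m \<in> mor C P0 V" for m using that by (rule iff)
      show "n \<in> mor C P1 V" by (rule n)
    qed
    then obtain m k where mk: "m \<in> mor C P0 V" "k \<in> K" "n = m \<cdot> f + k" by auto
    have "m \<cdot> f \<in> I" "k \<in> I" using mk KI unfolding I_def by auto
    then show ?thesis using H.subspace_add[OF I] mk(3) by simp
  qed
  show ?thesis
  proof (rule ext_eq_zeroI)
    fix \<epsilon> assume \<epsilon>: "\<epsilon> \<in> ext C U V"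
    have "pull C y \<epsilon> = 0" using pull_ext[OF DU(3) \<epsilon>] P0 unfolding projective_def by blast
    then obtain n where n: "n \<in> mor C P1 V" "\<epsilon> = push C n \<delta>" using ext_from_pull_zero[OF U \<epsilon>] by blast
    obtain m where m: "m \<in> mor C P0 V" "n = m \<cdot> f" using NI[OF n(1)] unfolding I_def by blast
    show "\<epsilon> = 0" using n(2) m(2) push_cmp[OF m(1) DU(2,1)] push_inflation[OF U] push_zero[OF m(1)] by simp
  qed
qed

text \<open>One class is killed at a time by extending \<open>A0\<close> by \<open>W\<close>; the
  new cone is an extension of \<open>W\<close> by \<open>A1\<close> and splits because
  \<open>ext C W A1\<close> vanishes. The clause over all \<open>Y\<close> records that
  \<open>A1\<close> is assembled from copies of \<open>W\<close>.\<close>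

lemma kill_extensions:
  assumes "finite D" "D \<subseteq> ext C W X" "ext C W W = {0}"
  shows "\<exists>A0 A1 x y \<delta>. etri C X A0 A1 x y \<delta> \<and> ext C W A1 = {0} \<and>
    (\<forall>Y. ext C W Y = {0} \<longrightarrow> ext C A1 Y = {0}) \<and> (\<forall>\<epsilon>\<in>D. push C x \<epsilon> = 0)"
  using assms(1,2)
proof (induction D rule: finite_induct)
  case empty
  obtain N where N: "zero_object C N" using ex_zero_object by blast
  show ?case
    by (intro exI[of _ X] exI[of _ N] exI[of _ "idn C X"] exI[of _ 0] conjI)
      (simp_all add: etri_idn_zero[OF N] zero_object_ext[OF N])
next
  case (insert \<epsilon> D)
  obtain A0 A1 x y \<delta> where A: "etri C X A0 A1 x y \<delta>" "ext C W A1 = {0}"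
      "\<And>Y. ext C W Y = {0} \<Longrightarrow> ext C A1 Y = {0}" "\<And>\<epsilon>. \<epsilon> \<in> D \<Longrightarrow> push C x \<epsilon> = 0"
    using insert.IH insert.prems by (metis (no_types, lifting) insert_subset)
  note DA = etriD[OF A(1)]
  have \<epsilon>: "\<epsilon> \<in> ext C W X" using insert.prems by simp
  obtain M m n where M: "etri C A0 M W m n (push C x \<epsilon>)" using push_ext[OF DA(2) \<epsilon>] by (rule ex_etri)
  note DM = etriD[OF M]
  obtain E h d e \<delta>'' where E: "etri C X M E (m \<cdot> x) h \<delta>''" "etri C A1 E W d e (push C y (push C x \<epsilon>))"
    using ET4[OF A(1) M] by blast
  have dE: "direct_sum C E [A1, W]" using confl_split[OF conflI[OF E(2)] A(2)] .
  have "push C (m \<cdot> x) \<epsilon>' = 0" if "\<epsilon>' \<in> insert \<epsilon> D" for \<epsilon>'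
  proof -
    have "\<epsilon>' \<in> ext C W X" using that insert.prems by blast
    then have "push C (m \<cdot> x) \<epsilon>' = push C m (push C x \<epsilon>')" using push_cmp[OF DM(2) DA(2)] by simp
    then show ?thesis using that A(4) push_inflation[OF M] push_zero[OF DM(2)] by auto
  qed
  moreover have "ext C W E = {0}" using ext_zero_sum_right[OF dE A(2) assms(3)] .
  moreover have "ext C E Y = {0}" if "ext C W Y = {0}" for Y using ext_zero_sum_left[OF dE A(3)[OF that] that] .
  ultimately show ?case
    by (intro exI[of _ M] exI[of _ E] exI[of _ "m \<cdot> x"] exI[of _ h] exI[of _ \<delta>''] conjI) (simp_all add: E(1))
qed

text \<open>Finitely many classes have to be killed: a projective resolution of \<open>W\<close>
  presents \<open>ext C W X\<close> as a quotient of \<open>mor C P1 X\<close>, which has a finite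
  spanning set.\<close>

lemma universal_extension:
  assumes fin: "hom_finite C" and hered: "hereditary C" and WW: "ext C W W = {0}"
  shows "\<exists>A0 A1. confl X A0 A1 \<and> ext C W A0 = {0} \<and> (\<forall>Y. ext C W Y = {0} \<longrightarrow> ext C A1 Y = {0})"
proof -
  obtain P1 P0 where P: "projective C P0" "confl P1 P0 W" using hered unfolding hereditary_def by blast
  obtain f z \<eta> where e: "etri C P1 P0 W f z \<eta>" using P(2) by (rule conflE)
  note D = etriD[OF e]
  obtain B where B: "H.span B = mor C P1 X" "finite B" using fin unfolding hom_finite_def by metis
  have Bm: "B \<subseteq> mor C P1 X" using B(1) H.span_superset by blast
  have "(\<lambda>h. push C h \<eta>) ` B \<subseteq> ext C W X" using Bm push_ext D(1) by blast
  from kill_extensions[OF finite_imageI[OF B(2)] this WW]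
  obtain A0 A1 x y \<delta> where A: "etri C X A0 A1 x y \<delta>" "ext C W A1 = {0}"
      "\<forall>Y. ext C W Y = {0} \<longrightarrow> ext C A1 Y = {0}" "\<forall>\<epsilon>\<in>(\<lambda>h. push C h \<eta>) ` B. push C x \<epsilon> = 0"
    by (elim exE conjE)
  note DA = etriD[OF A(1)]
  have kill: "push C x (push C h \<eta>) = 0" if "h \<in> mor C P1 X" for h
  proof -
    have "h \<in> mor C P1 X \<and> push C x (push C h \<eta>) = 0" if "h \<in> H.span B"
      using that
    proof (induction h rule: H.span_induct_alt)
      case base
      then show ?case using zero_push[OF D(1)] push_zero[OF DA(2)] by simp
    next
      case (step c h h')
      have h: "h \<in> mor C P1 X" "push C x (push C h \<eta>) = 0" using step Bm A(4) by auto
      have ch: "hscale C c h \<in> mor C P1 X" using H.subspace_scale[OF mor_subspace h(1)] .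
      have "push C x (push C (hscale C c h) \<eta>) = 0"
        using push_scale_left[OF h(1) D(1)] push_scale_right[OF DA(2) push_ext[OF h(1) D(1)]] h(2) by simp
      then show ?case
        using push_add_left[OF ch _ D(1)] push_add_right[OF DA(2) push_ext[OF ch D(1)] push_ext[OF _ D(1)]] step ch
        by (auto intro: add_mor)
    qed
    then show ?thesis using that B(1) by blast
  qed
  \<comment> \<open>A class in \<open>ext C W A0\<close> dies in \<open>ext C W A1 = {0}\<close>, so
    it comes from \<open>ext C W X\<close>, and all those classes are killed by
    \<open>x\<close>.\<close>
  have "ext C W A0 = {0}"
  proof (rule ext_eq_zeroI)
    fix \<epsilon> assume \<epsilon>: "\<epsilon> \<in> ext C W A0"
    have "push C y \<epsilon> = 0" using push_ext[OF DA(3) \<epsilon>] A(2) by simp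
    then obtain \<epsilon>' where \<epsilon>': "\<epsilon>' \<in> ext C W X" "\<epsilon> = push C x \<epsilon>'" using ext_exact_middle[OF A(1) \<epsilon>] by blast
    have "pull C z \<epsilon>' = 0" using pull_ext[OF D(3) \<epsilon>'(1)] P(1) unfolding projective_def by blast
    then obtain h where "h \<in> mor C P1 X" "\<epsilon>' = push C h \<eta>" using ext_from_pull_zero[OF e \<epsilon>'(1)] by blast
    then show "\<epsilon> = 0" using \<epsilon>'(2) kill by simp
  qed
  then show ?thesis
    by (intro exI[of _ A0] exI[of _ A1] conjI conflI[OF A(1)] A(3))
qed

text \<open>The dual of Schanuel's lemma cannot be applied to the two resolutions themselves: that
  would require \<open>P0\<close> to receive no extensions from \<open>U\<close> and
  \<open>V\<close>. After the pushouts the roles change: \<open>P0\<close> becomes the common first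
  term, the cone is \<open>A1\<close> in both cases, and the middle terms receive no extensions from
  it.\<close>

lemma presilting_ks_eq:
  assumes fin: "hom_finite C" and hered: "hereditary C"
    and pre: "presilting C U" "presilting C V"
    and U: "confl T1 T0 U" and V: "confl S1 S0 V" and proj: "projective C T0" "projective C S1"
    and eq: "ks T0 + ks S1 = ks S0 + ks T1"
  shows "ks U = ks V"
proof -
  \<comment> \<open>Equality of indices means that the resolutions acquire the same terms when
    \<open>S1\<close> is added to that of \<open>U\<close> and \<open>T1\<close> to that of
    \<open>V\<close>.\<close>
  obtain P1 where P1: "ks P1 = ks T1 + ks S1" using ex_ks by blast
  obtain P0 where P0: "ks P0 = ks T0 + ks S1" using ex_ks by blast
  have PU: "confl P1 P0 U" using confl_add_left[OF U P1 P0] .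
  have PV: "confl P1 P0 V" by (rule confl_add_left[OF V, of _ T1]) (use P1 P0 eq in \<open>auto simp: add.commute\<close>)
  have pP0: "projective C P0" using projective_ks_sum[OF P0 proj] .
  obtain f y \<delta> where u: "etri C P1 P0 U f y \<delta>" using PU by (rule conflE)
  obtain g y' \<delta>' where v: "etri C P1 P0 V g y' \<delta>'" using PV by (rule conflE)
  have UU: "ext C U U = {0}" and VV: "ext C V V = {0}" using pre unfolding presilting_def by auto
  have UV: "ext C U V = {0}" using ext_zero_of_same_terms[OF u v pP0 fin UU VV] .
  have VU: "ext C V U = {0}" using ext_zero_of_same_terms[OF v u pP0 fin VV UU] .
  obtain W where W: "ks W = ks U + ks V" using ex_ks by blast
  have WU: "ext C W U = {0}" and WV: "ext C W V = {0}" using ext_zero_ks_sum_left[OF W] UU UV VU VV by auto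
  have "ext C W W = {0}" using ext_zero_ks_sum_right[OF W WU WV] .
  from universal_extension[OF fin hered this, of P1]
  obtain A0 A1 where "confl P1 A0 A1 \<and> ext C W A0 = {0} \<and> (\<forall>Y. ext C W Y = {0} \<longrightarrow> ext C A1 Y = {0})"
    by (elim exE)
  then have A: "confl P1 A0 A1" "ext C W A0 = {0}" "\<And>Y. ext C W Y = {0} \<Longrightarrow> ext C A1 Y = {0}" by simp_all
  have UA: "ext C U A0 = {0}" "ext C V A0 = {0}" using ext_zero_ks_left[OF _ A(2)] W by auto
  obtain M where M: "confl P0 M A1" "confl A0 M U" using confl_pushout[OF PU A(1)] by blast
  obtain M' where M': "confl P0 M' A1" "confl A0 M' V" using confl_pushout[OF PV A(1)] by blast
  have ksM: "ks M = ks A0 + ks U" "ks M' = ks A0 + ks V" using confl_ks[OF M(2) UA(1)] confl_ks[OF M'(2) UA(2)] .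
  have "ext C W M = {0}" "ext C W M' = {0}"
    using ext_zero_ks_sum_right[OF ksM(1) A(2) WU] ext_zero_ks_sum_right[OF ksM(2) A(2) WV] .
  then have "ks M + ks A1 = ks M' + ks A1"
    by (rule schanuel_dual[OF M(1) M'(1) A(3) A(3)])
  then show ?thesis using ksM by simp
qed

end

section \<open>Fans from unique non-negative combinations\<close>

text \<open>Multiply a real solution by an integer that makes all its coefficients nearly integral and round:
  the left hand side becomes an integer of absolute value less than 1.\<close>

lemma real_relation_from_nat_relations:
  fixes z :: "'c \<Rightarrow> 'x \<Rightarrow> int" and a b :: "'c \<Rightarrow> real"
  assumes J: "finite J" and L: "\<And>x. (\<Sum>c\<in>J. \<bar>real_of_int (z c x)\<bar>) \<le> L"
    and a: "\<And>c. 0 \<le> a c" "\<And>c. c \<notin> \<sigma> \<Longrightarrow> a c = 0" and b: "\<And>c. 0 \<le> b c" "\<And>c. c \<notin> \<tau> \<Longrightarrow> b c = 0"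
    and \<sigma>\<tau>: "\<sigma> \<subseteq> J" "\<tau> \<subseteq> J"
    and eq: "\<And>x. (\<Sum>c\<in>J. a c * z c x) = (\<Sum>c\<in>J. b c * z c x)"
    and nat: "\<And>m n :: 'c \<Rightarrow> nat. \<lbrakk>\<And>c. c \<notin> \<sigma> \<Longrightarrow> m c = 0; \<And>c. c \<notin> \<tau> \<Longrightarrow> n c = 0;
      \<And>x. (\<Sum>c\<in>J. int (m c) * z c x) = (\<Sum>c\<in>J. int (n c) * z c x)\<rbrakk> \<Longrightarrow> m = n"
  shows "a = b"
proof (rule ccontr)
  assume "a \<noteq> b"
  then obtain c0 where c0: "a c0 \<noteq> b c0" by blast
  then have c0J: "c0 \<in> J" using a(2) b(2) \<sigma>\<tau> by (metis subsetD)
  define d where "d = \<bar>a c0 - b c0\<bar>"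
  have d: "0 < d" unfolding d_def using c0 by simp
  have L0: "0 \<le> L" using L[of undefined] by (meson abs_ge_zero order_trans sum_nonneg)
  \<comment> \<open>\<open>2 * L < N\<close> keeps the total rounding error below 1, and
    \<open>2 / d < N\<close> keeps \<open>a\<close> and \<open>b\<close> apart at \<open>c0\<close>.
    The bound \<open>L\<close> is uniform in \<open>x\<close> because the multiplier is chosen once
    for all coordinates.\<close>
  obtain N :: nat where N: "2 * L + 1 + 2 / d < real N" using reals_Archimedean2 by blast
  have d2: "0 < 2 / d" using d by simp
  have N0: "0 < N" using N L0 d2 by (cases N) auto
  have N1: "1 / real N \<le> 1" using N0 by simp
  have "2 * L < real N" using N d2 by linarith
  then have NL: "2 * L / real N < 1" using N0 by (simp add: divide_less_eq)
  have "2 / d < real N" using N L0 by linarith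
  then have Nd: "2 / real N < d" using d N0 by (simp add: divide_less_eq mult.commute)
  obtain e where e: "bij_betw e {0..<card J} J" using ex_bij_betw_nat_finite[OF J] by blast
  let ?k = "card J"
  define e' where "e' = the_inv_into {0..<?k} e"
  have e': "e' c < ?k" "e (e' c) = c" if "c \<in> J" for c
    using that e the_inv_into_into[of e "{0..<?k}" c "{0..<?k}"] f_the_inv_into_f[of e "{0..<?k}" c]
    unfolding e'_def bij_betw_def by auto
  \<comment> \<open>\<open>a\<close> and \<open>b\<close> are put into one family of
    \<open>2 * ?k\<close> reals so that they share the multiplier \<open>q\<close>.\<close>
  define \<theta> where "\<theta> i = (if i < ?k then a (e i) else b (e (i - ?k)))" for i
  obtain q p where q: "0 < q" and p: "\<And>i. i < 2 * ?k \<Longrightarrow> \<bar>of_int q * \<theta> i - of_int (p i)\<bar> < 1 / real N"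
    using Dirichlet_approx_simult[OF N0, of "2 * ?k" \<theta>] by blast
  define P where "P c = p (e' c)" for c
  define R where "R c = p (?k + e' c)" for c
  have P: "\<bar>of_int q * a c - of_int (P c)\<bar> < 1 / real N" if "c \<in> J" for c
    using p[of "e' c"] e'[OF that] unfolding P_def \<theta>_def by simp
  have R: "\<bar>of_int q * b c - of_int (R c)\<bar> < 1 / real N" if "c \<in> J" for c
    using p[of "?k + e' c"] e'[OF that] unfolding R_def \<theta>_def by simp
  \<comment> \<open>An error below 1 takes a non-negative real to a non-negative integer and 0 to 0,
    so the rounded functions stay supported on \<open>\<sigma>\<close> and
    \<open>\<tau>\<close>.\<close>
  have round: "0 \<le> i \<and> (r = 0 \<longrightarrow> i = 0)" if "\<bar>of_int q * r - of_int i\<bar> < 1 / real N" "0 \<le> r" for r :: real and i :: int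
  proof -
    have "\<bar>of_int q * r - of_int i\<bar> < 1" using that(1) N1 by linarith
    moreover have "0 \<le> of_int q * r" using q that(2) by simp
    ultimately have "- 1 < real_of_int i" "r = 0 \<longrightarrow> \<bar>real_of_int i\<bar> < 1" by auto
    then show ?thesis by auto
  qed
  define m where "m c = (if c \<in> J then nat (P c) else 0)" for c
  define n where "n c = (if c \<in> J then nat (R c) else 0)" for c
  have m: "int (m c) = P c" and n: "int (n c) = R c" if "c \<in> J" for c
    using round[OF P[OF that] a(1)] round[OF R[OF that] b(1)] that unfolding m_def n_def by auto
  have "m = n"
  proof (rule nat)
    show "m c = 0" if "c \<notin> \<sigma>" for c
      using round[OF P a(1), of c] a(2)[OF that] unfolding m_def by auto
    show "n c = 0" if "c \<notin> \<tau>" for c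
      using round[OF R b(1), of c] b(2)[OF that] unfolding n_def by auto
    show "(\<Sum>c\<in>J. int (m c) * z c x) = (\<Sum>c\<in>J. int (n c) * z c x)" for x
    proof -
      let ?s = "(\<Sum>c\<in>J. int (m c) * z c x) - (\<Sum>c\<in>J. int (n c) * z c x)"
      \<comment> \<open>The integral defect is rewritten as a combination of rounding errors plus a
        multiple of the real relation, and the latter vanishes by \<open>eq\<close>.\<close>
      have "real_of_int ?s = (\<Sum>c\<in>J. (of_int (P c) - of_int (R c)) * of_int (z c x))"
        by (simp add: sum_subtractf[symmetric] left_diff_distrib m n)
      also have "\<dots> = (\<Sum>c\<in>J. ((of_int q * b c - of_int (R c)) - (of_int q * a c - of_int (P c))) * of_int (z c x))
          + of_int q * ((\<Sum>c\<in>J. a c * z c x) - (\<Sum>c\<in>J. b c * z c x))"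
        by (simp add: sum_subtractf[symmetric] sum_distrib_left sum.distrib[symmetric] algebra_simps)
      finally have s: "real_of_int ?s = (\<Sum>c\<in>J. ((of_int q * b c - of_int (R c)) - (of_int q * a c - of_int (P c))) * of_int (z c x))"
        using eq[of x] by simp
      have "\<bar>real_of_int ?s\<bar> \<le> (\<Sum>c\<in>J. (2 / real N) * \<bar>real_of_int (z c x)\<bar>)"
        unfolding s
      proof (rule order_trans[OF sum_abs sum_mono])
        fix c assume c: "c \<in> J"
        have "\<bar>(of_int q * b c - of_int (R c)) - (of_int q * a c - of_int (P c))\<bar> \<le> 2 / real N"
          using P[OF c] R[OF c] by linarith
        then show "\<bar>((of_int q * b c - of_int (R c)) - (of_int q * a c - of_int (P c))) * of_int (z c x)\<bar>
            \<le> (2 / real N) * \<bar>real_of_int (z c x)\<bar>"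
          unfolding abs_mult by (rule mult_right_mono) simp
      qed
      also have "\<dots> = (2 / real N) * (\<Sum>c\<in>J. \<bar>real_of_int (z c x)\<bar>)" by (rule sum_distrib_left[symmetric])
      also have "\<dots> \<le> (2 / real N) * L" by (rule mult_left_mono[OF L]) simp
      also have "\<dots> < 1" using NL by simp
      finally show ?thesis by linarith
    qed
  qed
  then have "P c0 = R c0" using m[OF c0J] n[OF c0J] by simp
  then have "\<bar>of_int q * a c0 - of_int q * b c0\<bar> < 2 / real N" using P[OF c0J] R[OF c0J] by linarith
  moreover have "\<bar>of_int q * a c0 - of_int q * b c0\<bar> = of_int q * d"
    unfolding d_def using q by (simp add: abs_mult right_diff_distrib[symmetric])
  moreover have "d \<le> of_int q * d" using q d by simp
  ultimately show False using Nd by linarith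
qed

text \<open>Coefficients live on the whole type and vanish outside \<open>\<sigma>\<close>, so that
  combinations over different sets can be compared as functions.\<close>

lemma convex_cone_hull_image:
  fixes G :: "'c \<Rightarrow> 'v::real_vector"
  assumes "finite \<sigma>"
  shows "convex_cone hull (G ` \<sigma>) = {\<Sum>c\<in>\<sigma>. a c *\<^sub>R G c | a. (\<forall>c. 0 \<le> a c) \<and> (\<forall>c. c \<notin> \<sigma> \<longrightarrow> a c = (0::real))}"
    (is "_ = ?S")
proof
  have "convex_cone ?S"
    unfolding convex_cone_iff
  proof (intro conjI ballI allI impI)
    show "0 \<in> ?S" by (rule CollectI, rule exI[of _ "\<lambda>_. 0"]) simp
  next
    fix x y assume "x \<in> ?S" "y \<in> ?S"
    then obtain a b where "x = (\<Sum>c\<in>\<sigma>. a c *\<^sub>R G c)" "\<forall>c. 0 \<le> a c" "\<forall>c. c \<notin> \<sigma> \<longrightarrow> a c = 0"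
      "y = (\<Sum>c\<in>\<sigma>. b c *\<^sub>R G c)" "\<forall>c. 0 \<le> b c" "\<forall>c. c \<notin> \<sigma> \<longrightarrow> b c = 0" by blast
    then show "x + y \<in> ?S"
      by (intro CollectI exI[of _ "\<lambda>c. a c + b c"]) (simp add: sum.distrib scaleR_add_left)
  next
    fix x and t :: real assume "x \<in> ?S" "0 \<le> t"
    then obtain a where "x = (\<Sum>c\<in>\<sigma>. a c *\<^sub>R G c)" "\<forall>c. 0 \<le> a c" "\<forall>c. c \<notin> \<sigma> \<longrightarrow> a c = 0" by blast
    then show "t *\<^sub>R x \<in> ?S" using \<open>0 \<le> t\<close>
      by (intro CollectI exI[of _ "\<lambda>c. t * a c"]) (simp add: scaleR_sum_right)
  qed
  moreover have "G ` \<sigma> \<subseteq> ?S"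
  proof
    fix x assume "x \<in> G ` \<sigma>"
    then obtain d where d: "d \<in> \<sigma>" "x = G d" by blast
    have "(\<Sum>c\<in>\<sigma>. (if c = d then 1 else 0) *\<^sub>R G c) = (\<Sum>c\<in>\<sigma>. if c = d then G c else 0)"
      by (rule sum.cong) auto
    then have "x = (\<Sum>c\<in>\<sigma>. (if c = d then 1 else 0) *\<^sub>R G c)" using d assms by simp
    then show "x \<in> ?S" using d by (intro CollectI exI[of _ "\<lambda>c. if c = d then 1 else 0"]) auto
  qed
  ultimately show "convex_cone hull (G ` \<sigma>) \<subseteq> ?S" by (simp add: hull_minimal)
  show "?S \<subseteq> convex_cone hull (G ` \<sigma>)"
  proof
    fix x assume "x \<in> ?S"
    then obtain a where a: "x = (\<Sum>c\<in>\<sigma>. a c *\<^sub>R G c)" "\<forall>c. 0 \<le> a c" by blast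
    have "(\<Sum>c\<in>\<rho>. a c *\<^sub>R G c) \<in> convex_cone hull (G ` \<sigma>)" if "\<rho> \<subseteq> \<sigma>" for \<rho>
      using finite_subset[OF that assms] that
    proof (induction \<rho> rule: finite_induct)
      case (insert c \<rho>)
      have "G c \<in> convex_cone hull (G ` \<sigma>)" using insert.prems by (simp add: hull_inc)
      then have "a c *\<^sub>R G c \<in> convex_cone hull (G ` \<sigma>)" using a(2) by (simp add: convex_cone_hull_mul)
      then show ?case using insert by (simp add: convex_cone_hull_add)
    qed (simp add: convex_cone_hull_contains_0)
    then show "x \<in> convex_cone hull (G ` \<sigma>)" using a(1) by blast
  qed
qed

text \<open>Points are forced into \<open>F\<close> by placing a known point of \<open>F\<close>
  inside an open segment of \<open>S\<close>: \<open>x0\<close> is the midpoint of 0 and its double,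
  \<open>x\<close> lies between 0 and \<open>t *\<^sub>R x\<close> for \<open>t > 1\<close>, and
  \<open>x + y\<close> is the midpoint of the doubles of \<open>x\<close> and
  \<open>y\<close>.\<close>

lemma face_of_convex_cone:
  assumes S: "convex_cone S" and F: "F face_of S" "F \<noteq> {}"
  shows "convex_cone F" "\<And>x y. x \<in> S \<Longrightarrow> y \<in> S \<Longrightarrow> x + y \<in> F \<Longrightarrow> x \<in> F"
proof -
  have FS: "F \<subseteq> S" and cF: "convex F" using F(1) unfolding face_of_def by auto
  have ext: "p \<in> F \<and> r \<in> F" if "p \<in> S" "r \<in> S" "p \<noteq> r" "0 < u" "u < 1" "(1 - u) *\<^sub>R p + u *\<^sub>R r \<in> F" for p r u
    using F(1) that unfolding face_of_def in_segment by blast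
  have mulS: "t *\<^sub>R x \<in> S" if "x \<in> S" "0 \<le> t" for x t using S that by (simp add: convex_cone_scaleR)
  have zS: "0 \<in> S" using S by (rule convex_cone_contains_0)
  obtain x0 where x0: "x0 \<in> F" using F(2) by blast
  have zF: "0 \<in> F"
  proof (cases "x0 = 0")
    case False
    then show ?thesis using ext[of 0 "2 *\<^sub>R x0" "1 / 2"] zS mulS[of x0 2] x0 FS by auto
  qed (use x0 in simp)
  have mul: "t *\<^sub>R x \<in> F" if x: "x \<in> F" and t: "0 \<le> t" for x t
  proof (cases "t \<le> 1")
    case True
    then show ?thesis using convexD[OF cF zF x, of "1 - t" t] t by simp
  next
    case False
    show ?thesis
    proof (cases "x = 0")
      case False
      then show ?thesis
        using ext[of 0 "t *\<^sub>R x" "1 / t"] zS mulS[of x t] x FS t \<open>\<not> t \<le> 1\<close> by auto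
    qed (use zF in simp)
  qed
  have add: "x + y \<in> F" if "x \<in> F" "y \<in> F" for x y
  proof -
    have "(1 / 2) *\<^sub>R x + (1 / 2) *\<^sub>R y \<in> F" using convexD[OF cF that, of "1 / 2" "1 / 2"] by simp
    from mul[OF this, of 2] show ?thesis by (simp add: scaleR_add_right)
  qed
  show "convex_cone F" unfolding convex_cone_iff using zF add mul by blast
  show "x \<in> F" if "x \<in> S" "y \<in> S" "x + y \<in> F" for x y
  proof -
    have "2 *\<^sub>R x \<in> F"
    proof (cases "x = y")
      case True
      then show ?thesis using that(3) by (simp add: scaleR_2)
    next
      case False
      then show ?thesis
        using ext[of "2 *\<^sub>R x" "2 *\<^sub>R y" "1 / 2"] mulS that by simp
    qed
    then show ?thesis using mul[of "2 *\<^sub>R x" "1 / 2"] by simp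
  qed
qed

text \<open>An abstract simplicial complex with a vector at each vertex. Stating \<open>uniq\<close>
  for pairs makes it serve several ends: equal simplices give independence and strong convexity,
  nested ones the face property, arbitrary ones the intersections.\<close>

locale unique_nonneg_combinations =
  fixes \<Delta> :: "'c set set" and G :: "'c \<Rightarrow> 'v::real_vector"
  assumes fin: "\<sigma> \<in> \<Delta> \<Longrightarrow> finite \<sigma>"
    and sub: "\<sigma> \<in> \<Delta> \<Longrightarrow> \<rho> \<subseteq> \<sigma> \<Longrightarrow> \<rho> \<in> \<Delta>"
    and uniq: "\<lbrakk>\<sigma> \<in> \<Delta>; \<tau> \<in> \<Delta>; \<And>c. 0 \<le> a c; \<And>c. c \<notin> \<sigma> \<Longrightarrow> a c = 0; \<And>c. 0 \<le> b c; \<And>c. c \<notin> \<tau> \<Longrightarrow> b c = (0::real);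
      (\<Sum>c\<in>\<sigma>. a c *\<^sub>R G c) = (\<Sum>c\<in>\<tau>. b c *\<^sub>R G c)\<rbrakk> \<Longrightarrow> a = b"
begin

abbreviation cone_on :: "'c set \<Rightarrow> 'v set" where
  "cone_on \<sigma> \<equiv> convex_cone hull (G ` \<sigma>)"

lemma cone_onE:
  assumes "x \<in> cone_on \<sigma>" "\<sigma> \<in> \<Delta>"
  obtains a where "x = (\<Sum>c\<in>\<sigma>. a c *\<^sub>R G c)" "\<And>c. (0::real) \<le> a c" "\<And>c. c \<notin> \<sigma> \<Longrightarrow> a c = 0"
  using assms(1) unfolding convex_cone_hull_image[OF fin[OF assms(2)]] by blast

lemma sum_in_cone_on:
  assumes "\<sigma> \<in> \<Delta>" "\<rho> \<subseteq> \<sigma>" "\<And>c. (0::real) \<le> a c" "\<And>c. c \<notin> \<rho> \<Longrightarrow> a c = 0"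
  shows "(\<Sum>c\<in>\<sigma>. a c *\<^sub>R G c) \<in> cone_on \<rho>"
proof -
  have "(\<Sum>c\<in>\<sigma>. a c *\<^sub>R G c) = (\<Sum>c\<in>\<rho>. a c *\<^sub>R G c)"
    by (rule sum.mono_neutral_right[OF fin[OF assms(1)] assms(2)]) (use assms(4) in auto)
  then show ?thesis unfolding convex_cone_hull_image[OF fin[OF sub[OF assms(1,2)]]] using assms(3,4) by blast
qed

lemma cone_on_Int:
  assumes "\<sigma> \<in> \<Delta>" "\<tau> \<in> \<Delta>" shows "cone_on \<sigma> \<inter> cone_on \<tau> = cone_on (\<sigma> \<inter> \<tau>)"
proof
  show "cone_on (\<sigma> \<inter> \<tau>) \<subseteq> cone_on \<sigma> \<inter> cone_on \<tau>" by (simp add: hull_mono image_mono)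
  show "cone_on \<sigma> \<inter> cone_on \<tau> \<subseteq> cone_on (\<sigma> \<inter> \<tau>)"
  proof
    fix x assume x: "x \<in> cone_on \<sigma> \<inter> cone_on \<tau>"
    obtain a where a: "x = (\<Sum>c\<in>\<sigma>. a c *\<^sub>R G c)" "\<And>c. (0::real) \<le> a c" "\<And>c. c \<notin> \<sigma> \<Longrightarrow> a c = 0"
      using x assms(1) cone_onE by blast
    obtain b where b: "x = (\<Sum>c\<in>\<tau>. b c *\<^sub>R G c)" "\<And>c. (0::real) \<le> b c" "\<And>c. c \<notin> \<tau> \<Longrightarrow> b c = 0"
      using x assms(2) cone_onE by blast
    have "a = b" by (rule uniq[OF assms a(2,3) b(2,3)]) (use a b in auto)
    then show "x \<in> cone_on (\<sigma> \<inter> \<tau>)"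
      unfolding a(1) using a b by (intro sum_in_cone_on[OF assms(1)]) auto
  qed
qed

text \<open>By \<open>uniq\<close>, the coefficients of a point of an open segment are the mixture
  of those of the endpoints. Outside \<open>\<rho>\<close> the mixture is 0, and as all terms are
  non-negative, both endpoint coefficients are 0 there.\<close>

lemma cone_face_cone_on:
  assumes \<sigma>: "\<sigma> \<in> \<Delta>" and \<rho>: "\<rho> \<subseteq> \<sigma>" shows "cone_face (cone_on \<rho>) (cone_on \<sigma>)"
proof -
  note \<rho>\<Delta> = sub[OF \<sigma> \<rho>]
  have "p \<in> cone_on \<rho> \<and> r \<in> cone_on \<rho>"
    if p: "p \<in> cone_on \<sigma>" and r: "r \<in> cone_on \<sigma>" and x: "x \<in> cone_on \<rho>" "x \<in> open_segment p r" for p r x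
  proof -
    obtain a where a: "p = (\<Sum>c\<in>\<sigma>. a c *\<^sub>R G c)" "\<And>c. (0::real) \<le> a c" "\<And>c. c \<notin> \<sigma> \<Longrightarrow> a c = 0"
      using p \<sigma> cone_onE by blast
    obtain b where b: "r = (\<Sum>c\<in>\<sigma>. b c *\<^sub>R G c)" "\<And>c. (0::real) \<le> b c" "\<And>c. c \<notin> \<sigma> \<Longrightarrow> b c = 0"
      using r \<sigma> cone_onE by blast
    obtain d where d: "x = (\<Sum>c\<in>\<rho>. d c *\<^sub>R G c)" "\<And>c. (0::real) \<le> d c" "\<And>c. c \<notin> \<rho> \<Longrightarrow> d c = 0"
      using x(1) \<rho>\<Delta> cone_onE by blast
    obtain u where u: "0 < u" "u < 1" "x = (1 - u) *\<^sub>R p + u *\<^sub>R r" using x(2) unfolding in_segment by blast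
    have "x = (\<Sum>c\<in>\<sigma>. ((1 - u) * a c + u * b c) *\<^sub>R G c)"
      unfolding u(3) a(1) b(1) by (simp add: scaleR_sum_right sum.distrib scaleR_add_left)
    then have "(\<lambda>c. (1 - u) * a c + u * b c) = d"
      using a b d u by (intro uniq[OF \<sigma> \<rho>\<Delta>]) auto
    then have "(1 - u) * a c + u * b c = 0" if "c \<notin> \<rho>" for c using d(3)[OF that] by metis
    moreover have "0 \<le> (1 - u) * a c" "0 \<le> u * b c" for c using u a(2) b(2) by simp_all
    ultimately have "(1 - u) * a c = 0" "u * b c = 0" if "c \<notin> \<rho>" for c
      using that by (metis add_nonneg_eq_0_iff)+
    then have "a c = 0" "b c = 0" if "c \<notin> \<rho>" for c using that u by auto
    then show ?thesis unfolding a(1) b(1) using sum_in_cone_on[OF \<sigma> \<rho>] a(2) b(2) by blast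
  qed
  then show ?thesis
    unfolding cone_face_def face_of_def
    using hull_mono[OF image_mono[OF \<rho>]] convex_convex_cone_hull convex_cone_hull_nonempty by metis
qed

text \<open>A face is spanned by the rays it contains: separating one term of a combination from the
  rest puts every ray with a positive coefficient into \<open>F\<close>.\<close>

lemma cone_face_cone_onE:
  assumes \<sigma>: "\<sigma> \<in> \<Delta>" and F: "cone_face F (cone_on \<sigma>)"
  obtains \<rho> where "\<rho> \<subseteq> \<sigma>" "F = cone_on \<rho>"
proof -
  have F': "F face_of cone_on \<sigma>" "F \<noteq> {}" using F unfolding cone_face_def by auto
  note FC = face_of_convex_cone[OF convex_cone_convex_cone_hull F']
  let ?\<rho> = "{c \<in> \<sigma>. G c \<in> F}"
  have "cone_on ?\<rho> \<subseteq> F" by (rule hull_minimal) (use FC(1) in auto)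
  moreover have "F \<subseteq> cone_on ?\<rho>"
  proof
    fix x assume x: "x \<in> F"
    then have "x \<in> cone_on \<sigma>" using F'(1) unfolding face_of_def by blast
    then obtain a where a: "x = (\<Sum>c\<in>\<sigma>. a c *\<^sub>R G c)" "\<And>c. (0::real) \<le> a c" "\<And>c. c \<notin> \<sigma> \<Longrightarrow> a c = 0"
      using \<sigma> cone_onE by blast
    have "a c = 0" if "c \<notin> ?\<rho>" for c
    proof (rule ccontr)
      assume ac: "a c \<noteq> 0"
      then have c: "c \<in> \<sigma>" using a(3) by blast
      have "x = a c *\<^sub>R G c + (\<Sum>c\<in>\<sigma> - {c}. a c *\<^sub>R G c)"
        unfolding a(1) by (rule sum.remove[OF fin[OF \<sigma>] c])
      moreover have "a c *\<^sub>R G c \<in> cone_on \<sigma>" using c a(2) by (simp add: convex_cone_hull_mul hull_inc)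
      moreover have "(\<Sum>c\<in>\<sigma> - {c}. a c *\<^sub>R G c) \<in> cone_on \<sigma>"
      proof -
        have "(\<Sum>d\<in>\<sigma> - {c}. a d *\<^sub>R G d) = (\<Sum>d\<in>\<sigma>. (if d = c then 0 else a d) *\<^sub>R G d)"
          by (rule sum.mono_neutral_cong_left) (use fin[OF \<sigma>] in auto)
        also have "\<dots> \<in> cone_on \<sigma>" by (rule sum_in_cone_on[OF \<sigma> order_refl]) (use a in auto)
        finally show ?thesis .
      qed
      ultimately have "a c *\<^sub>R G c \<in> F" using FC(2) x by blast
      from convex_cone_scaleR[OF FC(1) _ this, of "1 / a c"] have "G c \<in> F" using a(2)[of c] ac by simp
      then show False using that c by simp
    qed
    then show "x \<in> cone_on ?\<rho>" unfolding a(1) using a(2) by (intro sum_in_cone_on[OF \<sigma>]) auto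
  qed
  ultimately show ?thesis using that[of ?\<rho>] by blast
qed

lemma inj_on_rays: assumes "\<sigma> \<in> \<Delta>" shows "inj_on G \<sigma>"
proof (rule inj_onI)
  fix c d assume cd: "c \<in> \<sigma>" "d \<in> \<sigma>" "G c = G d"
  have s: "(\<Sum>x\<in>\<sigma>. (if x = e then 1 else 0) *\<^sub>R G x) = G e" if "e \<in> \<sigma>" for e
  proof -
    have "(\<Sum>x\<in>\<sigma>. (if x = e then 1 else 0) *\<^sub>R G x) = (\<Sum>x\<in>\<sigma>. if x = e then G x else 0)"
      by (rule sum.cong) auto
    then show ?thesis using that fin[OF assms] by simp
  qed
  have "(\<lambda>x. if x = c then 1 else 0) = (\<lambda>x. if x = d then 1 else (0::real))"
    by (rule uniq[OF assms assms]) (use cd s[OF cd(1)] s[OF cd(2)] in auto)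
  then show "c = d" by (metis zero_neq_one)
qed

lemma independent_rays: assumes "\<sigma> \<in> \<Delta>" shows "independent (G ` \<sigma>)"
proof
  assume "dependent (G ` \<sigma>)"
  then obtain u where u: "\<exists>v\<in>G ` \<sigma>. u v \<noteq> 0" "(\<Sum>v\<in>G ` \<sigma>. u v *\<^sub>R v) = 0"
    using real_vector.dependent_finite[OF finite_imageI[OF fin[OF assms]], of G] by blast
  have "(\<Sum>c\<in>\<sigma>. u (G c) *\<^sub>R G c) = 0"
    using u(2) by (simp add: sum.reindex[OF inj_on_rays[OF assms]])
  \<comment> \<open>The positive and negative parts of a dependency are non-negative combinations
    with the same value and disjoint supports; \<open>uniq\<close> makes them equal, hence
    zero.\<close>
  define a where "a c = (if c \<in> \<sigma> then max (u (G c)) 0 else 0)" for c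
  define b where "b c = (if c \<in> \<sigma> then max (- u (G c)) 0 else 0)" for c
  have "(\<Sum>c\<in>\<sigma>. a c *\<^sub>R G c) - (\<Sum>c\<in>\<sigma>. b c *\<^sub>R G c) = (\<Sum>c\<in>\<sigma>. u (G c) *\<^sub>R G c)"
    unfolding sum_subtractf[symmetric] scaleR_diff_left[symmetric]
    by (rule sum.cong) (auto simp: a_def b_def)
  then have "a = b"
    using \<open>(\<Sum>c\<in>\<sigma>. u (G c) *\<^sub>R G c) = 0\<close>
    by (intro uniq[OF assms assms]) (auto simp: a_def b_def)
  have "u (G c) = 0" if "c \<in> \<sigma>" for c
    using that fun_cong[OF \<open>a = b\<close>, of c] by (auto simp: a_def b_def max_def split: if_splits)
  then show False using u(1) by blast
qed

lemma subspace_of_cone_on: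
  assumes "\<sigma> \<in> \<Delta>" "subspace V" "V \<subseteq> cone_on \<sigma>" shows "V = {0}"
proof -
  have "v = 0" if v: "v \<in> V" for v
  proof -
    have "- v \<in> V" using v assms(2) by (rule subspace_neg[rotated])
    then obtain b where b: "- v = (\<Sum>c\<in>\<sigma>. b c *\<^sub>R G c)" "\<And>c. (0::real) \<le> b c" "\<And>c. c \<notin> \<sigma> \<Longrightarrow> b c = 0"
      using assms cone_onE by blast
    obtain a where a: "v = (\<Sum>c\<in>\<sigma>. a c *\<^sub>R G c)" "\<And>c. (0::real) \<le> a c" "\<And>c. c \<notin> \<sigma> \<Longrightarrow> a c = 0"
      using v assms cone_onE by blast
    have "(\<Sum>c\<in>\<sigma>. (a c + b c) *\<^sub>R G c) = v + (- v)"
      unfolding b(1) unfolding a(1) by (simp add: scaleR_add_left sum.distrib)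
    then have "(\<lambda>c. a c + b c) = (\<lambda>_. 0)"
      using a b by (intro uniq[OF assms(1,1)]) auto
    then have "a c = 0" for c using a(2)[of c] b(2)[of c] by (metis add_nonneg_eq_0_iff)
    then show ?thesis unfolding a(1) by simp
  qed
  then show ?thesis using subspace_0[OF assms(2)] by blast
qed

theorem simplicial_fan_of_cones:
  assumes N: "lattice_finite_rank N" and G: "\<And>\<sigma> c. \<sigma> \<in> \<Delta> \<Longrightarrow> c \<in> \<sigma> \<Longrightarrow> G c \<in> N"
  shows "polyhedral_fan N (cone_on ` \<Delta>) \<and> rational_fan N (cone_on ` \<Delta>) \<and> simplicial_fan (cone_on ` \<Delta>)"
proof -
  have rat: "finite (G ` \<sigma>)" "G ` \<sigma> \<subseteq> N" if "\<sigma> \<in> \<Delta>" for \<sigma>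
    using that G fin by auto
  have sc: "strongly_convex_polyhedral_cone N (cone_on \<sigma>)" if "\<sigma> \<in> \<Delta>" for \<sigma>
    unfolding strongly_convex_polyhedral_cone_def
  proof (intro conjI allI impI)
    show "\<exists>S. finite S \<and> S \<subseteq> span N \<and> cone_on \<sigma> = convex_cone hull S"
      by (intro exI[of _ "G ` \<sigma>"] conjI refl rat(1)[OF that] order_trans[OF rat(2)[OF that] span_superset])
    show "V = {0}" if "subspace V \<and> V \<subseteq> cone_on \<sigma>" for V
      using that subspace_of_cone_on[OF \<open>\<sigma> \<in> \<Delta>\<close>] by simp
  qed
  have fc: "F \<in> cone_on ` \<Delta>" if "\<sigma> \<in> \<Delta>" "cone_face F (cone_on \<sigma>)" for \<sigma> F
    using cone_face_cone_onE[OF that] sub[OF that(1)] by blast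
  have ic: "cone_face (cone_on \<sigma> \<inter> cone_on \<tau>) (cone_on \<sigma>)" "cone_face (cone_on \<sigma> \<inter> cone_on \<tau>) (cone_on \<tau>)"
    if "\<sigma> \<in> \<Delta>" "\<tau> \<in> \<Delta>" for \<sigma> \<tau>
    unfolding cone_on_Int[OF that] using that by (simp_all add: cone_face_cone_on)
  have "polyhedral_fan N (cone_on ` \<Delta>)"
    unfolding polyhedral_fan_def
  proof (intro conjI ballI allI impI)
    show "lattice_finite_rank N" by (rule N)
    fix \<sigma>' assume "\<sigma>' \<in> cone_on ` \<Delta>"
    then obtain \<sigma> where \<sigma>: "\<sigma>' = cone_on \<sigma>" "\<sigma> \<in> \<Delta>" by (rule imageE)
    show "strongly_convex_polyhedral_cone N \<sigma>'" unfolding \<sigma>(1) using \<sigma>(2) by (rule sc)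
    show "F \<in> cone_on ` \<Delta>" if "cone_face F \<sigma>'" for F using \<sigma>(2) that unfolding \<sigma>(1) by (rule fc)
    fix \<tau>' assume "\<tau>' \<in> cone_on ` \<Delta>"
    then obtain \<tau> where \<tau>: "\<tau>' = cone_on \<tau>" "\<tau> \<in> \<Delta>" by (rule imageE)
    show "cone_face (\<sigma>' \<inter> \<tau>') \<sigma>'" "cone_face (\<sigma>' \<inter> \<tau>') \<tau>'"
      unfolding \<sigma>(1) \<tau>(1) using \<sigma>(2) \<tau>(2) by (rule ic)+
  qed
  moreover have "rational_fan N (cone_on ` \<Delta>)"
    unfolding rational_fan_def by (intro ballI; elim imageE; hypsubst) (use rat in metis)
  moreover have "simplicial_fan (cone_on ` \<Delta>)"
    unfolding simplicial_fan_def by (intro ballI; elim imageE; hypsubst) (use independent_rays in metis)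
  ultimately show ?thesis by blast
qed

end

section \<open>Integral vectors among finitely supported real functions\<close>

lemma lookup_scaleR [simp]: "Poly_Mapping.lookup (r *\<^sub>R x) i = r * Poly_Mapping.lookup x i"
  for x :: "'a \<Rightarrow>\<^sub>0 real"
proof -
  have "finite {i. r *\<^sub>R Poly_Mapping.lookup x i \<noteq> 0}"
    by (rule finite_subset[OF _ finite_lookup[of x]]) auto
  then show ?thesis unfolding scaleR_poly_mapping_def by (simp add: Abs_poly_mapping_inverse)
qed

lemma lookup_tensor_real [simp]: "Poly_Mapping.lookup (tensor_real v) i = real_of_int (Poly_Mapping.lookup v i)"
  unfolding tensor_real_def by (simp add: Poly_Mapping.map.rep_eq when_def)

lemma lattice_finite_rank_tensor_real:
  assumes S: "finite S" shows "lattice_finite_rank (tensor_real ` {v. Poly_Mapping.keys v \<subseteq> S})"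
proof -
  let ?e = "\<lambda>s::'a. Poly_Mapping.single s (1::real)"
  have inj: "inj_on ?e S" by (rule inj_onI) (metis lookup_single_eq lookup_single_not_eq zero_neq_one)
  have lk: "Poly_Mapping.lookup (\<Sum>s\<in>S. f s *\<^sub>R ?e s) t = (if t \<in> S then f t else 0)" for f :: "'a \<Rightarrow> real" and t
  proof -
    have "Poly_Mapping.lookup (\<Sum>s\<in>S. f s *\<^sub>R ?e s) t = (\<Sum>s\<in>S. if s = t then f s else 0)"
      unfolding lookup_sum by (rule sum.cong) (auto simp: lookup_single when_def)
    then show ?thesis using S by simp
  qed
  have "independent (?e ` S)"
  proof
    assume "dependent (?e ` S)"
    then obtain u where u: "\<exists>v\<in>?e ` S. u v \<noteq> 0" "(\<Sum>v\<in>?e ` S. u v *\<^sub>R v) = 0"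
      using real_vector.dependent_finite[OF finite_imageI[OF S], of ?e] by blast
    then have "(\<Sum>s\<in>S. u (?e s) *\<^sub>R ?e s) = 0" by (simp add: sum.reindex[OF inj])
    then have "u (?e s) = 0" if "s \<in> S" for s using lk[of "\<lambda>s. u (?e s)" s] that by simp
    then show False using u(1) by blast
  qed
  moreover have "tensor_real ` {v. Poly_Mapping.keys v \<subseteq> S} =
      {v. \<exists>c :: _ \<Rightarrow> int. v = (\<Sum>b\<in>?e ` S. real_of_int (c b) *\<^sub>R b)}" (is "?A = ?B")
  proof
    show "?A \<subseteq> ?B"
    proof
      fix w assume "w \<in> ?A"
      then obtain v where v: "Poly_Mapping.keys v \<subseteq> S" "w = tensor_real v" by blast
      \<comment> \<open>\<open>lattice_finite_rank\<close> indexes integral coefficients by the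
        basis vectors themselves, hence the inverse of \<open>?e\<close>.\<close>
      define c where "c b = Poly_Mapping.lookup v (the_inv_into S ?e b)" for b
      have c: "c (?e s) = Poly_Mapping.lookup v s" if "s \<in> S" for s
        unfolding c_def using the_inv_into_f_f[OF inj that] by simp
      have "w = (\<Sum>s\<in>S. real_of_int (c (?e s)) *\<^sub>R ?e s)"
        by (rule poly_mapping_eqI) (use v c in \<open>auto simp: lk in_keys_iff\<close>)
      then have "w = (\<Sum>b\<in>?e ` S. real_of_int (c b) *\<^sub>R b)" by (simp add: sum.reindex[OF inj])
      then show "w \<in> ?B" by blast
    qed
    show "?B \<subseteq> ?A"
    proof
      fix w assume "w \<in> ?B"
      then obtain c :: "_ \<Rightarrow> int" where w: "w = (\<Sum>s\<in>S. real_of_int (c (?e s)) *\<^sub>R ?e s)"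
        by (auto simp: sum.reindex[OF inj])
      define v where "v = Abs_poly_mapping (\<lambda>s. if s \<in> S then c (?e s) else 0)"
      have v: "Poly_Mapping.lookup v = (\<lambda>s. if s \<in> S then c (?e s) else 0)"
        unfolding v_def by (rule Abs_poly_mapping_inverse) (use S in simp)
      have "w = tensor_real v" by (rule poly_mapping_eqI) (simp add: w lk v)
      moreover have "Poly_Mapping.keys v \<subseteq> S" by (auto simp: in_keys_iff v split: if_splits)
      ultimately show "w \<in> ?A" by blast
    qed
  qed
  ultimately show ?thesis unfolding lattice_finite_rank_def using S by (intro exI[of _ "?e ` S"]) simp
qed

section \<open>The g-vector fan\<close>

text \<open>The class in the split Grothendieck group of an object with Krull-Schmidt multiset
  \<open>M\<close>. As the group is free on the indecomposables, nothing is lost.\<close>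

definition frag_of_mset :: "'a multiset \<Rightarrow> ('a \<Rightarrow>\<^sub>0 int)" where
  "frag_of_mset M = (\<Sum>c\<in>#M. frag_of c)"

lemma frag_of_mset_add: "frag_of_mset (M + N) = frag_of_mset M + frag_of_mset N"
  by (simp add: frag_of_mset_def)

lemma lookup_frag_of_mset: "Poly_Mapping.lookup (frag_of_mset M) c = int (count M c)"
  by (induction M) (auto simp: frag_of_mset_def lookup_add)

lemma inj_frag_of_mset: "frag_of_mset M = frag_of_mset N \<Longrightarrow> M = N"
  by (rule multiset_eqI) (metis lookup_frag_of_mset of_nat_eq_iff)

lemma keys_frag_of_mset: "Poly_Mapping.keys (frag_of_mset M) = set_mset M"
  by (auto simp: in_keys_iff lookup_frag_of_mset count_eq_zero_iff)

context krull_schmidt_category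
begin

lemma K0_class_eq: "K0_class C X = frag_of_mset (ks X)"
proof -
  have *: "(\<Sum>Y\<leftarrow>Xs. frag_of (iso_class C Y)) = frag_of_mset (ks X)"
    if Xs: "direct_sum C X Xs" "\<forall>Y \<in> set Xs. indecomposable C Y" for Xs
  proof -
    have "sum_list (map ks Ys) = mset (map (iso_class C) Ys)" if "\<forall>Y \<in> set Ys. indecomposable C Y" for Ys
      using that by (induction Ys) (auto simp: indecomposable_iff_ks)
    then have "ks X = mset (map (iso_class C) Xs)" using ks_direct_sum[OF Xs(1)] Xs(2) by simp
    then show ?thesis
      unfolding frag_of_mset_def by (simp add: sum_mset_sum_list[symmetric] multiset.map_comp o_def)
  qed
  obtain Xs where Xs: "direct_sum C X Xs" "\<And>Y. Y \<in> set Xs \<Longrightarrow> local_end C Y"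
    using ex_local_decomposition by blast
  then have "\<forall>Y \<in> set Xs. indecomposable C Y" using ks_local indecomposable_iff_ks by blast
  then have ex: "\<exists>v Xs. direct_sum C X Xs \<and> (\<forall>Y \<in> set Xs. indecomposable C Y) \<and>
      v = (\<Sum>Y\<leftarrow>Xs. frag_of (iso_class C Y))" using Xs(1) by blast
  show ?thesis unfolding K0_class_def using someI_ex[OF ex] * by metis
qed

end

locale projective_silting = krull_schmidt_extriangulated C
  for C :: "('k::field, 'o, 'm::ab_group_add, 'e::ab_group_add, 'z) extricat_scheme" (structure) +
  fixes T :: 'o
  assumes hom_finite: "hom_finite C" and hereditary: "hereditary C"
    and projective_T: "projective C T" and silting_T: "silting C T"
begin

lemma ex_resolution:
  obtains T1 T0 where "T1 \<in> add_of C T" "T0 \<in> add_of C T" "confl T1 T0 X"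
  using resolved_UNIV[OF projective_T hereditary silting_T] unfolding resolved_def by blast

lemma projective_add_of: "X \<in> add_of C T \<Longrightarrow> projective C X"
  using projective_of_ks_subset[OF projective_T] add_of_iff_ks by blast

text \<open>Schanuel's lemma applied to two resolutions of \<open>X\<close> shows that their
  differences of classes agree, so the choice made in \<open>ind\<close> is harmless.\<close>

lemma ind_eq:
  assumes "T1 \<in> add_of C T" "T0 \<in> add_of C T" "confl T1 T0 X"
  shows "ind C T X = frag_of_mset (ks T0) - frag_of_mset (ks T1)"
proof -
  have *: "K0_class C S0 - K0_class C S1 = frag_of_mset (ks T0) - frag_of_mset (ks T1)"
    if S: "S1 \<in> add_of C T" "S0 \<in> add_of C T" "etri C S1 S0 X x y \<delta>" for S1 S0 x y \<delta>
  proof -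
    have "ks S1 + ks T0 = ks T1 + ks S0"
      by (rule schanuel[OF conflI[OF S(3)] assms(3)])
        (use projective_add_of[OF assms(2)] projective_add_of[OF S(2)] in \<open>auto simp: projective_def\<close>)
    then have "frag_of_mset (ks S1) + frag_of_mset (ks T0) = frag_of_mset (ks T1) + frag_of_mset (ks S0)"
      by (metis frag_of_mset_add)
    then show ?thesis unfolding K0_class_eq by (simp add: algebra_simps)
  qed
  obtain x y \<delta> where e: "etri C T1 T0 X x y \<delta>" using assms(3) by (rule conflE)
  have "\<exists>v T1 T0 x y \<delta>. T1 \<in> add_of C T \<and> T0 \<in> add_of C T \<and>
     etri C T1 T0 X x y \<delta> \<and> v = K0_class C T0 - K0_class C T1"
    by (rule exI, rule exI[of _ T1], rule exI[of _ T0], rule exI[of _ x], rule exI[of _ y], rule exI[of _ \<delta>])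
      (simp add: assms(1,2) e)
  then show ?thesis
    unfolding ind_def by (rule someI2_ex) (elim exE conjE, simp add: *)
qed

lemma ind_iso:
  assumes "ks X = ks Y" shows "ind C T X = ind C T Y"
proof -
  obtain T1 T0 where X: "T1 \<in> add_of C T" "T0 \<in> add_of C T" "confl T1 T0 X" by (rule ex_resolution)
  have "confl T1 T0 Y"
    by (rule confl_iso[OF X(3) isomorphic_refl isomorphic_refl]) (simp add: isomorphic_iff_ks assms)
  then show ?thesis using ind_eq[OF X] ind_eq[OF X(1,2)] by simp
qed

lemma ind_sum:
  assumes "ks X = ks A + ks B" shows "ind C T X = ind C T A + ind C T B"
proof -
  obtain S1 S0 where A: "S1 \<in> add_of C T" "S0 \<in> add_of C T" "confl S1 S0 A" by (rule ex_resolution)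
  obtain R1 R0 where B: "R1 \<in> add_of C T" "R0 \<in> add_of C T" "confl R1 R0 B" by (rule ex_resolution)
  obtain T1 where T1: "ks T1 = ks S1 + ks R1" using ex_ks by blast
  obtain T0 where T0: "ks T0 = ks S0 + ks R0" using ex_ks by blast
  have "confl T1 T0 X"
    by (rule confl_sum[OF A(3) B(3)]) (simp_all add: direct_sum2_iff_ks T1 T0 assms)
  moreover have "T1 \<in> add_of C T" "T0 \<in> add_of C T" using A B T1 T0 by (simp_all add: add_of_iff_ks)
  ultimately show ?thesis using ind_eq ind_eq[OF A] ind_eq[OF B] T1 T0 by (simp add: frag_of_mset_add)
qed

text \<open>A set \<open>c\<close> that is not an isomorphism class still receives the index of some
  object, so every value is supported on \<open>ks T\<close>.\<close>

definition ind_class :: "'o set \<Rightarrow> ('o set \<Rightarrow>\<^sub>0 int)" where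
  "ind_class c = ind C T (SOME Y. iso_class C Y = c)"

lemma ind_class_eq: "ind_class (iso_class C X) = ind C T X"
proof -
  have "iso_class C (SOME Y. iso_class C Y = iso_class C X) = iso_class C X" by (rule someI) simp
  then show ?thesis unfolding ind_class_def using ind_iso iso_class_eq_iff isomorphic_iff_ks by metis
qed

lemma ind_eq_sum: "ind C T X = (\<Sum>c\<in>#ks X. ind_class c)"
proof (induction "ks X" arbitrary: X)
  case empty
  have "X \<in> add_of C T" using empty add_of_iff_ks by simp
  then have "ind C T X = frag_of_mset (ks X) - frag_of_mset (ks X)"
    using ind_eq[of X X X] confl_idn_zero[of X X] empty zero_object_iff_ks by simp
  then show ?case using empty by simp
next
  case (add c M)
  obtain Y S where Y: "local_end C Y" "iso_class C Y = c" "direct_sum C X [Y, S]"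
    using mem_ks_split[of c X] add.hyps(2) by (metis union_single_eq_member)
  have X: "ks X = ks Y + ks S" using ks_direct_sum2[OF Y(3)] .
  have kY: "ks Y = {#c#}" using ks_local[OF Y(1)] Y(2) by simp
  then have S: "M = ks S" using add.hyps(2) X by simp
  have "ind C T X = ind C T Y + ind C T S" using ind_sum[OF X] .
  also have "ind C T Y = ind_class c" unfolding Y(2)[symmetric] ind_class_eq ..
  also have "ind C T S = (\<Sum>c\<in>#ks S. ind_class c)" using add.hyps(1)[OF S] .
  finally show ?case unfolding X kY by simp
qed

lemma keys_ind: "Poly_Mapping.keys (ind C T X) \<subseteq> set_mset (ks T)"
proof -
  obtain T1 T0 where X: "T1 \<in> add_of C T" "T0 \<in> add_of C T" "confl T1 T0 X" by (rule ex_resolution)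
  have "Poly_Mapping.keys (ind C T X) \<subseteq> set_mset (ks T0) \<union> set_mset (ks T1)"
    unfolding ind_eq[OF X] using keys_diff[of "frag_of_mset (ks T0)" "frag_of_mset (ks T1)"]
    by (simp add: keys_frag_of_mset)
  then show ?thesis using X by (auto simp: add_of_iff_ks)
qed

lemma presilting_ind_eq:
  assumes "presilting C U" "presilting C V" "ind C T U = ind C T V"
  shows "ks U = ks V"
proof -
  obtain T1 T0 where U: "T1 \<in> add_of C T" "T0 \<in> add_of C T" "confl T1 T0 U" by (rule ex_resolution)
  obtain S1 S0 where V: "S1 \<in> add_of C T" "S0 \<in> add_of C T" "confl S1 S0 V" by (rule ex_resolution)
  have "frag_of_mset (ks T0 + ks S1) = frag_of_mset (ks S0 + ks T1)"
    using assms(3) unfolding ind_eq[OF U] ind_eq[OF V] frag_of_mset_add by (simp add: algebra_simps)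
  then have "ks T0 + ks S1 = ks S0 + ks T1" by (rule inj_frag_of_mset)
  then show ?thesis
    using presilting_ks_eq[OF hom_finite hereditary assms(1,2) U(3) V(3) projective_add_of[OF U(2)] projective_add_of[OF V(1)]]
    by blast
qed

text \<open>Multiplicities are forgotten, because a g-cone depends only on which indecomposable
  summands occur.\<close>

definition presilting_complex :: "'o set set set" where
  "presilting_complex = {set_mset (ks X) | X. presilting C X}"

definition g_class :: "'o set \<Rightarrow> ('o set \<Rightarrow>\<^sub>0 real)" where
  "g_class c = tensor_real (ind_class c)"

text \<open>All objects of add(\<open>X\<close>) are presilting, so multiplicities on the summands
  can be prescribed freely. Rounded coefficients thereby become presilting objects.\<close>

lemma ex_presilting_of_nat:
  fixes m :: "'o set \<Rightarrow> nat"
  assumes "presilting C X" "\<And>c. c \<notin> set_mset (ks X) \<Longrightarrow> m c = 0"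
  shows "\<exists>Y. presilting C Y \<and> count (ks Y) = m"
proof -
  have fin: "finite {c. 0 < m c}"
    by (rule finite_subset[of _ "set_mset (ks X)"]) (use assms(2) in force)+
  define M where "M = Abs_multiset m"
  have M: "count M = m" unfolding M_def by (rule count_Abs_multiset[OF fin])
  have sub: "set_mset M \<subseteq> set_mset (ks X)" using assms(2) M by (metis count_eq_zero_iff subsetI)
  have "\<exists>Y. ks Y = M" by (rule ex_ks_sub) (use sub in blast)
  then obtain Y where Y: "ks Y = M" by blast
  then have "presilting C Y" using presilting_add_of[OF assms(1)] sub by simp
  then show ?thesis using Y M by blast
qed

lemma lookup_ind:
  assumes "finite J" "set_mset (ks X) \<subseteq> J"
  shows "Poly_Mapping.lookup (ind C T X) x = (\<Sum>c\<in>J. int (count (ks X) c) * Poly_Mapping.lookup (ind_class c) x)"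
proof -
  have "Poly_Mapping.lookup (\<Sum>c\<in>#M. ind_class c) x = (\<Sum>c\<in>J. int (count M c) * Poly_Mapping.lookup (ind_class c) x)"
    if "set_mset M \<subseteq> J" for M
    using that
  proof (induction M)
    case (add d M)
    have "(\<Sum>c\<in>J. int (count (add_mset d M) c) * Poly_Mapping.lookup (ind_class c) x) =
        (\<Sum>c\<in>J. (if c = d then Poly_Mapping.lookup (ind_class c) x else 0) + int (count M c) * Poly_Mapping.lookup (ind_class c) x)"
      by (rule sum.cong) (auto simp: algebra_simps)
    then show ?case using add assms(1) by (simp add: lookup_add sum.distrib)
  qed simp
  then show ?thesis unfolding ind_eq_sum using assms(2) .
qed

sublocale fan: unique_nonneg_combinations presilting_complex g_class
proof
  show "finite \<sigma>" if "\<sigma> \<in> presilting_complex" for \<sigma> using that unfolding presilting_complex_def by auto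
  show "\<rho> \<in> presilting_complex" if \<sigma>: "\<sigma> \<in> presilting_complex" and \<rho>: "\<rho> \<subseteq> \<sigma>" for \<sigma> \<rho>
  proof -
    obtain X where X: "presilting C X" "\<sigma> = set_mset (ks X)" using \<sigma> unfolding presilting_complex_def by blast
    have "\<exists>Y. presilting C Y \<and> count (ks Y) = (\<lambda>c. if c \<in> \<rho> then 1 else 0)"
      by (rule ex_presilting_of_nat[OF X(1)]) (use \<rho> X(2) in auto)
    then obtain Y where Y: "presilting C Y" "count (ks Y) = (\<lambda>c. if c \<in> \<rho> then 1 else 0)" by (elim exE conjE)
    have "set_mset (ks Y) = \<rho>" unfolding set_mset_def Y(2) by auto
    then show ?thesis using Y(1) unfolding presilting_complex_def by blast
  qed
  fix \<sigma> \<tau> :: "'o set set" and a b :: "'o set \<Rightarrow> real"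
  assume \<sigma>: "\<sigma> \<in> presilting_complex" and \<tau>: "\<tau> \<in> presilting_complex"
    and a: "\<And>c. 0 \<le> a c" "\<And>c. c \<notin> \<sigma> \<Longrightarrow> a c = 0" and b: "\<And>c. 0 \<le> b c" "\<And>c. c \<notin> \<tau> \<Longrightarrow> b c = 0"
    and eq: "(\<Sum>c\<in>\<sigma>. a c *\<^sub>R g_class c) = (\<Sum>c\<in>\<tau>. b c *\<^sub>R g_class c)"
  obtain U where U: "presilting C U" "\<sigma> = set_mset (ks U)" using \<sigma> unfolding presilting_complex_def by blast
  obtain V where V: "presilting C V" "\<tau> = set_mset (ks V)" using \<tau> unfolding presilting_complex_def by blast
  let ?J = "\<sigma> \<union> \<tau>"
  let ?z = "\<lambda>c x. Poly_Mapping.lookup (ind_class c) x"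
  have J: "finite ?J" using U V by simp
  \<comment> \<open>Summing over all keys gives one bound valid in every coordinate
    \<open>x\<close>.\<close>
  define L where "L = (\<Sum>c\<in>?J. \<Sum>x\<in>Poly_Mapping.keys (ind_class c). \<bar>real_of_int (?z c x)\<bar>)"
  show "a = b"
  proof (rule real_relation_from_nat_relations[OF J, where z = ?z and L = L and \<sigma> = \<sigma> and \<tau> = \<tau>])
    show "(\<Sum>c\<in>?J. \<bar>real_of_int (?z c x)\<bar>) \<le> L" for x
      unfolding L_def
    proof (rule sum_mono)
      fix c
      show "\<bar>real_of_int (?z c x)\<bar> \<le> (\<Sum>x\<in>Poly_Mapping.keys (ind_class c). \<bar>real_of_int (?z c x)\<bar>)"
      proof (cases "x \<in> Poly_Mapping.keys (ind_class c)")
        case True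
        then show ?thesis by (intro member_le_sum) auto
      next
        case False
        then show ?thesis by (simp add: in_keys_iff sum_nonneg)
      qed
    qed
    show "(\<Sum>c\<in>?J. a c * real_of_int (?z c x)) = (\<Sum>c\<in>?J. b c * real_of_int (?z c x))" for x
    proof -
      have "(\<Sum>c\<in>?J. a c * real_of_int (?z c x)) = (\<Sum>c\<in>\<sigma>. a c * real_of_int (?z c x))"
        by (rule sum.mono_neutral_right[OF J]) (use a in auto)
      also have "\<dots> = Poly_Mapping.lookup (\<Sum>c\<in>\<sigma>. a c *\<^sub>R g_class c) x" by (simp add: lookup_sum g_class_def)
      also have "\<dots> = (\<Sum>c\<in>\<tau>. b c * real_of_int (?z c x))" unfolding eq by (simp add: lookup_sum g_class_def)
      also have "\<dots> = (\<Sum>c\<in>?J. b c * real_of_int (?z c x))"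
        by (rule sum.mono_neutral_left[OF J]) (use b in auto)
      finally show ?thesis .
    qed
    \<comment> \<open>Read as multiplicities, \<open>m\<close> and \<open>n\<close> belong to
      presilting objects, and agreement in all coordinates is equality of their indices;
      \<open>presilting_ind_eq\<close> then applies.\<close>
    show "m = n"
      if m: "\<And>c. c \<notin> \<sigma> \<Longrightarrow> m c = 0" and n: "\<And>c. c \<notin> \<tau> \<Longrightarrow> n c = 0"
        and mn: "\<And>x. (\<Sum>c\<in>?J. int (m c) * ?z c x) = (\<Sum>c\<in>?J. int (n c) * ?z c x)" for m n :: "'o set \<Rightarrow> nat"
    proof -
      have "\<exists>X. presilting C X \<and> count (ks X) = m"
        by (rule ex_presilting_of_nat[OF U(1)]) (use m U(2) in simp)
      then obtain X where X: "presilting C X" "count (ks X) = m" by (elim exE conjE)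
      have "\<exists>Y. presilting C Y \<and> count (ks Y) = n"
        by (rule ex_presilting_of_nat[OF V(1)]) (use n V(2) in simp)
      then obtain Y where Y: "presilting C Y" "count (ks Y) = n" by (elim exE conjE)
      have "set_mset (ks X) \<subseteq> ?J" "set_mset (ks Y) \<subseteq> ?J"
        using m n unfolding set_mset_def X(2) Y(2) by force+
      then have "ind C T X = ind C T Y"
        using mn by (intro poly_mapping_eqI) (simp add: lookup_ind[OF J] X(2) Y(2))
      then have "ks X = ks Y" using presilting_ind_eq X(1) Y(1) by blast
      then show ?thesis using X(2) Y(2) by simp
    qed
  qed (use a b in auto)
qed

lemma set_mset_ks: "set_mset (ks X) = iso_class C ` {Y. indecomposable C Y \<and> summand C Y X}"
  by (auto simp: mem_ks_iff)

lemma g_cone_eq: "g_cone C T X = fan.cone_on (set_mset (ks X))"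
proof -
  have "g_vector C T Y = g_class (iso_class C Y)" for Y
    unfolding g_vector_def g_class_def ind_class_eq ..
  then have "g_vector C T ` {Y. indecomposable C Y \<and> summand C Y X} = g_class ` set_mset (ks X)"
    unfolding set_mset_ks by (simp add: image_image)
  then show ?thesis unfolding g_cone_def by simp
qed

lemma g_fan_eq: "g_fan C T = fan.cone_on ` presilting_complex"
  unfolding g_fan_def presilting_complex_def g_cone_eq by blast

lemma K0_lattice_eq: "K0_lattice C T = tensor_real ` {v. Poly_Mapping.keys v \<subseteq> set_mset (ks T)}"
  unfolding K0_lattice_def K0_def set_mset_ks by (simp add: free_Abelian_group_def)

lemma g_class_in_lattice:
  assumes "\<sigma> \<in> presilting_complex" "c \<in> \<sigma>" shows "g_class c \<in> K0_lattice C T"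
  unfolding K0_lattice_eq g_class_def ind_class_def using keys_ind by blast

lemma simplicial_g_fan:
  "polyhedral_fan (K0_lattice C T) (g_fan C T) \<and> rational_fan (K0_lattice C T) (g_fan C T) \<and>
    simplicial_fan (g_fan C T)"
  unfolding g_fan_eq
  by (rule fan.simplicial_fan_of_cones[OF _ g_class_in_lattice])
    (simp_all add: K0_lattice_eq lattice_finite_rank_tensor_real)

end

theorem theorem3p5:
  fixes C :: "('k::field, 'o, 'm::ab_group_add, 'e::ab_group_add) extricat"
    and T :: 'o
  assumes "extriangulated_category C"
    and "hom_finite C"
    and "krull_schmidt C"
    and "zero_auslander C"
    and "basic C T"
    and "projective C T"
    and "silting C T"
  shows "polyhedral_fan (K0_lattice C T) (g_fan C T) \<and>
    rational_fan (K0_lattice C T) (g_fan C T) \<and>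
    simplicial_fan (g_fan C T)"
proof -
  interpret extriangulated_category C by fact
  interpret projective_silting C T
    by unfold_locales (use assms in \<open>auto simp: zero_auslander_def\<close>)
  show ?thesis by (rule simplicial_g_fan)
qed

end
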